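(* Let $\mu\in\mathcal{M}_{\sigma}(I^{\mathbb{N}})$ with $h_{\mu}<\infty$, and assume $\sup_{i\in I}\|A_i\|<\tfrac12$. Then for $\boldsymbol{m}$-almost every $\mathbf{a}\in\mathbf{Q}^{I}$ the following holds: for $\mu$-almost every $\mathtt{i}\in I^{\mathbb{N}}$ for which there exists $s\in[0,\infty)$ with $-\infty<P_{\mu}(s,\mathtt{i})<0$, the local dimension $\dim_{\mathrm{loc}}(\pi_{\mathbf a}\mu,\pi_{\mathbf a}(\mathtt{i}))$ exists and $$\dim_{\mathrm{loc}}(\pi_{\mathbf a}\mu,\pi_{\mathbf a}(\mathtt{i}))=\min\{d,\dim_{LY}(\mu,\mathtt{i})\}.$$ In particular, if $\mu$ is ergodic, $h_\mu<\infty$ and $-\infty<P_\mu(s)<0$ for some $s$, then $\pi_{\mathbf a}\mu$ is exactly dimensional with local dimension $\min\{d,\dim_{LY}(\mu)\}$ for $\boldsymbol m$-a.e. $\mathbf a$.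
   Context: Let $I$ be a finite or countably infinite set, $I^{\mathbb{N}}$ the space of infinite sequences $\mathtt{i}=(i_1,i_2,\ldots)$ with the product of discrete topologies and its Borel $\sigma$-algebra. Write $\mathtt{i}|_n=(i_1,\ldots,i_n)$, $[j_1\ldots j_n]=\{\mathtt{i}: \mathtt{i}|_n=(j_1,\dots,j_n)\}$ (cylinder), and $\sigma(i_1,i_2,\ldots)=(i_2,i_3,\ldots)$ (left shift). $\mathcal{M}_\sigma(I^{\mathbb N})$ denotes the $\sigma$-invariant Borel probability measures and $\mathcal{E}_\sigma(I^{\mathbb N})$ the ergodic ones. Fix $d\ge1$; for each $i\in I$ fix an invertible real $d\times d$ matrix $A_i$, with $\sup_{i\in I}\|A_i\|<1$ (operator norm). Let $\mathbf{Q}=[-\frac12,\frac12]^d$; for a translation vector $\mathbf a=(a_i)_{i\in I}\in\mathbf Q^{I}$ put $f_i(x)=A_ix+a_i$, $f_{\mathtt i|_n}=f_{i_1}\circ\cdots\circ f_{i_n}$, and define the canonical projection $\pi_{\mathbf a}:I^{\mathbb N}\to\mathbb R^d$ by $\{\pi_{\mathbf a}(\mathtt i)\}=\bigcap_n f_{\mathtt i|_n}(B(0,R))$, where $R$ is such that $f_i(B(0,R))\subset B(0,R)$ for all $i$. $\boldsymbol m$ is the product probability measure $(\mathcal L^d|_{\mathbf Q})^{I}$ on $\mathbf Q^{I}$. $\pi_{\mathbf a}\mu=\mu\circ\pi_{\mathbf a}^{-1}$. For a finite word $\mathtt j=(j_1,\dots,j_n)$ let $\alpha_1(\mathtt j)\ge\dots\ge\alpha_d(\mathtt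 j)>0$ be the singular values of $A_{j_1}\cdots A_{j_n}$; the singular value function is $\phi^s(\mathtt j)=\alpha_1(\mathtt j)\cdots\alpha_k(\mathtt j)\alpha_{k+1}(\mathtt j)^{s-k}$ for $0\le s<d$, $k=\lfloor s\rfloor$, and $\phi^s(\mathtt j)=(\alpha_1(\mathtt j)\cdots\alpha_d(\mathtt j))^{s/d}$ for $s\ge d$. The upper/lower local dimensions of a measure $\nu$ at $x$ are $\limsup/\liminf_{r\to0}\log\nu(B(x,r))/\log r$; the local dimension $\dim_{\mathrm{loc}}(\nu,x)$ exists when they agree. Let $\mathcal P_n=\{[\mathtt j]:\mathtt j\in I^n\}$, $H(\mathcal P_n)=-\sum_{\mathtt j\in I^n}\mu[\mathtt j]\log\mu[\mathtt j]$, and entropy $h_\mu=\lim_n\frac1nH(\mathcal P_n)$. When $h_\mu<\infty$, for $\mu$-a.e. $\mathtt i$ the following limits exist: the local entropy $h_\mu(\mathtt i)=-\lim_n\frac1n\log\mu[\mathtt i|_n]<\infty$, the local energy $\Lambda_\mu(s,\mathtt i)=\lim_n\frac1n\log\phi^s(\mathtt i|_n)\in[-\infty,0]$ for all $s\ge0$, and the Lyapunov exponents $\lambda_l(\mu,\mathtt i)=\lim_n\frac1n\log\alpha_l(\mathtt i|_n)$; for ergodic $\mu$ these are a.e. constant (written $h_\mu$, $\Lambda_\mu(s)$, $\lambda_l(\mu)$). The measure-theoretical pressure is $P_\mu(s,\mathtt i)=-\lim_n\frac1n\log\frac{\mu[\mathtt i|_n]}{\phi^s(\mathtt i|_n)}=h_\mu(\mathtt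 i)+\Lambda_\mu(s,\mathtt i)$, and the local Lyapunov dimension is $\dim_{LY}(\mu,\mathtt i)=\inf\{s\ge0:P_\mu(s,\mathtt i)<0\}$ (constant $\dim_{LY}(\mu)$ a.e. for ergodic $\mu$). *)

theory Defs
  imports "HOL-Probability.Probability" "HOL-Computational_Algebra.Polynomial"
begin

(* Symbolic space I^N: sequences nat => 'i (I = UNIV :: 'i set, 'i countable),
   with the product sigma-algebra of discrete sigma-algebras (= Borel sigma-algebra
   of the product of discrete topologies, since I is countable). *)
definition seq_space :: "(nat \<Rightarrow> 'i::countable) measure" where
  "seq_space = Pi\<^sub>M UNIV (\<lambda>_. count_space UNIV)"

definition shift :: "(nat \<Rightarrow> 'i) \<Rightarrow> (nat \<Rightarrow> 'i)" where
  "shift \<omega> = (\<lambda>n. \<omega> (Suc n))"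

definition prefix :: "(nat \<Rightarrow> 'i) \<Rightarrow> nat \<Rightarrow> 'i list" where
  "prefix \<omega> n = map \<omega> [0..<n]"

definition cyl :: "'i list \<Rightarrow> (nat \<Rightarrow> 'i) set" where
  "cyl w = {x. \<forall>k<length w. x k = w ! k}"

definition invariant_prob :: "(nat \<Rightarrow> 'i::countable) measure \<Rightarrow> bool" where
  "invariant_prob \<mu> \<longleftrightarrow> prob_space \<mu> \<and> sets \<mu> = sets seq_space \<and>
     (\<forall>X\<in>sets \<mu>. emeasure \<mu> (shift -` X) = emeasure \<mu> X)"

definition ergodic_prob :: "(nat \<Rightarrow> 'i::countable) measure \<Rightarrow> bool" where
  "ergodic_prob \<mu> \<longleftrightarrow> invariant_prob \<mu> \<and>
     (\<forall>X\<in>sets \<mu>. shift -` X = X \<longrightarrow> measure \<mu> X = 0 \<or> measure \<mu> X = 1)"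

definition part_entropy :: "(nat \<Rightarrow> 'i) measure \<Rightarrow> nat \<Rightarrow> ennreal" where
  "part_entropy \<mu> n = (\<integral>\<^sup>+ w. ennreal (- measure \<mu> (cyl w) * ln (measure \<mu> (cyl w)))
        \<partial>count_space {w :: 'i list. length w = n})"

definition entropy :: "(nat \<Rightarrow> 'i) measure \<Rightarrow> ennreal" where
  "entropy \<mu> = lim (\<lambda>n. part_entropy \<mu> n / of_nat n)"

definition charpoly :: "real^'n^'n \<Rightarrow> real poly" where
  "charpoly M = det (\<chi> i j. (if i = j then [:0, 1:] else 0) - [:M $ i $ j:])"

(* singular values alpha_1 >= ... >= alpha_d (list index l-1 holds alpha_l):
   square roots of the eigenvalues (with multiplicity) of M^T M, in decreasing order *)
definition sing_vals :: "real^'n^'n \<Rightarrow> real list" where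
  "sing_vals M = map sqrt (rev (sorted_list_of_multiset (proots (charpoly (transpose M ** M)))))"

definition sv_fun :: "real \<Rightarrow> real^'n^'n \<Rightarrow> real" where
  "sv_fun s M = (let \<alpha> = sing_vals M; d = CARD('n); k = nat \<lfloor>s\<rfloor> in
     if s < real d then (\<Prod>l<k. \<alpha> ! l) * (\<alpha> ! k) powr (s - real k)
     else (\<Prod>l<d. \<alpha> ! l) powr (s / real d))"

definition word_mat :: "('i \<Rightarrow> real^'n^'n) \<Rightarrow> 'i list \<Rightarrow> real^'n^'n" where
  "word_mat A w = foldr (\<lambda>i M. A i ** M) w (mat 1)"

definition pressure :: "(nat \<Rightarrow> 'i) measure \<Rightarrow> ('i \<Rightarrow> real^'n^'n) \<Rightarrow> real \<Rightarrow> (nat \<Rightarrow> 'i) \<Rightarrow> ereal" where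
  "pressure \<mu> A s \<omega> = - lim (\<lambda>n. ereal (ln (measure \<mu> (cyl (prefix \<omega> n))
        / sv_fun s (word_mat A (prefix \<omega> n))) / real n))"

(* dim_LY(mu,i) = inf {s >= 0 : P_mu(s,i) < 0}  (inf of the empty set = infinity) *)
definition dimLY :: "(nat \<Rightarrow> 'i) measure \<Rightarrow> ('i \<Rightarrow> real^'n^'n) \<Rightarrow> (nat \<Rightarrow> 'i) \<Rightarrow> ereal" where
  "dimLY \<mu> A \<omega> = Inf (ereal ` {s. 0 \<le> s \<and> pressure \<mu> A s \<omega> < 0})"

definition ifs_map :: "('i \<Rightarrow> real^'n^'n) \<Rightarrow> ('i \<Rightarrow> real^'n) \<Rightarrow> 'i \<Rightarrow> real^'n \<Rightarrow> real^'n" where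
  "ifs_map A a i x = A i *v x + a i"

definition word_fun :: "('i \<Rightarrow> real^'n^'n) \<Rightarrow> ('i \<Rightarrow> real^'n) \<Rightarrow> 'i list \<Rightarrow> real^'n \<Rightarrow> real^'n" where
  "word_fun A a w = foldr (\<lambda>i f. ifs_map A a i \<circ> f) w id"

definition proj :: "('i \<Rightarrow> real^'n^'n) \<Rightarrow> ('i \<Rightarrow> real^'n) \<Rightarrow> (nat \<Rightarrow> 'i) \<Rightarrow> real^'n" where
  "proj A a \<omega> = (THE x. \<exists>R>0. (\<forall>i. ifs_map A a i ` cball 0 R \<subseteq> cball 0 R) \<and>
       (\<Inter>n. word_fun A a (prefix \<omega> n) ` cball 0 R) = {x})"

definition cubeQ :: "(real^'n) set" where
  "cubeQ = cbox (\<chi> _. - 1/2) (\<chi> _. 1/2)"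

definition trans_measure :: "('i \<Rightarrow> real^'n) measure" where
  "trans_measure = Pi\<^sub>M UNIV (\<lambda>_. restrict_space lborel cubeQ)"

(* log nu(B(x,r)) / log r, with log 0 = -infinity *)
definition dim_ratio :: "'a::metric_space measure \<Rightarrow> 'a \<Rightarrow> real \<Rightarrow> ereal" where
  "dim_ratio \<nu> x r = (if measure \<nu> (ball x r) = 0 then \<infinity>
       else ereal (ln (measure \<nu> (ball x r)) / ln r))"

definition lower_local_dim :: "'a::metric_space measure \<Rightarrow> 'a \<Rightarrow> ereal" where
  "lower_local_dim \<nu> x = Liminf (at_right 0) (dim_ratio \<nu> x)"

definition upper_local_dim :: "'a::metric_space measure \<Rightarrow> 'a \<Rightarrow> ereal" where
  "upper_local_dim \<nu> x = Limsup (at_right 0) (dim_ratio \<nu> x)"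

definition local_dim_eq :: "'a::metric_space measure \<Rightarrow> 'a \<Rightarrow> ereal \<Rightarrow> bool" where
  "local_dim_eq \<nu> x D \<longleftrightarrow> lower_local_dim \<nu> x = D \<and> upper_local_dim \<nu> x = D"

end

theory Submission
  imports Defs
begin

text \<open>
Let \<open>\<pi>\<close> be the coding map, \<open>w\<close> the first \<open>n\<close> symbols of \<open>\<omega>\<close> and \<open>\<mu>[w]\<close> the mass of their cylinder.

The local entropy and the exponential rates of the products of the largest \<open>k\<close> singular values
exist almost everywhere. Both follow from one tiling argument: if \<open>F (l + m) \<omega>\<close> is at most
\<open>f l \<omega> + c l + F m (shift ^ l \<omega>)\<close> with \<open>c l = o(l)\<close> and \<open>f n \<le> F n + o(n)\<close>, then most of an
orbit is covered by long blocks on which \<open>f\<close> is close to its liminf, and the maximal inequality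
controls the rest. For the singular values \<open>F = f\<close>. For the entropy, where \<open>f n = - ln (\<mu>[w])\<close> is not
subadditive, \<open>F n\<close> is minus the logarithm of a subprobability on words of length \<open>n\<close> that dominates
products of masses of consecutive blocks; by Borel-Cantelli \<open>f n \<le> F n + 2 ln n\<close> eventually.

Lower bound for the dimension. For sequences with longest common prefix \<open>w\<close>, the set of translations
that put their projections within \<open>r\<close> of each other has probability at most a constant times
\<open>r powr s / sv_fun s\<close>. Integrating, the expected mass of the \<open>r\<close>-ball around \<open>\<pi> \<omega>\<close> is at most a
constant times \<open>r powr s\<close> times the sum over \<open>n\<close> of \<open>\<mu>[w] / sv_fun s\<close>, which converges when the pressure
at \<open>s\<close> is positive.

Upper bound. The image of a cylinder lies in an ellipsoid, which is cut into about
\<open>sv_fun s / \<alpha> powr s\<close> cells whose diameter is comparable to the singular value \<open>\<alpha>\<close> with index \<open>k\<close>, where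
\<open>k < s \<le> k + 1\<close>. Cells carrying much less than the average mass are almost surely avoided
eventually, so negative pressure at \<open>s\<close> makes the ball of radius comparable to \<open>\<alpha>\<close> have mass at least
\<open>\<alpha> powr s\<close>. Finite pressure makes \<open>\<alpha>\<close> decay at an exact exponential rate, so these scales suffice.
\<close>

section \<open>Maximal inequality and almost subadditive sequences\<close>

text \<open>Randomness of the translations enters only the lower bound for the dimension. There
  \<open>\<omega>\<close> is fixed first and the integral runs over translations. The upper bound
  holds for every translation vector in the cube. As \<open>'i\<close> may be infinite, singular
  values of the \<open>A i\<close> need not be bounded away from 0, so growth rates and pressures
  can be minus infinity. Limits are therefore taken in \<open>ereal\<close>, and the tiling argument
  uses an integrable bound of \<open>f 1\<close> from above only, with the liminf truncated from
  below. Products of the largest singular values are treated as determinants with mixed columns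
  instead of norms of exterior powers; submultiplicativity then holds up to the square of a
  factorial, and a constant factor does not affect exponential rates. One covering lemma
  (\<open>box_partition\<close>) gives the volume of the set of bad translations, the cells of an
  ellipsoid and the small cubes behind the cap \<open>d\<close>. The local dimension is reached
  through \<open>dyadic_dim\<close>, a countable condition with measurable solution set, since the
  ergodic statement has to be moved from \<open>\<mu>\<close> to its image on Euclidean
  space.\<close>

locale measure_preserving_map = prob_space M for M :: "'a measure" +
  fixes T :: "'a \<Rightarrow> 'a"
  assumes T_meas [measurable]: "T \<in> measurable M M"
    and T_inv: "distr M M T = M"
begin

lemma iter_meas [measurable]: "(T ^^ n) \<in> measurable M M"
proof (induction n)
  case (Suc n)
  have "T \<circ> (T ^^ n) \<in> measurable M M"
    using Suc T_meas by (rule measurable_comp)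
  then show ?case by (simp add: comp_def)
qed auto

lemma AE_T: assumes "AE x in M. P x" shows "AE x in M. P (T x)"
proof -
  have "AE x in distr M M T. P x" unfolding T_inv by (rule assms)
  then show ?thesis by (rule AE_distrD[OF T_meas])
qed

lemma AE_orbit: assumes "AE x in M. P x" shows "AE x in M. \<forall>k. P ((T ^^ k) x)"
proof -
  have "AE x in M. P ((T ^^ k) x)" for k
  proof (induction k)
    case (Suc k)
    then have "AE x in M. P ((T ^^ k) (T x))" by (rule AE_T)
    then show ?case by (simp add: funpow_swap1)
  qed (use assms in simp)
  then show ?thesis by (simp add: AE_all_countable)
qed

lemma integral_T:
  fixes f :: "'a \<Rightarrow> real"
  assumes "integrable M f"
  shows "integrable M (\<lambda>x. f (T x))" "(\<integral>x. f (T x) \<partial>M) = (\<integral>x. f x \<partial>M)"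
proof -
  have f: "f \<in> borel_measurable M" using assms by auto
  have "integrable (distr M M T) f" using assms T_inv by simp
  then show "integrable M (\<lambda>x. f (T x))" using integrable_distr[OF T_meas] by blast
  have "(\<integral>x. f x \<partial>M) = (\<integral>x. f x \<partial>distr M M T)" using T_inv by simp
  also have "\<dots> = (\<integral>x. f (T x) \<partial>M)" by (rule integral_distr[OF T_meas f])
  finally show "(\<integral>x. f (T x) \<partial>M) = (\<integral>x. f x \<partial>M)" by simp
qed

lemma measure_T_vimage:
  assumes "{x \<in> space M. P x} \<in> sets M"
  shows "{x \<in> space M. P (T x)} \<in> sets M"
    "measure M {x \<in> space M. P (T x)} = measure M {x \<in> space M. P x}"
proof -
  have eq: "T -` {x \<in> space M. P x} \<inter> space M = {x \<in> space M. P (T x)}"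
    using measurable_space[OF T_meas] by auto
  show "{x \<in> space M. P (T x)} \<in> sets M"
    using measurable_sets[OF T_meas assms] eq by simp
  have "measure M {x \<in> space M. P x} = measure (distr M M T) {x \<in> space M. P x}" using T_inv by simp
  also have "\<dots> = measure M {x \<in> space M. P (T x)}"
    using measure_distr[OF T_meas assms] eq by simp
  finally show "measure M {x \<in> space M. P (T x)} = measure M {x \<in> space M. P x}" by simp
qed

text \<open>In a finite measure space, inclusion up to a null set between sets of equal measure is
  equality up to a null set. This is how one-sided inequalities along \<open>T\<close> become
  invariance.\<close>

lemma AE_iff_of_imp:
  assumes P: "{x \<in> space M. P x} \<in> sets M" and Q: "{x \<in> space M. Q x} \<in> sets M"
    and imp: "AE x in M. P x \<longrightarrow> Q x"
    and eq: "measure M {x \<in> space M. P x} = measure M {x \<in> space M. Q x}"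
  shows "AE x in M. P x \<longleftrightarrow> Q x"
proof -
  let ?P = "{x \<in> space M. P x}" and ?Q = "{x \<in> space M. Q x}"
  have "measure M (?P \<inter> ?Q) = measure M ?P"
    by (rule finite_measure_eq_AE) (use P Q imp in auto)
  moreover have "measure M ?Q = measure M (?Q - ?P) + measure M (?P \<inter> ?Q)"
    by (subst finite_measure_Union[symmetric]) (use P Q in \<open>auto intro!: arg_cong[where f="measure M"]\<close>)
  ultimately have "measure M (?Q - ?P) = 0" using eq by simp
  then have "AE x in M. x \<notin> ?Q - ?P"
    using P Q by (subst AE_iff_null_sets[symmetric]) (auto simp: emeasure_eq_measure intro!: null_setsI)
  then show ?thesis using imp by (auto elim: AE_mp)
qed

text \<open>A sublevel set of \<open>h\<close> and its preimage under \<open>T\<close> have equal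
  measure, and one contains the other up to a null set; rational levels separate values. Working
  with sublevel sets instead of integrals admits infinite values of \<open>h\<close>.\<close>

lemma AE_invariant_of_le:
  fixes h :: "'a \<Rightarrow> ereal"
  assumes h[measurable]: "h \<in> borel_measurable M" and le: "AE x in M. h (T x) \<le> h x"
  shows "AE x in M. h (T x) = h x"
proof -
  have "AE x in M. \<forall>q::rat. h x \<le> ereal (real_of_rat q) \<longleftrightarrow> h (T x) \<le> ereal (real_of_rat q)"
    unfolding AE_all_countable
  proof
    fix q :: rat
    have m: "{x \<in> space M. h x \<le> ereal (real_of_rat q)} \<in> sets M" by measurable
    show "AE x in M. h x \<le> ereal (real_of_rat q) \<longleftrightarrow> h (T x) \<le> ereal (real_of_rat q)"
      by (rule AE_iff_of_imp[OF m measure_T_vimage(1)[OF m] _ measure_T_vimage(2)[OF m, symmetric]])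
        (use le in \<open>auto elim!: AE_mp\<close>)
  qed
  then show ?thesis using le
  proof eventually_elim
    case (elim x)
    show ?case
    proof (rule ccontr)
      assume "h (T x) \<noteq> h x"
      then have "h (T x) < h x" using elim by simp
      then obtain q where q: "h (T x) < ereal (real_of_rat q)" "ereal (real_of_rat q) < h x"
        using ereal_dense3 by blast
      with elim(1) show False by (meson less_imp_le not_less)
    qed
  qed
qed

lemma AE_invariant_of_ge:
  fixes h :: "'a \<Rightarrow> ereal"
  assumes h[measurable]: "h \<in> borel_measurable M" and le: "AE x in M. h x \<le> h (T x)"
  shows "AE x in M. h (T x) = h x"
proof -
  have "AE x in M. - h (T x) = - h x"
    by (rule AE_invariant_of_le[of "\<lambda>x. - h x"]) (use le in auto)
  then show ?thesis by simp
qed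

section \<open>Birkhoff sums and the maximal inequality\<close>

definition birkhoff_sum :: "('a \<Rightarrow> real) \<Rightarrow> nat \<Rightarrow> 'a \<Rightarrow> real" where
  "birkhoff_sum f n x = (\<Sum>k<n. f ((T ^^ k) x))"

lemma birkhoff_sum_meas [measurable]:
  "f \<in> borel_measurable M \<Longrightarrow> birkhoff_sum f n \<in> borel_measurable M"
  unfolding birkhoff_sum_def by (intro borel_measurable_sum measurable_compose[OF iter_meas])

lemma birkhoff_sum_Suc: "birkhoff_sum f (Suc n) x = f x + birkhoff_sum f n (T x)"
  unfolding birkhoff_sum_def by (subst sum.lessThan_Suc_shift) (simp add: funpow_swap1)

lemma birkhoff_sum_add: "birkhoff_sum f (l + m) x = birkhoff_sum f l x + birkhoff_sum f m ((T ^^ l) x)"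
proof (induction l arbitrary: x)
  case 0 then show ?case by (simp add: birkhoff_sum_def)
next
  case (Suc l) then show ?case by (simp add: birkhoff_sum_Suc funpow_swap1)
qed

text \<open>The maximum of the Birkhoff sums of lengths 0 to \<open>n\<close>, written in the
  recursive form that Garsia's proof of the maximal ergodic theorem uses.\<close>

fun max_sum :: "('a \<Rightarrow> real) \<Rightarrow> nat \<Rightarrow> 'a \<Rightarrow> real" where
  "max_sum f 0 x = 0"
| "max_sum f (Suc n) x = max 0 (f x + max_sum f n (T x))"

lemma max_sum_nonneg: "0 \<le> max_sum f n x" by (cases n) auto

lemma max_sum_mono: "max_sum f n x \<le> max_sum f (Suc n) x"
proof (induction n arbitrary: x)
  case (Suc n)
  have "max 0 (f x + max_sum f n (T x)) \<le> max 0 (f x + max_sum f (Suc n) (T x))"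
    using Suc[of "T x"] by linarith
  then show ?case by (simp only: max_sum.simps(2)[of f _ x])
qed (simp add: max_sum_nonneg)

lemma max_sum_integrable: "integrable M f \<Longrightarrow> integrable M (max_sum f n)"
proof (induction n)
  case 0
  have "max_sum f 0 = (\<lambda>_. 0)" by auto
  then show ?case by simp
next
  case (Suc n)
  have "integrable M (\<lambda>x. max 0 (f x + max_sum f n (T x)))"
    using Suc integral_T(1)[of "max_sum f n"] by auto
  moreover have "max_sum f (Suc n) = (\<lambda>x. max 0 (f x + max_sum f n (T x)))" by auto
  ultimately show ?case by simp
qed

lemma birkhoff_le_max_sum: "j \<le> n \<Longrightarrow> birkhoff_sum f j x \<le> max_sum f n x"
proof (induction n arbitrary: j x)
  case 0 then show ?case by (simp add: birkhoff_sum_def)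
next
  case (Suc n)
  show ?case
  proof (cases j)
    case 0 then show ?thesis by (simp add: birkhoff_sum_def)
  next
    case (Suc j')
    with Suc.prems Suc.IH[of j' "T x"] show ?thesis by (simp add: birkhoff_sum_Suc)
  qed
qed

text \<open>Garsia's argument: where \<open>max_sum f n\<close> is positive, the recursion bounds it
  by \<open>f x + max_sum f n (T x)\<close>; elsewhere it is 0 and its value at \<open>T x\<close>
  is nonnegative. Integrating, the difference of \<open>max_sum f n\<close> and its composition with
  \<open>T\<close> has integral 0.\<close>

lemma maximal_ergodic:
  fixes f :: "'a \<Rightarrow> real"
  assumes f: "integrable M f"
  shows "0 \<le> (\<integral>x. f x * indicator {x \<in> space M. 0 < max_sum f n x} x \<partial>M)"
proof -
  have mm[measurable]: "max_sum f n \<in> borel_measurable M" and fm[measurable]: "f \<in> borel_measurable M"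
    using max_sum_integrable[OF f, of n] f by auto
  have i: "integrable M (max_sum f n)" by (rule max_sum_integrable[OF f])
  have "0 = (\<integral>x. max_sum f n x - max_sum f n (T x) \<partial>M)"
    using integral_T[OF i] i by simp
  also have "\<dots> \<le> (\<integral>x. f x * indicator {x \<in> space M. 0 < max_sum f n x} x \<partial>M)"
  proof (rule integral_mono)
    show "integrable M (\<lambda>x. max_sum f n x - max_sum f n (T x))" using integral_T[OF i] i by simp
    show "integrable M (\<lambda>x. f x * indicator {x \<in> space M. 0 < max_sum f n x} x)"
      by (rule integrable_real_mult_indicator[OF _ f]) simp
    fix x assume x: "x \<in> space M"
    show "max_sum f n x - max_sum f n (T x) \<le> f x * indicator {x \<in> space M. 0 < max_sum f n x} x"
    proof (cases "0 < max_sum f n x")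
      case True
      then obtain n' where n: "n = Suc n'" by (cases n) auto
      have "max_sum f n x = f x + max_sum f n' (T x)" using True n by (auto simp: max_def split: if_splits)
      also have "\<dots> \<le> f x + max_sum f n (T x)" using max_sum_mono[of f n' "T x"] n by simp
      finally show ?thesis using True x by simp
    next
      case False
      then show ?thesis using max_sum_nonneg[of f n x] max_sum_nonneg[of f n "T x"] by simp
    qed
  qed
  finally show ?thesis .
qed

text \<open>\<open>maximal_ergodic\<close> for \<phi> - \<kappa>, whose Birkhoff sum is positive
  exactly when that of \<phi> exceeds \<kappa> n; the horizon \<open>N\<close> then tends to
  infinity.\<close>

lemma maximal_inequality:
  fixes \<phi> :: "'a \<Rightarrow> real" and \<kappa> :: real
  assumes \<phi>: "integrable M \<phi>" "\<And>x. 0 \<le> \<phi> x" and \<kappa>: "0 < \<kappa>"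
  shows "{x \<in> space M. \<exists>n. birkhoff_sum \<phi> n x > \<kappa> * n} \<in> sets M"
    "measure M {x \<in> space M. \<exists>n. birkhoff_sum \<phi> n x > \<kappa> * n} \<le> (\<integral>x. \<phi> x \<partial>M) / \<kappa>"
proof -
  have [measurable]: "\<phi> \<in> borel_measurable M" using \<phi> by auto
  let ?f = "\<lambda>x. \<phi> x - \<kappa>"
  let ?A = "\<lambda>N. {x \<in> space M. \<exists>n\<le>N. birkhoff_sum \<phi> n x > \<kappa> * n}"
  show meas: "{x \<in> space M. \<exists>n. birkhoff_sum \<phi> n x > \<kappa> * n} \<in> sets M" by measurable
  have "measure M (?A N) \<le> (\<integral>x. \<phi> x \<partial>M) / \<kappa>" for N
  proof -
    let ?B = "{x \<in> space M. 0 < max_sum ?f N x}"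
    have if': "integrable M ?f" using \<phi> by simp
    have [measurable]: "max_sum ?f N \<in> borel_measurable M" using max_sum_integrable[OF if', of N] by auto
    have B: "?B \<in> sets M" by measurable
    have sub: "?A N \<subseteq> ?B"
    proof safe
      fix x n assume "x \<in> space M" "n \<le> N" "\<kappa> * real n < birkhoff_sum \<phi> n x"
      moreover have "birkhoff_sum ?f n x = birkhoff_sum \<phi> n x - \<kappa> * n"
        by (simp add: birkhoff_sum_def sum_subtractf)
      ultimately show "0 < max_sum ?f N x" using birkhoff_le_max_sum[of n N ?f x] by linarith
    qed
    have "0 \<le> (\<integral>x. ?f x * indicator ?B x \<partial>M)" by (rule maximal_ergodic[OF if'])
    also have "\<dots> = (\<integral>x. \<phi> x * indicator ?B x - \<kappa> * indicator ?B x \<partial>M)"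
      by (simp add: algebra_simps)
    also have "\<dots> = (\<integral>x. \<phi> x * indicator ?B x \<partial>M) - \<kappa> * measure M ?B"
      using B integrable_real_mult_indicator[OF B \<phi>(1)]
      by (subst Bochner_Integration.integral_diff) (auto simp: emeasure_eq_measure)
    also have "(\<integral>x. \<phi> x * indicator ?B x \<partial>M) \<le> (\<integral>x. \<phi> x \<partial>M)"
      by (rule integral_mono[OF integrable_real_mult_indicator[OF B \<phi>(1)] \<phi>(1)])
        (use \<phi>(2) in \<open>auto simp: indicator_def\<close>)
    finally have "measure M ?B \<le> (\<integral>x. \<phi> x \<partial>M) / \<kappa>" using \<kappa> by (simp add: field_simps)
    moreover have "measure M (?A N) \<le> measure M ?B" by (rule finite_measure_mono[OF sub B])
    ultimately show ?thesis by linarith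
  qed
  moreover have "(\<lambda>N. measure M (?A N)) \<longlonglongrightarrow> measure M (\<Union>N. ?A N)"
    by (rule finite_Lim_measure_incseq) (auto simp: incseq_def intro: le_trans)
  moreover have "(\<Union>N. ?A N) = {x \<in> space M. \<exists>n. birkhoff_sum \<phi> n x > \<kappa> * n}" by auto
  ultimately show "measure M {x \<in> space M. \<exists>n. birkhoff_sum \<phi> n x > \<kappa> * n} \<le> (\<integral>x. \<phi> x \<partial>M) / \<kappa>"
    by (metis (no_types, lifting) LIMSEQ_le_const2)
qed


text \<open>Turns estimates in measure, which is what the maximal inequality supplies, into almost
  sure statements. \<open>P\<close> itself may be nonmeasurable: the null set is the intersection of
  the exceptional sets.\<close>

lemma AE_of_small_exceptions:
  assumes "\<And>\<eta>::real. 0 < \<eta> \<Longrightarrow> \<exists>X\<in>sets M. measure M X \<le> \<eta> \<and> (AE x in M. x \<notin> X \<longrightarrow> P x)"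
  shows "AE x in M. P x"
proof -
  have "\<forall>n::nat. \<exists>X\<in>sets M. measure M X \<le> 1 / Suc n \<and> (AE x in M. x \<notin> X \<longrightarrow> P x)"
    using assms by simp
  then obtain X where X: "\<And>n::nat. X n \<in> sets M" "\<And>n. measure M (X n) \<le> 1 / Suc n"
    "\<And>n. AE x in M. x \<notin> X n \<longrightarrow> P x"
    by metis
  have "measure M (\<Inter>n. X n) \<le> 1 / Suc n" for n
    using X(1)[of n] X(2)[of n] by (meson INF_lower UNIV_I finite_measure_mono order_trans)
  then have "measure M (\<Inter>n. X n) \<le> 0"
    using LIMSEQ_inverse_real_of_nat by (intro LIMSEQ_le_const[of "\<lambda>n. 1 / real (Suc n)"]) (auto simp: inverse_eq_divide)
  then have "measure M (\<Inter>n. X n) = 0" by (simp add: measure_le_0_iff)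
  then have "(\<Inter>n. X n) \<in> null_sets M"
    using X(1) by (auto simp: emeasure_eq_measure intro!: null_setsI)
  then have "AE x in M. x \<notin> (\<Inter>n. X n)" by (rule AE_not_in)
  moreover have "AE x in M. \<forall>n. x \<notin> X n \<longrightarrow> P x" unfolding AE_all_countable using X(3) by blast
  ultimately show ?thesis by eventually_elim auto
qed

text \<open>A weak substitute for Birkhoff's theorem: by the maximal inequality a slope \<kappa>
  fails with probability at most the integral of \<phi> divided by \<kappa>.\<close>

lemma birkhoff_sum_linear_bound:
  fixes \<phi> :: "'a \<Rightarrow> real"
  assumes \<phi>: "integrable M \<phi>" "\<And>x. 0 \<le> \<phi> x"
  shows "AE x in M. \<exists>\<kappa>::real. \<forall>n. birkhoff_sum \<phi> n x \<le> \<kappa> * n"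
proof (rule AE_of_small_exceptions)
  fix \<eta> :: real assume \<eta>: "0 < \<eta>"
  define \<kappa> where "\<kappa> = ((\<integral>x. \<phi> x \<partial>M) + 1) / \<eta>"
  have I: "0 \<le> (\<integral>x. \<phi> x \<partial>M)" using \<phi> by simp
  have \<kappa>: "0 < \<kappa>" using I \<eta> by (simp add: \<kappa>_def)
  let ?X = "{x \<in> space M. \<exists>n. birkhoff_sum \<phi> n x > \<kappa> * n}"
  have "measure M ?X \<le> (\<integral>x. \<phi> x \<partial>M) / \<kappa>" by (rule maximal_inequality(2)[OF \<phi> \<kappa>])
  also have "\<dots> \<le> \<eta>" using I \<eta> by (simp add: \<kappa>_def field_simps)
  finally have "measure M ?X \<le> \<eta>" .
  moreover have "?X \<in> sets M" by (rule maximal_inequality(1)[OF \<phi> \<kappa>])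
  moreover have "AE x in M. x \<notin> ?X \<longrightarrow> (\<exists>\<kappa>::real. \<forall>n. birkhoff_sum \<phi> n x \<le> \<kappa> * n)"
    by (rule AE_I2) (auto simp: not_less)
  ultimately show "\<exists>X\<in>sets M. measure M X \<le> \<eta> \<and> (AE x in M. x \<notin> X \<longrightarrow> (\<exists>\<kappa>::real. \<forall>n. birkhoff_sum \<phi> n x \<le> \<kappa> * n))"
    by blast
qed

text \<open>Walk along the orbit from the left. At a point outside \<open>D\<close> jump over a
  block on which \<open>f + c\<close> is at most \<open>g\<close> per step; at a point of
  \<open>D\<close> take a single step and pay \<psi>. The last term pays for the end of the stretch,
  where the block on offer may be too long.\<close>

lemma tiling_bound:
  fixes f F :: "nat \<Rightarrow> 'a \<Rightarrow> real"
  assumes sub: "\<And>k l m. 1 \<le> l \<Longrightarrow> F (l + m) ((T ^^ k) x) \<le> f l ((T ^^ k) x) + c l + F m ((T ^^ (l + k)) x)"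
    and F0: "\<And>k. F 0 ((T ^^ k) x) \<le> 0"
    and \<psi>: "\<And>y. 0 \<le> \<psi> y"
    and single: "\<And>k. f 1 ((T ^^ k) x) + c 1 \<le> g + \<psi> ((T ^^ k) x)"
    and good: "\<And>k. (T ^^ k) x \<notin> D \<Longrightarrow> \<psi> ((T ^^ k) x) \<le> N \<and>
                 (\<exists>l. 1 \<le> l \<and> l \<le> N \<and> f l ((T ^^ k) x) + c l \<le> l * g)"
  shows "F n ((T ^^ k) x) \<le> n * g + birkhoff_sum (\<lambda>y. indicator D y * \<psi> y) n ((T ^^ k) x) + real (min n N) * real N"
proof (induction n arbitrary: k rule: less_induct)
  case (less n)
  let ?y = "(T ^^ k) x" and ?\<phi> = "\<lambda>y. indicator D y * \<psi> y :: real"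
  have nonneg: "0 \<le> birkhoff_sum ?\<phi> m z" for m z
    unfolding birkhoff_sum_def by (intro sum_nonneg mult_nonneg_nonneg) (auto simp: \<psi>)
  consider "n = 0" | "0 < n" "?y \<in> D" | l where "0 < n" "?y \<notin> D" "1 \<le> l" "l \<le> n" "f l ?y + c l \<le> l * g"
    | l where "0 < n" "?y \<notin> D" "n < l" "l \<le> N"
    using good[of k] by force
  then show ?case
  proof cases
    case 1 then show ?thesis using F0[of k] by (simp add: birkhoff_sum_def)
  next
    case 2
    then obtain n' where n: "n = Suc n'" by (cases n) auto
    have "F n ?y \<le> f 1 ?y + c 1 + F n' ((T ^^ Suc k) x)" using sub[of 1 n' k] n by simp
    also have "\<dots> \<le> g + \<psi> ?y + (n' * g + birkhoff_sum ?\<phi> n' ((T ^^ Suc k) x) + real (min n' N) * real N)"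
      using single[of k] less.IH[of n' "Suc k"] n by simp
    also have "\<dots> = n * g + birkhoff_sum ?\<phi> n ?y + real (min n' N) * real N"
      using 2 n by (simp add: birkhoff_sum_Suc algebra_simps)
    also have "real (min n' N) * real N \<le> real (min n N) * real N"
      using n by (intro mult_right_mono) auto
    finally show ?thesis by simp
  next
    case 3
    have eq: "n = l + (n - l)" using 3 by simp
    have "F n ?y \<le> f l ?y + c l + F (n - l) ((T ^^ (l + k)) x)" using sub[of l "n - l" k] 3 by simp
    also have "\<dots> \<le> l * g + (real (n - l) * g + birkhoff_sum ?\<phi> (n - l) ((T ^^ (l + k)) x) + real (min (n - l) N) * real N)"
      using 3 less.IH[of "n - l" "l + k"] by (intro add_mono) auto
    also have "\<dots> \<le> n * g + birkhoff_sum ?\<phi> n ?y + real (min (n - l) N) * real N"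
      using birkhoff_sum_add[of ?\<phi> l "n - l" ?y] nonneg[of l ?y] 3
      unfolding funpow_add[of l k] comp_def by (simp add: of_nat_diff algebra_simps)
    also have "real (min (n - l) N) * real N \<le> real (min n N) * real N"
      by (intro mult_right_mono) auto
    finally show ?thesis by simp
  next
    \<comment> \<open>The block sticks out of the remaining stretch, so \<open>n < N\<close>. A
      single step costs at most \<open>N\<close> beyond \<open>g\<close>, and it lowers
      \<open>min n N\<close> by one, which pays for it.\<close>
    case 4
    then obtain n' where n: "n = Suc n'" by (cases n) auto
    have "F n ?y \<le> f 1 ?y + c 1 + F n' ((T ^^ Suc k) x)" using sub[of 1 n' k] n by simp
    also have "\<dots> \<le> g + real N + (n' * g + birkhoff_sum ?\<phi> n' ((T ^^ Suc k) x) + real (min n' N) * real N)"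
      using single[of k] good[of k] 4 less.IH[of n' "Suc k"] n by simp
    also have "\<dots> = n * g + birkhoff_sum ?\<phi> n ?y + real (min n N) * real N"
      using 4 n by (simp add: birkhoff_sum_Suc min_def algebra_simps)
    finally show ?thesis by simp
  qed
qed


text \<open>The tiling controls \<open>F\<close>, while the limit is wanted for \<open>f\<close>;
  \<open>sub\<close> charges \<open>f\<close> for each block and \<open>cmp\<close> returns from
  \<open>F\<close> to \<open>f\<close> at cost \<open>o(n)\<close>. Invariance of the liminf is a
  hypothesis because the two applications obtain it from opposite one-sided inequalities. The limit
  may be minus infinity.\<close>

theorem almost_subadditive_ergodic:
  fixes f F :: "nat \<Rightarrow> 'a \<Rightarrow> real" and c :: "nat \<Rightarrow> real"
  assumes f_meas [measurable]: "\<And>n. f n \<in> borel_measurable M"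
    and sub: "AE x in M. \<forall>l m. 1 \<le> l \<longrightarrow> F (l + m) x \<le> f l x + c l + F m ((T ^^ l) x)"
    and F0: "AE x in M. F 0 x \<le> 0"
    and c: "\<And>l. 0 \<le> c l" "(\<lambda>l. c l / l) \<longlonglongrightarrow> 0"
    and \<psi>: "integrable M \<psi>" "\<And>x. 0 \<le> \<psi> x" "AE x in M. f 1 x \<le> \<psi> x"
    and cmp: "AE x in M. \<forall>e>0. \<forall>\<^sub>F n in sequentially. f n x \<le> F n x + e * real n"
    and inv: "AE x in M. liminf (\<lambda>n. ereal (f n (T x) / n)) = liminf (\<lambda>n. ereal (f n x / n))"
  shows "AE x in M. (\<lambda>n. ereal (f n x / n)) \<longlonglongrightarrow> liminf (\<lambda>n. ereal (f n x / n)) \<and>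
           liminf (\<lambda>n. ereal (f n x / n)) < \<infinity>"
proof -
  define h where "h x = liminf (\<lambda>n. ereal (f n x / n))" for x
  have h_meas [measurable]: "h \<in> borel_measurable M" unfolding h_def by measurable
  have [measurable]: "\<psi> \<in> borel_measurable M" using \<psi> by auto
  have "AE x in M. h (T x) = h x" using inv by (simp add: h_def)
  from AE_orbit[OF this] have h_inv: "AE x in M. \<forall>k. h ((T ^^ k) x) = h x"
  proof eventually_elim
    case (elim x)
    show ?case
    proof
      fix k show "h ((T ^^ k) x) = h x" by (induction k) (use elim in auto)
    qed
  qed
  have sub_orbit: "AE x in M. \<forall>k l m. 1 \<le> l \<longrightarrow>
      F (l + m) ((T ^^ k) x) \<le> f l ((T ^^ k) x) + c l + F m ((T ^^ (l + k)) x)"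
    using AE_orbit[OF sub] by (simp add: funpow_add)
  note F0_orbit = AE_orbit[OF F0]
  note \<psi>_orbit = AE_orbit[OF \<psi>(3)]

  have h_fin: "AE x in M. h x < \<infinity>"
  proof -
    have "integrable M (\<lambda>x. \<psi> x + c 1)" "\<And>x. 0 \<le> \<psi> x + c 1" using \<psi> c(1)[of 1] by auto
    from birkhoff_sum_linear_bound[OF this] sub_orbit F0_orbit \<psi>_orbit cmp
    show ?thesis
    proof eventually_elim
      case (elim x)
      obtain \<kappa> :: real where \<kappa>: "\<And>n. birkhoff_sum (\<lambda>x. \<psi> x + c 1) n x \<le> \<kappa> * n" using elim(1) by blast
      have "F n ((T ^^ k) x) \<le> birkhoff_sum (\<lambda>x. \<psi> x + c 1) n ((T ^^ k) x)" for n k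
      proof (induction n arbitrary: k)
        case 0 then show ?case using elim(3) by (simp add: birkhoff_sum_def)
      next
        case (Suc n)
        have "F (Suc n) ((T ^^ k) x) \<le> f 1 ((T ^^ k) x) + c 1 + F n ((T ^^ (1 + k)) x)"
          using elim(2)[rule_format, of 1 n k] by simp
        also have "\<dots> \<le> \<psi> ((T ^^ k) x) + c 1 + birkhoff_sum (\<lambda>x. \<psi> x + c 1) n ((T ^^ (1 + k)) x)"
          using elim(4) Suc[of "1 + k"] by (intro add_mono) auto
        finally show ?case by (simp add: birkhoff_sum_Suc)
      qed
      from this[of _ 0] have F_le: "F n x \<le> \<kappa> * n" for n using \<kappa>[of n] order_trans by fastforce
      have "\<forall>\<^sub>F n in sequentially. f n x \<le> F n x + 1 * real n" using elim(5) zero_less_one by blast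
      then have "\<forall>\<^sub>F n in sequentially. ereal (f n x / n) \<le> ereal (\<kappa> + 1)"
        using eventually_gt_at_top[of 0]
      proof eventually_elim
        case (elim n)
        have "f n x \<le> (\<kappa> + 1) * n" using F_le[of n] elim(1) by (simp add: algebra_simps)
        then show ?case using elim(2) by (simp add: divide_le_eq)
      qed
      then have "h x \<le> ereal (\<kappa> + 1)" unfolding h_def
        by (intro order_trans[OF Liminf_le_Limsup Limsup_bounded]) auto
      then show ?case using order_le_less_trans[of "h x" "ereal (\<kappa> + 1)" \<infinity>] by simp
    qed
  qed

  \<comment> \<open>The liminf is cut off below at \<open>- q\<close>, so that there is a real rate
    to aim at even where it is minus infinity. Both parameters are natural numbers, so that
    countably many null sets suffice at the end.\<close>
  have main: "AE x in M. h x \<le> ereal (real q) \<longrightarrow>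
      (\<forall>\<^sub>F n in sequentially. F n x \<le> n * (real_of_ereal (max (h x) (- real q)) + 3 / Suc j))" for q j :: nat
  proof (rule AE_of_small_exceptions)
    fix \<eta> :: real assume \<eta>: "0 < \<eta>"
    define e :: real where "e = 1 / Suc j"
    have e: "0 < e" by (simp add: e_def)
    define G where "G x = real_of_ereal (max (h x) (- real q))" for x
    have G_meas [measurable]: "G \<in> borel_measurable M" unfolding G_def by measurable
    have "\<forall>\<^sub>F l in sequentially. c l / l < e / 2"
      using c(2) e by (intro order_tendstoD) auto
    then obtain K0 where K0: "\<And>l. l \<ge> K0 \<Longrightarrow> c l / l < e / 2" by (auto simp: eventually_sequentially)
    define K where "K = max 1 K0"
    \<comment> \<open>The summand \<open>q\<close> compensates for \<open>G \<ge> - q\<close>: it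
      makes a single step cost at most \<open>G + e + \<Psi>\<close>.\<close>
    define \<Psi> where "\<Psi> x = \<psi> x + c 1 + q" for x
    have \<Psi>_int: "integrable M \<Psi>" unfolding \<Psi>_def using \<psi> by auto
    have \<Psi>_nonneg: "0 \<le> \<Psi> x" for x using \<psi>(2)[of x] c(1)[of 1] by (simp add: \<Psi>_def)
    have [measurable]: "\<Psi> \<in> borel_measurable M" using \<Psi>_int by auto
    \<comment> \<open>Points without a good block of length between \<open>K\<close> and
      \<open>N\<close>, or with an expensive single step. Lengths from \<open>K\<close> on are used
      because there \<open>c l\<close> is below \<open>l * e / 2\<close>. Each point leaves
      \<open>D N\<close> for large \<open>N\<close>, so the integral of \<Psi> over
      \<open>D N\<close> tends to 0.\<close>
    define D where "D N = {x \<in> space M. (h x \<le> ereal (real q) \<and>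
        (\<forall>l\<in>{K..N}. l * (G x + e) < f l x + c l)) \<or> \<Psi> x > real N}" for N :: nat
    have D_meas [measurable]: "D N \<in> sets M" for N unfolding D_def by measurable
    have "(\<lambda>N. \<integral>x. indicator (D N) x * \<Psi> x \<partial>M) \<longlonglongrightarrow> (\<integral>x. 0 \<partial>M)"
    proof (rule integral_dominated_convergence[where w=\<Psi>])
      show "AE x in M. (\<lambda>N. indicator (D N) x * \<Psi> x) \<longlonglongrightarrow> 0"
      proof (rule AE_I2)
        fix x assume x: "x \<in> space M"
        have "\<exists>N0. \<forall>N\<ge>N0. x \<notin> D N"
        proof (cases "h x \<le> ereal (real q)")
          case False
          obtain N0 where "\<Psi> x \<le> real N0" using real_arch_simple by blast
          then show ?thesis using False by (intro exI[of _ N0]) (auto simp: D_def)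
        next
          case True
          have "h x < ereal (G x + e / 2)"
          proof (cases "h x")
            case (real r) then show ?thesis using e by (auto simp: G_def max_def)
          qed (use True in auto)
          have "\<exists>\<^sub>F l in sequentially. ereal (f l x / l) < ereal (G x + e / 2)"
          proof (rule ccontr)
            assume "\<not> ?thesis"
            then have "\<forall>\<^sub>F l in sequentially. ereal (G x + e / 2) \<le> ereal (f l x / l)"
              by (simp add: not_frequently not_less)
            then have "ereal (G x + e / 2) \<le> h x" unfolding h_def by (rule Liminf_bounded)
            with \<open>h x < ereal (G x + e / 2)\<close> show False by simp
          qed
          then have "\<exists>\<^sub>F l in sequentially. K \<le> l \<and> ereal (f l x / l) < ereal (G x + e / 2)"
            using eventually_ge_at_top[of K] by (rule frequently_rev_mp[OF _ eventually_mono]) auto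
          then obtain l where l: "K \<le> l" "f l x / l < G x + e / 2"
            by (auto dest!: frequently_ex)
          have "c l / l < e / 2" using K0[of l] l by (simp add: K_def)
          then have "(f l x + c l) / l \<le> G x + e" using l(2) unfolding add_divide_distrib by linarith
          then have l': "f l x + c l \<le> l * (G x + e)" using l(1) by (simp add: K_def divide_le_eq mult.commute)
          obtain N0 where "\<Psi> x \<le> real N0" using real_arch_simple by blast
          then show ?thesis using l l' by (intro exI[of _ "max l N0"]) (auto simp: D_def not_less intro!: bexI[of _ l])
        qed
        then obtain N0 where "\<And>N. N \<ge> N0 \<Longrightarrow> x \<notin> D N" by blast
        then have "\<forall>\<^sub>F N in sequentially. indicator (D N) x * \<Psi> x = 0"
          unfolding eventually_sequentially by (intro exI[of _ N0]) simp
        then show "(\<lambda>N. indicator (D N) x * \<Psi> x) \<longlonglongrightarrow> 0" by (rule tendsto_eventually)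
      qed
      show "AE x in M. norm (indicator (D N) x * \<Psi> x) \<le> \<Psi> x" for N
        using \<Psi>_nonneg by (intro AE_I2) (auto simp: indicator_def)
    qed (use \<Psi>_int in auto)
    then have "\<forall>\<^sub>F N in sequentially. (\<integral>x. indicator (D N) x * \<Psi> x \<partial>M) < \<eta> * e"
      using \<eta> e by (intro order_tendstoD) auto
    then obtain N where N: "(\<integral>x. indicator (D N) x * \<Psi> x \<partial>M) < \<eta> * e"
      by (auto simp: eventually_sequentially)
    let ?\<phi> = "\<lambda>x. indicator (D N) x * \<Psi> x :: real"
    have \<phi>: "integrable M ?\<phi>" "\<And>x. 0 \<le> ?\<phi> x"
      using \<Psi>_nonneg integrable_real_mult_indicator[OF D_meas \<Psi>_int] by (auto simp: mult.commute)
    \<comment> \<open>Outside \<open>X\<close> the visits of the orbit to \<open>D N\<close> cost at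
      most \<open>e\<close> per step, uniformly in time.\<close>
    define X where "X = {x \<in> space M. \<exists>n. birkhoff_sum ?\<phi> n x > e * n}"
    have "measure M X \<le> (\<integral>x. ?\<phi> x \<partial>M) / e" unfolding X_def by (rule maximal_inequality(2)[OF \<phi> e])
    also have "\<dots> \<le> \<eta>" using N e by (simp add: field_simps)
    finally have X: "measure M X \<le> \<eta>" .
    have X_meas: "X \<in> sets M" unfolding X_def by (rule maximal_inequality(1)[OF \<phi> e])
    \<comment> \<open>Of the three \<open>e\<close>, one is the slack of the good blocks, one pays
      for the visits to \<open>D N\<close>, and one absorbs the boundary term \<open>N * N\<close>
      for large \<open>n\<close>.\<close>
    have "AE x in M. x \<notin> X \<longrightarrow> h x \<le> ereal (real q) \<longrightarrow> (\<forall>\<^sub>F n in sequentially. F n x \<le> n * (G x + 3 * e))"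
      using sub_orbit F0_orbit \<psi>_orbit h_inv AE_space
    proof eventually_elim
      case (elim x)
      have sp: "(T ^^ k) x \<in> space M" for k using measurable_space[OF iter_meas elim(5)] .
      show ?case
      proof (intro impI)
        assume x: "x \<notin> X" and hx: "h x \<le> ereal (real q)"
        have Gk: "G ((T ^^ k) x) = G x" for k using elim(4) by (simp add: G_def)
        have Gq: "- real q \<le> G x"
        proof (cases "h x")
          case (real r) then show ?thesis by (auto simp: G_def max_def)
        next
          case MInf then show ?thesis by (simp add: G_def max_def)
        qed (use hx in auto)
        have bound: "F n x \<le> n * (G x + e) + birkhoff_sum ?\<phi> n x + real (min n N) * real N" for n
        proof -
          have "F n ((T ^^ 0) x) \<le> n * (G x + e) + birkhoff_sum ?\<phi> n ((T ^^ 0) x) + real (min n N) * real N"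
          proof (rule tiling_bound)
            show "f 1 ((T ^^ k) x) + c 1 \<le> G x + e + \<Psi> ((T ^^ k) x)" for k
              using elim(3)[rule_format, of k] Gq e by (simp add: \<Psi>_def)
            show "\<Psi> ((T ^^ k) x) \<le> real N \<and> (\<exists>l. 1 \<le> l \<and> l \<le> N \<and>
                f l ((T ^^ k) x) + c l \<le> l * (G x + e))" if "(T ^^ k) x \<notin> D N" for k
              using that sp[of k] hx elim(4) Gk[of k] by (force simp: D_def K_def not_less)
          qed (use elim \<Psi>_nonneg in auto)
          then show ?thesis by simp
        qed
        obtain n0 where n0: "real N * real N / e \<le> real n0" using real_arch_simple by blast
        show "\<forall>\<^sub>F n in sequentially. F n x \<le> n * (G x + 3 * e)"
          using eventually_ge_at_top[of n0]
        proof eventually_elim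
          case (elim n)
          have "birkhoff_sum ?\<phi> n x \<le> e * n" using x sp[of 0] by (auto simp: X_def not_less)
          moreover have "real (min n N) * real N \<le> real N * real N" by (intro mult_right_mono) auto
          moreover have "real N * real N \<le> e * n"
            using n0 elim e by (simp add: field_simps) (meson mult_left_mono of_nat_le_iff less_imp_le order_trans)
          ultimately show ?case using bound[of n] by (simp add: algebra_simps)
        qed
      qed
    qed
    then show "\<exists>X\<in>sets M. measure M X \<le> \<eta> \<and> (AE x in M. x \<notin> X \<longrightarrow> h x \<le> ereal (real q) \<longrightarrow>
      (\<forall>\<^sub>F n in sequentially. F n x \<le> n * (real_of_ereal (max (h x) (- real q)) + 3 / Suc j)))"
      using X X_meas by (intro bexI[of _ X]) (simp_all add: G_def e_def)
  qed
  have "AE x in M. \<forall>q j. h x \<le> ereal (real q) \<longrightarrow>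
      (\<forall>\<^sub>F n in sequentially. F n x \<le> n * (real_of_ereal (max (h x) (- real q)) + 3 / Suc j))"
    unfolding AE_all_countable using main by blast
  then show ?thesis using cmp h_fin
  proof eventually_elim
    case (elim x)
    let ?u = "\<lambda>n. ereal (f n x / n)"
    have "limsup ?u \<le> h x"
    proof (rule ccontr)
      assume "\<not> limsup ?u \<le> h x"
      then obtain y where y: "h x < ereal y" "ereal y < limsup ?u" using ereal_dense2 by (metis not_le)
      obtain q :: nat where "\<bar>y\<bar> + 1 \<le> real q" using real_arch_simple by blast
      then have q: "h x \<le> ereal (real q)" "- real q < y" using y(1) less_imp_le[OF less_le_trans[of "h x" "ereal y" "ereal (real q)"]] by auto
      define G where "G = real_of_ereal (max (h x) (- real q))"
      have "G < y" using y(1) q elim(3) by (cases "h x") (auto simp: G_def max_def)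
      then obtain j where j: "4 / Suc j < y - G"
        using reals_Archimedean[of "(y - G) / 4"] by (auto simp: field_simps)
      have "\<forall>\<^sub>F n in sequentially. F n x \<le> n * (G + 3 / Suc j)"
        using elim(1) q(1) by (simp add: G_def)
      moreover have "\<forall>\<^sub>F n in sequentially. f n x \<le> F n x + 1 / Suc j * real n"
        by (rule elim(2)[rule_format]) simp
      ultimately have "\<forall>\<^sub>F n in sequentially. ?u n \<le> ereal y"
        using eventually_gt_at_top[of 0]
      proof eventually_elim
        case (elim n)
        define e where "e = 1 / real (Suc j)"
        have "3 / real (Suc j) = 3 * e" "4 / real (Suc j) = 4 * e" "1 / real (Suc j) = e"
          by (simp_all add: e_def)
        note eqs = this
        have "F n x \<le> n * (G + 3 * e)" "f n x \<le> F n x + e * real n"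
          using elim(1,2) unfolding eqs .
        then have "f n x \<le> n * (G + 4 * e)" by (simp add: algebra_simps)
        also have "\<dots> = n * (G + 4 / Suc j)" unfolding eqs ..
        also have "\<dots> \<le> n * y" using j elim(3) by (intro mult_left_mono) auto
        finally show ?case using elim(3) by (simp add: divide_le_eq mult.commute)
      qed
      then have "limsup ?u \<le> ereal y" by (rule Limsup_bounded)
      then show False using y(2) by simp
    qed
    moreover have "h x \<le> limsup ?u" unfolding h_def by (rule Liminf_le_Limsup) simp
    ultimately show ?case
      using elim(3) by (simp add: tendsto_iff_Liminf_eq_Limsup h_def)
  qed
qed

end

section \<open>Invariant measures on the shift space\<close>

lemma (in prob_space) nn_integral_countable_valued:
  fixes X :: "'a \<Rightarrow> 'c::countable"
  assumes X [measurable]: "X \<in> measurable M (count_space UNIV)"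
  shows "(\<integral>\<^sup>+ \<omega>. g (X \<omega>) \<partial>M) = (\<integral>\<^sup>+ c. g c * emeasure M {\<omega> \<in> space M. X \<omega> = c} \<partial>count_space UNIV)"
proof -
  have "(\<integral>\<^sup>+ \<omega>. g (X \<omega>) \<partial>M) = (\<integral>\<^sup>+ \<omega>. (\<integral>\<^sup>+ c. g c * indicator {\<omega> \<in> space M. X \<omega> = c} \<omega> \<partial>count_space UNIV) \<partial>M)"
  proof (rule nn_integral_cong)
    fix \<omega> assume "\<omega> \<in> space M"
    then have "(\<integral>\<^sup>+ c. g c * indicator {\<omega> \<in> space M. X \<omega> = c} \<omega> \<partial>count_space UNIV)
        = (\<integral>\<^sup>+ c. g c * indicator {X \<omega>} c \<partial>count_space UNIV)"
      by (intro nn_integral_cong) (auto simp: indicator_def)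
    also have "\<dots> = g (X \<omega>)" by (subst nn_integral_indicator_singleton) auto
    finally show "g (X \<omega>) = (\<integral>\<^sup>+ c. g c * indicator {\<omega> \<in> space M. X \<omega> = c} \<omega> \<partial>count_space UNIV)" ..
  qed
  also have "\<dots> = (\<integral>\<^sup>+ c. (\<integral>\<^sup>+ \<omega>. g c * indicator {\<omega> \<in> space M. X \<omega> = c} \<omega> \<partial>M) \<partial>count_space UNIV)"
    by (rule nn_integral_count_space_nn_integral) auto
  also have "\<dots> = (\<integral>\<^sup>+ c. g c * emeasure M {\<omega> \<in> space M. X \<omega> = c} \<partial>count_space UNIV)"
    by (intro nn_integral_cong nn_integral_cmult_indicator) auto
  finally show ?thesis .
qed

text \<open>The first Borel-Cantelli lemma with functions in place of events: the sum of the
  integrals is finite, so almost surely the series converges and its terms tend to 0.\<close>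

lemma AE_eventually_less_1:
  fixes f :: "nat \<Rightarrow> 'a \<Rightarrow> ennreal"
  assumes f [measurable]: "\<And>n. f n \<in> borel_measurable M" and K: "0 \<le> K"
    and le: "\<And>n. (\<integral>\<^sup>+ \<omega>. f n \<omega> \<partial>M) \<le> ennreal (K / (real n + 1)\<^sup>2)"
  shows "AE \<omega> in M. \<forall>\<^sub>F n in sequentially. f n \<omega> < 1"
proof -
  have "(\<integral>\<^sup>+ \<omega>. (\<Sum>n. f n \<omega>) \<partial>M) \<le> (\<Sum>n. ennreal (K / (real n + 1)\<^sup>2))"
    using le by (subst nn_integral_suminf) (auto intro!: suminf_le)
  also have "\<dots> < \<infinity>"
  proof -
    have "summable (\<lambda>n. 1 / (real n + 1)\<^sup>2)"
      using inverse_squares_sums by (auto simp: sums_iff add.commute)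
    then have "summable (\<lambda>n. K / (real n + 1)\<^sup>2)" using summable_mult[of _ K] by fastforce
    then have "(\<Sum>n. ennreal (K / (real n + 1)\<^sup>2)) = ennreal (\<Sum>n. K / (real n + 1)\<^sup>2)"
      using K by (intro suminf_ennreal2) auto
    then show ?thesis by simp
  qed
  finally have "AE \<omega> in M. (\<Sum>n. f n \<omega>) \<noteq> \<infinity>"
    by (intro nn_integral_noteq_infinite) auto
  then show ?thesis
  proof eventually_elim
    case (elim \<omega>)
    have "f n \<omega> \<noteq> \<top>" for n
      using ennreal_suminf_lessD[of "\<lambda>n. f n \<omega>" \<top> n] elim by (simp add: less_top)
    then have r: "f n \<omega> = ennreal (enn2real (f n \<omega>))" for n by (simp add: ennreal_enn2real less_top)
    have "summable (\<lambda>n. enn2real (f n \<omega>))"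
      using elim r by (intro summable_suminf_not_top) auto
    then have "(\<lambda>n. ennreal (enn2real (f n \<omega>))) \<longlonglongrightarrow> ennreal 0"
      by (intro tendsto_ennrealI summable_LIMSEQ_zero)
    then have "(\<lambda>n. f n \<omega>) \<longlonglongrightarrow> 0" unfolding r[symmetric] by simp
    then show ?case by (rule order_tendstoD) simp
  qed
qed

text \<open>The quotient of the weight and the mass of the observed value has expectation at most
  the total weight, hence at most 1; divided by \<open>(n + 1)^2\<close> the expectations are
  summable. It serves both the comparison of \<open>block_weight\<close> with \<open>mass\<close>
  and, through \<open>AE_cell_mass\<close>, all lower bounds for masses of cells.\<close>

lemma (in prob_space) AE_weight_le_mass:
  fixes X :: "nat \<Rightarrow> 'a \<Rightarrow> 'c::countable" and q :: "nat \<Rightarrow> 'c \<Rightarrow> real"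
  assumes X [measurable]: "\<And>n. X n \<in> measurable M (count_space UNIV)"
    and q: "\<And>n c. 0 \<le> q n c" "\<And>n. (\<integral>\<^sup>+ c. ennreal (q n c) \<partial>count_space UNIV) \<le> 1"
  shows "AE \<omega> in M. \<forall>\<^sub>F n in sequentially.
           q n (X n \<omega>) \<le> (real n + 1)\<^sup>2 * measure M {\<omega>' \<in> space M. X n \<omega>' = X n \<omega>}"
proof -
  let ?m = "\<lambda>n c. emeasure M {\<omega> \<in> space M. X n \<omega> = c}"
  let ?t = "\<lambda>n \<omega>. ennreal (1 / (real n + 1)\<^sup>2) * (ennreal (q n (X n \<omega>)) / ?m n (X n \<omega>))"
  have t_meas [measurable]: "(\<lambda>\<omega>. ?t n \<omega>) \<in> borel_measurable M" for n
    by (rule measurable_compose[OF X[of n]]) simp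
  have "(\<integral>\<^sup>+ \<omega>. ?t n \<omega> \<partial>M) \<le> ennreal (1 / (real n + 1)\<^sup>2)" for n
  proof -
    have "(\<integral>\<^sup>+ \<omega>. ?t n \<omega> \<partial>M) = (\<integral>\<^sup>+ c. ennreal (1 / (real n + 1)\<^sup>2) * (ennreal (q n c) / ?m n c) * ?m n c \<partial>count_space UNIV)"
      by (rule nn_integral_countable_valued[OF X])
    also have "\<dots> \<le> (\<integral>\<^sup>+ c. ennreal (1 / (real n + 1)\<^sup>2) * ennreal (q n c) \<partial>count_space UNIV)"
    proof (rule nn_integral_mono)
      fix c
      have "ennreal (q n c) / ?m n c * ?m n c \<le> ennreal (q n c)"
      proof (cases "?m n c = 0")
        case False
        then have "?m n c / ?m n c = 1"
          by (intro ennreal_divide_self) (auto simp: emeasure_eq_measure)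
        then show ?thesis by (simp add: ennreal_divide_times)
      qed simp
      then show "ennreal (1 / (real n + 1)\<^sup>2) * (ennreal (q n c) / ?m n c) * ?m n c \<le> ennreal (1 / (real n + 1)\<^sup>2) * ennreal (q n c)"
        by (simp add: mult.assoc mult_left_mono)
    qed
    also have "\<dots> = ennreal (1 / (real n + 1)\<^sup>2) * (\<integral>\<^sup>+ c. ennreal (q n c) \<partial>count_space UNIV)"
      by (rule nn_integral_cmult) simp
    also have "\<dots> \<le> ennreal (1 / (real n + 1)\<^sup>2) * 1" by (intro mult_left_mono q) simp
    finally show ?thesis by simp
  qed
  note le = this
  have "AE \<omega> in M. \<forall>\<^sub>F n in sequentially. ?t n \<omega> < 1"
    by (rule AE_eventually_less_1[where K=1, OF t_meas _ le]) simp
  then show ?thesis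
  proof eventually_elim
    case (elim \<omega>)
    then show ?case
    proof eventually_elim
      case (elim n)
      let ?p = "measure M {\<omega>' \<in> space M. X n \<omega>' = X n \<omega>}"
      show ?case
      proof (cases "?p = 0")
        case True
        then show ?thesis using elim q(1)[of n "X n \<omega>"]
          by (cases "q n (X n \<omega>) = 0") (auto simp: emeasure_eq_measure ennreal_mult_top)
      next
        case False
        then have p: "0 < ?p" by (simp add: zero_less_measure_iff)
        have "?t n \<omega> = ennreal (1 / (real n + 1)\<^sup>2 * (q n (X n \<omega>) / ?p))"
          using p q(1)[of n "X n \<omega>"] by (simp add: emeasure_eq_measure divide_ennreal ennreal_mult'[symmetric])
        then have "1 / (real n + 1)\<^sup>2 * (q n (X n \<omega>) / ?p) < 1" using elim by simp
        then show ?thesis using p by (simp add: field_simps)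
      qed
    qed
  qed
qed

section \<open>Words, cylinders and the shift\<close>

lemma space_seq_space [simp]: "space seq_space = UNIV"
  by (auto simp: seq_space_def space_PiM)

lemma coordinate_measurable: "(\<lambda>\<omega>. \<omega> k) \<in> measurable seq_space (count_space UNIV)"
  unfolding seq_space_def by (rule measurable_component_singleton) simp

lemma shift_measurable [measurable]: "shift \<in> measurable seq_space seq_space"
  unfolding shift_def seq_space_def
proof (rule measurable_PiM_single')
  show "(\<lambda>\<omega>. \<omega> (Suc n)) \<in> measurable (Pi\<^sub>M UNIV (\<lambda>_. count_space UNIV)) (count_space UNIV)" for n
    by (rule measurable_component_singleton) simp
qed simp

lemma prefix_measurable [measurable]: "(\<lambda>\<omega>::nat \<Rightarrow> 'i::countable. prefix \<omega> n) \<in> measurable seq_space (count_space UNIV)"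
proof (induction n)
  case (Suc n)
  have "(\<lambda>\<omega>::nat \<Rightarrow> 'i. (prefix \<omega> n, \<omega> n)) \<in> measurable seq_space (count_space UNIV \<Otimes>\<^sub>M count_space UNIV)"
    by (rule measurable_Pair[OF Suc coordinate_measurable])
  then have "(\<lambda>\<omega>::nat \<Rightarrow> 'i. (prefix \<omega> n, \<omega> n)) \<in> measurable seq_space (count_space UNIV)"
    by (simp add: pair_measure_countable)
  from measurable_compose[OF this, of "\<lambda>(w, i). w @ [i]" "count_space UNIV"]
  show ?case by (simp add: prefix_def)
qed (simp add: prefix_def)

lemma length_prefix [simp]: "length (prefix \<omega> n) = n" by (simp add: prefix_def)

lemma prefix_0 [simp]: "prefix \<omega> 0 = []" by (simp add: prefix_def)

lemma funpow_shift: "(shift ^^ n) \<omega> = (\<lambda>k. \<omega> (n + k))"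
proof (induction n arbitrary: \<omega>)
  case (Suc n)
  have "(shift ^^ Suc n) \<omega> = (shift ^^ n) (shift \<omega>)" by (simp only: funpow_Suc_right comp_def)
  also have "\<dots> = (\<lambda>k. shift \<omega> (n + k))" by (rule Suc)
  finally show ?case by (simp only: shift_def[of \<omega>] add_Suc_right add_Suc)
qed simp

lemma prefix_add: "prefix \<omega> (l + m) = prefix \<omega> l @ prefix ((shift ^^ l) \<omega>) m"
  by (rule nth_equalityI) (auto simp: prefix_def funpow_shift nth_append)

lemma prefix_Suc: "prefix \<omega> (Suc n) = \<omega> 0 # prefix (shift \<omega>) n"
  by (rule nth_equalityI) (auto simp: prefix_def shift_def nth_Cons simp del: upt_Suc split: nat.split)

lemma cyl_eq_prefix: "cyl w = {\<omega>. prefix \<omega> (length w) = w}"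
proof -
  have "prefix \<omega> (length w) = w \<longleftrightarrow> (\<forall>k<length w. \<omega> k = w ! k)" for \<omega>
  proof
    assume "prefix \<omega> (length w) = w"
    then have "w ! k = prefix \<omega> (length w) ! k" for k by simp
    then show "\<forall>k<length w. \<omega> k = w ! k" by (simp add: prefix_def)
  next
    assume "\<forall>k<length w. \<omega> k = w ! k"
    then show "prefix \<omega> (length w) = w" by (intro nth_equalityI) (simp_all add: prefix_def)
  qed
  then show ?thesis by (simp add: cyl_def)
qed

lemma cyl_prefix: "cyl (prefix \<omega> n) = {\<omega>'. prefix \<omega>' n = prefix \<omega> n}"
  by (simp add: cyl_eq_prefix)

lemma cyl_append: "cyl (u @ v) = {\<omega> \<in> cyl u. (shift ^^ length u) \<omega> \<in> cyl v}"
  by (auto simp: cyl_eq_prefix prefix_add)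

lemma cyl_measurable [measurable]: "cyl w \<in> sets seq_space"
proof -
  have "{\<omega> \<in> space seq_space. prefix \<omega> (length w) = w} \<in> sets seq_space" by measurable
  then show ?thesis by (simp add: cyl_eq_prefix)
qed

locale invariant_shift = prob_space \<mu> for \<mu> :: "(nat \<Rightarrow> 'i::countable) measure" +
  assumes sets_\<mu> [measurable_cong]: "sets \<mu> = sets seq_space"
    and shift_inv: "\<And>X. X \<in> sets \<mu> \<Longrightarrow> emeasure \<mu> (shift -` X) = emeasure \<mu> X"
begin

lemma space_\<mu> [simp]: "space \<mu> = UNIV"
  using sets_eq_imp_space_eq[OF sets_\<mu>] by simp

sublocale measure_preserving_map \<mu> shift
proof
  show [measurable]: "shift \<in> measurable \<mu> \<mu>" by measurable
  show "distr \<mu> \<mu> shift = \<mu>"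
    by (rule measure_eqI) (auto simp: emeasure_distr shift_inv)
qed

definition mass :: "'i list \<Rightarrow> real" where "mass w = measure \<mu> (cyl w)"

lemma mass_nonneg [simp]: "0 \<le> mass w" by (simp add: mass_def)

lemma mass_le_1 [simp]: "mass w \<le> 1" by (simp add: mass_def)

text \<open>The first inequality is inclusion of cylinders, the second comes from shift
  invariance.\<close>

lemma mass_append_le: "mass (u @ v) \<le> mass u" "mass (u @ v) \<le> mass v"
proof -
  show "mass (u @ v) \<le> mass u"
    unfolding mass_def by (rule finite_measure_mono) (auto simp: cyl_append)
  have "measure \<mu> ((shift ^^ k) -` cyl v) = measure \<mu> (cyl v)" for k
  proof (induction k)
    case (Suc k)
    have m: "(shift ^^ k) -` cyl v \<in> sets \<mu>"
      using measurable_sets[OF iter_meas[of k], of "cyl v"] by simp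
    have "(shift ^^ Suc k) -` cyl v = shift -` ((shift ^^ k) -` cyl v)"
      by (auto simp: funpow_swap1)
    then show ?case using shift_inv[OF m] Suc unfolding measure_def by simp
  qed simp
  then have "mass v = measure \<mu> ((shift ^^ length u) -` cyl v)" by (simp add: mass_def)
  moreover have "measure \<mu> (cyl (u @ v)) \<le> measure \<mu> ((shift ^^ length u) -` cyl v)"
    using measurable_sets[OF iter_meas[of "length u"], of "cyl v"]
    by (intro finite_measure_mono) (auto simp: cyl_append)
  ultimately show "mass (u @ v) \<le> mass v" by (simp add: mass_def)
qed

lemma mass_prefix: "mass (prefix \<omega> n) = measure \<mu> {\<omega>' \<in> space \<mu>. prefix \<omega>' n = prefix \<omega> n}"
  by (simp add: mass_def cyl_prefix)

lemma AE_mass_pos: "AE \<omega> in \<mu>. \<forall>n. 0 < mass (prefix \<omega> n)"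
proof -
  have "AE \<omega> in \<mu>. \<forall>w. mass w = 0 \<longrightarrow> \<omega> \<notin> cyl w"
    unfolding AE_all_countable
  proof
    fix w show "AE \<omega> in \<mu>. mass w = 0 \<longrightarrow> \<omega> \<notin> cyl w"
    proof (cases "mass w = 0")
      case True
      then have "cyl w \<in> null_sets \<mu>" by (auto simp: mass_def emeasure_eq_measure intro!: null_setsI)
      then show ?thesis using AE_not_in by auto
    qed simp
  qed
  then show ?thesis
  proof eventually_elim
    case (elim \<omega>)
    show ?case
    proof
      fix n
      have "\<omega> \<in> cyl (prefix \<omega> n)" by (simp add: cyl_prefix)
      then have "mass (prefix \<omega> n) \<noteq> 0" using elim by auto
      then show "0 < mass (prefix \<omega> n)" using mass_nonneg[of "prefix \<omega> n"] by linarith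
    qed
  qed
qed

lemma prefix_fun_measurable: "g \<in> UNIV \<rightarrow> space N \<Longrightarrow> (\<lambda>\<omega>. g (prefix \<omega> n)) \<in> measurable \<mu> N"
  by (rule measurable_compose[of _ _ "count_space UNIV"]) auto

lemma part_entropy_eq: "part_entropy \<mu> n = (\<integral>\<^sup>+ \<omega>. ennreal (- ln (mass (prefix \<omega> n))) \<partial>\<mu>)"
proof -
  have "(\<integral>\<^sup>+ \<omega>. ennreal (- ln (mass (prefix \<omega> n))) \<partial>\<mu>) =
     (\<integral>\<^sup>+ w. ennreal (- ln (mass w)) * emeasure \<mu> {\<omega> \<in> space \<mu>. prefix \<omega> n = w} \<partial>count_space UNIV)"
    by (rule nn_integral_countable_valued) measurable
  also have "\<dots> = (\<integral>\<^sup>+ w. ennreal (- mass w * ln (mass w)) * indicator {w. length w = n} w \<partial>count_space UNIV)"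
  proof (rule nn_integral_cong)
    fix w :: "'i list"
    show "ennreal (- ln (mass w)) * emeasure \<mu> {\<omega> \<in> space \<mu>. prefix \<omega> n = w} =
      ennreal (- mass w * ln (mass w)) * indicator {w. length w = n} w"
    proof (cases "length w = n")
      case True
      then have "emeasure \<mu> {\<omega> \<in> space \<mu>. prefix \<omega> n = w} = ennreal (mass w)"
        by (auto simp: mass_def cyl_eq_prefix emeasure_eq_measure)
      moreover have "0 \<le> - ln (mass w)"
        using mass_nonneg[of w] mass_le_1[of w] by (cases "mass w = 0") (auto simp del: mass_le_1 mass_nonneg)
      ultimately show ?thesis using True by (simp add: ennreal_mult[symmetric] mult.commute)
    next
      case False
      then have "{\<omega> \<in> space \<mu>. prefix \<omega> n = w} = {}" by auto
      then show ?thesis using False by simp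
    qed
  qed
  also have "\<dots> = part_entropy \<mu> n"
    unfolding part_entropy_def mass_def by (rule nn_integral_count_space_indicator[symmetric]) simp
  finally show ?thesis ..
qed


lemma part_entropy_mono: "part_entropy \<mu> 1 \<le> part_entropy \<mu> (Suc n)"
  unfolding part_entropy_eq
proof (rule nn_integral_mono_AE)
  show "AE \<omega> in \<mu>. ennreal (- ln (mass (prefix \<omega> 1))) \<le> ennreal (- ln (mass (prefix \<omega> (Suc n))))"
    using AE_mass_pos
  proof (rule AE_mp, intro AE_I2 impI)
    fix \<omega> assume "\<forall>n. 0 < mass (prefix \<omega> n)"
    moreover have "mass (prefix \<omega> (1 + n)) \<le> mass (prefix \<omega> 1)"
      unfolding prefix_add by (rule mass_append_le)
    ultimately show "ennreal (- ln (mass (prefix \<omega> 1))) \<le> ennreal (- ln (mass (prefix \<omega> (Suc n))))"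
      by (intro ennreal_leI) (simp only: neg_le_iff_le ln_le_cancel_iff plus_1_eq_Suc)
  qed
qed

text \<open>This avoids proving that the limit in \<open>entropy\<close> exists: if the first
  partition had infinite entropy, so would all later ones by monotonicity, and the sequence would
  converge to infinity.\<close>

lemma part_entropy_1_finite:
  assumes "Defs.entropy \<mu> < \<infinity>"
  shows "part_entropy \<mu> 1 \<noteq> \<infinity>"
proof
  assume inf: "part_entropy \<mu> 1 = \<infinity>"
  have "part_entropy \<mu> n / of_nat n = \<infinity>" if n: "n > 0" for n
  proof -
    obtain n' where "n = Suc n'" using n by (cases n) auto
    then have "part_entropy \<mu> n = \<infinity>" using part_entropy_mono[of n'] inf by (simp add: top_unique)
    then show ?thesis by (simp add: ennreal_top_divide)
  qed
  then have "\<forall>\<^sub>F n in sequentially. part_entropy \<mu> n / of_nat n = \<infinity>"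
    by (intro eventually_sequentiallyI[of 1]) auto
  then have "(\<lambda>n. part_entropy \<mu> n / of_nat n) \<longlonglongrightarrow> \<infinity>" by (rule tendsto_eventually)
  then have "Defs.entropy \<mu> = \<infinity>" unfolding Defs.entropy_def by (rule limI)
  then show False using assms by simp
qed

lemma AE_ln_mass: "AE \<omega> in \<mu>. \<forall>n. 0 \<le> - ln (mass (prefix \<omega> n))"
  using AE_mass_pos by (rule AE_mp) (auto intro!: AE_I2)

lemma integrable_of_entropy_finite:
  assumes "Defs.entropy \<mu> < \<infinity>"
  shows "integrable \<mu> (\<lambda>\<omega>. - ln (mass (prefix \<omega> 1)))"
proof (rule integrableI_nonneg)
  show "(\<lambda>\<omega>. - ln (mass (prefix \<omega> 1))) \<in> borel_measurable \<mu>"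
    by (rule prefix_fun_measurable[of "\<lambda>w. - ln (mass w)"]) simp
  show "AE \<omega> in \<mu>. 0 \<le> - ln (mass (prefix \<omega> 1))"
    using AE_ln_mass by (rule AE_mp) (auto intro!: AE_I2)
  show "(\<integral>\<^sup>+ \<omega>. ennreal (- ln (mass (prefix \<omega> 1))) \<partial>\<mu>) < \<infinity>"
    using part_entropy_1_finite[OF assms] unfolding part_entropy_eq by (simp add: less_top)
qed


section \<open>Block weights of words\<close>

lemma nn_integral_mass_words: "(\<integral>\<^sup>+ w. ennreal (mass w) \<partial>count_space {w. length w = n}) = 1"
proof -
  have "(\<integral>\<^sup>+ w. ennreal (mass w) * indicator {w. length w = n} w \<partial>count_space UNIV)
      = (\<integral>\<^sup>+ w. 1 * emeasure \<mu> {\<omega> \<in> space \<mu>. prefix \<omega> n = w} \<partial>count_space UNIV)"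
  proof (rule nn_integral_cong)
    fix w :: "'i list"
    have "{\<omega>. prefix \<omega> n = w} = (if length w = n then cyl w else {})"
      by (auto simp: cyl_eq_prefix)
    then show "ennreal (mass w) * indicator {w. length w = n} w = 1 * emeasure \<mu> {\<omega> \<in> space \<mu>. prefix \<omega> n = w}"
      by (simp add: mass_def emeasure_eq_measure)
  qed
  also have "\<dots> = (\<integral>\<^sup>+ \<omega>. 1 \<partial>\<mu>)"
    by (rule nn_integral_countable_valued[symmetric]) measurable
  also have "\<dots> = 1" by (simp add: emeasure_space_1 del: space_\<mu>)
  finally show ?thesis by (simp add: nn_integral_count_space_indicator)
qed

text \<open>A subprobability on the words of each length that dominates, up to the factor
  \<open>1 / (l * (l + 1))\<close> per block of length \<open>l\<close>, every product of masses of consecutive blocks.\<close>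

function block_weight :: "'i list \<Rightarrow> real" where
  "block_weight w = (if w = [] then 1 else
     (\<Sum>l\<in>{..<length w}. mass (take (Suc l) w) / (real (Suc l) * real (Suc (Suc l))) * block_weight (drop (Suc l) w)))"
  by auto
termination by (relation "Wellfounded.measure length") auto

declare block_weight.simps [simp del]

lemma block_weight_Nil [simp]: "block_weight [] = 1" by (simp add: block_weight.simps)

lemma block_weight_nonneg: "0 \<le> block_weight w"
proof (induction w rule: block_weight.induct)
  case (1 w)
  then show ?case
    by (subst block_weight.simps) (auto intro!: sum_nonneg mult_nonneg_nonneg divide_nonneg_nonneg)
qed

lemma block_weight_append:
  assumes "u \<noteq> []"
  shows "mass u / (real (length u) * real (Suc (length u))) * block_weight v \<le> block_weight (u @ v)"
proof -
  let ?t = "\<lambda>l. mass (take (Suc l) (u @ v)) / (real (Suc l) * real (Suc (Suc l))) * block_weight (drop (Suc l) (u @ v))"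
  \<comment> \<open>Summand \<open>l\<close> of the recursion stands for a first block of length
    \<open>Suc l\<close>, so the block \<open>u\<close> has index
    \<open>length u - 1\<close>.\<close>
  have "?t (length u - 1) \<le> sum ?t {..<length (u @ v)}"
    using assms by (intro member_le_sum)
      (auto simp: less_Suc_eq_le[symmetric] Suc_pred' trans_less_add1 intro!: mult_nonneg_nonneg divide_nonneg_nonneg block_weight_nonneg simp del: of_nat_Suc)
  also have "\<dots> = block_weight (u @ v)" using assms by (subst (2) block_weight.simps) simp
  also have "?t (length u - 1) = mass u / (real (length u) * real (Suc (length u))) * block_weight v"
    using assms by (simp del: of_nat_Suc)
  finally show ?thesis .
qed

lemma nn_integral_split_words:
  fixes g h :: "'i list \<Rightarrow> ennreal"
  assumes "l \<le> n"
  shows "(\<integral>\<^sup>+ w. g (take l w) * h (drop l w) \<partial>count_space {w. length w = n}) =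
     (\<integral>\<^sup>+ u. g u \<partial>count_space {u. length u = l}) * (\<integral>\<^sup>+ v. h v \<partial>count_space {v. length v = n - l})"
proof -
  have bij: "bij_betw (\<lambda>(u, v). u @ v) ({u::'i list. length u = l} \<times> {v. length v = n - l}) {w. length w = n}"
    by (rule bij_betwI[of _ _ _ "\<lambda>w. (take l w, drop l w)"]) (use assms in auto)
  have "(\<integral>\<^sup>+ w. g (take l w) * h (drop l w) \<partial>count_space {w. length w = n}) =
    (\<integral>\<^sup>+ p. g (take l (case p of (u, v) \<Rightarrow> u @ v)) * h (drop l (case p of (u, v) \<Rightarrow> u @ v))
       \<partial>count_space ({u. length u = l} \<times> {v. length v = n - l}))"
    by (rule nn_integral_bij_count_space[OF bij, symmetric])
  also have "\<dots> = (\<integral>\<^sup>+ p. g (fst p) * h (snd p) \<partial>count_space ({u. length u = l} \<times> {v. length v = n - l}))"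
    by (rule nn_integral_cong) auto
  also have "\<dots> = (\<integral>\<^sup>+ p. g (fst p) * h (snd p) \<partial>(count_space {u. length u = l} \<Otimes>\<^sub>M count_space {v. length v = n - l}))"
    by (simp add: pair_measure_countable)
  also have "\<dots> = (\<integral>\<^sup>+ u. (\<integral>\<^sup>+ v. g u * h v \<partial>count_space {v. length v = n - l}) \<partial>count_space {u. length u = l})"
    by (subst sigma_finite_measure.nn_integral_fst[symmetric])
      (auto intro!: sigma_finite_measure_count_space_countable simp: pair_measure_countable)
  also have "\<dots> = (\<integral>\<^sup>+ u. g u \<partial>count_space {u. length u = l}) * (\<integral>\<^sup>+ v. h v \<partial>count_space {v. length v = n - l})"
    by (simp add: nn_integral_cmult nn_integral_multc)
  finally show ?thesis .
qed

text \<open>The reason for the factor \<open>1 / (l * (l + 1))\<close> per block: the factors sum to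
  less than 1, which keeps \<open>block_weight\<close> a subprobability, while their logarithms are
  \<open>o(l)\<close>.\<close>

lemma sum_inverse_oblong: "(\<Sum>l<n. 1 / (real (Suc l) * real (Suc (Suc l)))) = 1 - 1 / real (Suc n)"
proof (induction n)
  case (Suc n)
  have "1 / (x * (x + 1)) = 1 / x - 1 / (x + 1)" if "0 < x" for x :: real
    using that by (simp add: field_simps)
  from this[of "real (Suc n)"] show ?case using Suc by (simp add: add.commute)
qed simp

text \<open>Induction on \<open>n\<close>, sorted by the length of the first block: for a fixed
  length the first blocks have total mass 1 and the remainders total weight at most 1.\<close>

lemma nn_integral_block_weight_le_1:
  "(\<integral>\<^sup>+ w. ennreal (block_weight w) \<partial>count_space {w. length w = n}) \<le> 1"
proof (induction n rule: less_induct)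
  case (less n)
  show ?case
  proof (cases "n = 0")
    case True
    then have "{w::'i list. length w = n} = {[]}" by auto
    then show ?thesis by (simp add: nn_integral_count_space_finite)
  next
    case False
    let ?p = "\<lambda>l. 1 / (real (Suc l) * real (Suc (Suc l)))"
    have "(\<integral>\<^sup>+ w. ennreal (block_weight w) \<partial>count_space {w. length w = n}) =
      (\<integral>\<^sup>+ w. (\<Sum>l<n. ennreal (?p l) * (ennreal (mass (take (Suc l) w)) * ennreal (block_weight (drop (Suc l) w)))) \<partial>count_space {w. length w = n})"
    proof (rule nn_integral_cong)
      fix w :: "'i list" assume "w \<in> space (count_space {w. length w = n})"
      then have w: "length w = n" "w \<noteq> []" using False by auto
      have "block_weight w = (\<Sum>l<n. ?p l * (mass (take (Suc l) w) * block_weight (drop (Suc l) w)))"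
        using w by (subst block_weight.simps) (simp del: of_nat_Suc)
      then show "ennreal (block_weight w) = (\<Sum>l<n. ennreal (?p l) * (ennreal (mass (take (Suc l) w)) * ennreal (block_weight (drop (Suc l) w))))"
        using block_weight_nonneg by (simp add: ennreal_mult[symmetric] sum_ennreal del: of_nat_Suc)
    qed
    also have "\<dots> = (\<Sum>l<n. ennreal (?p l) * (\<integral>\<^sup>+ w. ennreal (mass (take (Suc l) w)) * ennreal (block_weight (drop (Suc l) w)) \<partial>count_space {w. length w = n}))"
      by (subst nn_integral_sum) (auto intro!: sum.cong nn_integral_cmult)
    also have "\<dots> \<le> (\<Sum>l<n. ennreal (?p l) * 1)"
    proof (intro sum_mono mult_left_mono)
      fix l assume "l \<in> {..<n}"
      then have l: "Suc l \<le> n" by simp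
      have "(\<integral>\<^sup>+ w. ennreal (mass (take (Suc l) w)) * ennreal (block_weight (drop (Suc l) w)) \<partial>count_space {w. length w = n})
        = (\<integral>\<^sup>+ v. ennreal (block_weight v) \<partial>count_space {v. length v = n - Suc l})"
        by (subst nn_integral_split_words[OF l]) (simp add: nn_integral_mass_words)
      also have "\<dots> \<le> 1" using l by (intro less) simp
      finally show "(\<integral>\<^sup>+ w. ennreal (mass (take (Suc l) w)) * ennreal (block_weight (drop (Suc l) w)) \<partial>count_space {w. length w = n}) \<le> 1" .
    qed simp
    also have "\<dots> = ennreal (\<Sum>l<n. ?p l)" by (simp add: sum_ennreal del: of_nat_Suc)
    also have "\<dots> \<le> 1" unfolding sum_inverse_oblong by simp
    finally show ?thesis .
  qed
qed

lemma AE_block_weight_le: "AE \<omega> in \<mu>. \<forall>\<^sub>F n in sequentially.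
    block_weight (prefix \<omega> n) \<le> (real n + 1)\<^sup>2 * mass (prefix \<omega> n)"
proof -
  \<comment> \<open>The general estimate sums over all words, whereas \<open>block_weight\<close>
    has total at most 1 on each length separately; the indicator restricts it to length
    \<open>n\<close>.\<close>
  have "AE \<omega> in \<mu>. \<forall>\<^sub>F n in sequentially.
     block_weight (prefix \<omega> n) * indicator {w. length w = n} (prefix \<omega> n) \<le>
     (real n + 1)\<^sup>2 * measure \<mu> {\<omega>' \<in> space \<mu>. prefix \<omega>' n = prefix \<omega> n}"
  proof (rule AE_weight_le_mass)
    show "(\<lambda>\<omega>. prefix \<omega> n) \<in> measurable \<mu> (count_space UNIV)" for n by measurable
    show "0 \<le> block_weight c * indicator {w. length w = n} c" for n c
      using block_weight_nonneg by (simp add: indicator_def)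
    show "(\<integral>\<^sup>+ c. ennreal (block_weight c * indicator {w. length w = n} c) \<partial>count_space UNIV) \<le> 1" for n
      using nn_integral_block_weight_le_1[of n] block_weight_nonneg
      by (simp add: nn_integral_count_space_indicator ennreal_mult ennreal_indicator)
  qed
  then show ?thesis by (simp add: mass_prefix)
qed

text \<open>Two levels \<open>q < q'\<close> are put between the supposedly reversed liminfs; for
  large \<open>n\<close> their gap times \<open>n\<close> absorbs both \<open>C\<close> and the
  change of denominator from \<open>n + 1\<close> to \<open>n\<close>.\<close>

lemma liminf_Suc_le:
  fixes u v :: "nat \<Rightarrow> real"
  assumes "\<And>n. u (Suc n) \<le> C + v n"
  shows "liminf (\<lambda>n. ereal (u n / n)) \<le> liminf (\<lambda>n. ereal (v n / n))"
proof (rule ccontr)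
  assume "\<not> ?thesis"
  then have "liminf (\<lambda>n. ereal (v n / n)) < liminf (\<lambda>n. ereal (u n / n))" by (simp only: not_le)
  from ereal_dense2[OF this] obtain q
    where q: "liminf (\<lambda>n. ereal (v n / n)) < ereal q" "ereal q < liminf (\<lambda>n. ereal (u n / n))" by blast
  obtain q' where q': "ereal q < ereal q'" "ereal q' < liminf (\<lambda>n. ereal (u n / n))"
    using ereal_dense2[OF q(2)] by blast
  have "\<forall>\<^sub>F n in sequentially. ereal q' < ereal (u n / n)"
    using q'(2) by (rule less_LiminfD)
  then have ev1: "\<forall>\<^sub>F n in sequentially. q' < u (Suc n) / real (Suc n)"
    using eventually_sequentially_Suc[of "\<lambda>n. q' < u n / real n"] by simp
  obtain N :: nat where N: "(\<bar>C\<bar> + \<bar>q\<bar> + \<bar>q'\<bar>) / (q' - q) < real N" using reals_Archimedean2 by blast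
  have ev2: "\<forall>\<^sub>F n in sequentially. (\<bar>C\<bar> + \<bar>q\<bar> + \<bar>q'\<bar>) / (q' - q) < real n"
    by (rule eventually_mono[OF eventually_ge_at_top[of N]]) (use N in linarith)
  from ev1 ev2 eventually_gt_at_top[of 0] have "\<forall>\<^sub>F n in sequentially. ereal q \<le> ereal (v n / n)"
  proof eventually_elim
    case (elim n)
    have "q' * (real n + 1) < u (Suc n)" using elim(1) by (simp add: field_simps)
    also have "\<dots> \<le> C + v n" by (rule assms)
    finally have "q' * real n + q' - C < v n" by (simp add: algebra_simps)
    moreover have "\<bar>C\<bar> + \<bar>q\<bar> + \<bar>q'\<bar> < (q' - q) * n" using elim(2) q'(1) by (simp add: field_simps)
    ultimately have "q * n \<le> v n" by (simp add: algebra_simps)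
    then show ?case using elim(3) by (simp add: field_simps)
  qed
  then have "ereal q \<le> liminf (\<lambda>n. ereal (v n / n))" by (rule Liminf_bounded)
  then show False using q(1) by simp
qed

lemma liminf_le_Suc:
  fixes u v :: "nat \<Rightarrow> real"
  assumes "\<And>n. v n \<le> C + u (Suc n)"
  shows "liminf (\<lambda>n. ereal (v n / n)) \<le> liminf (\<lambda>n. ereal (u n / n))"
proof (rule ccontr)
  assume "\<not> ?thesis"
  then have "liminf (\<lambda>n. ereal (u n / n)) < liminf (\<lambda>n. ereal (v n / n))" by (simp only: not_le)
  from ereal_dense2[OF this] obtain q
    where q: "liminf (\<lambda>n. ereal (u n / n)) < ereal q" "ereal q < liminf (\<lambda>n. ereal (v n / n))" by blast
  obtain q' where q': "ereal q < ereal q'" "ereal q' < liminf (\<lambda>n. ereal (v n / n))"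
    using ereal_dense2[OF q(2)] by blast
  have ev1: "\<forall>\<^sub>F n in sequentially. ereal q' < ereal (v n / n)"
    using q'(2) by (rule less_LiminfD)
  obtain N :: nat where N: "(\<bar>C\<bar> + \<bar>q\<bar>) / (q' - q) < real N" using reals_Archimedean2 by blast
  have ev2: "\<forall>\<^sub>F n in sequentially. (\<bar>C\<bar> + \<bar>q\<bar>) / (q' - q) < real n"
    by (rule eventually_mono[OF eventually_ge_at_top[of N]]) (use N in linarith)
  from ev1 ev2 eventually_gt_at_top[of 0] have "\<forall>\<^sub>F n in sequentially. ereal q \<le> ereal (u (Suc n) / real (Suc n))"
  proof eventually_elim
    case (elim n)
    have "q' * real n < v n" using elim(1,3) by (simp add: field_simps)
    also have "\<dots> \<le> C + u (Suc n)" by (rule assms)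
    finally have "q' * real n - C < u (Suc n)" by (simp add: algebra_simps)
    moreover have "\<bar>C\<bar> + \<bar>q\<bar> < (q' - q) * n" using elim(2) q'(1) by (simp add: field_simps)
    ultimately have "q * (real n + 1) \<le> u (Suc n)" by (simp add: algebra_simps)
    then show ?case by (simp add: field_simps)
  qed
  then have "\<forall>\<^sub>F n in sequentially. ereal q \<le> ereal (u n / real n)"
    using eventually_sequentially_Suc[of "\<lambda>n. ereal q \<le> ereal (u n / real n)"] by blast
  then have "ereal q \<le> liminf (\<lambda>n. ereal (u n / n))" by (rule Liminf_bounded)
  then show False using q(1) by simp
qed

definition lower_entropy :: "(nat \<Rightarrow> 'i) \<Rightarrow> ereal" where
  "lower_entropy \<omega> = liminf (\<lambda>n. ereal (- ln (mass (prefix \<omega> n)) / n))"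

lemma lower_entropy_measurable [measurable]: "lower_entropy \<in> borel_measurable \<mu>"
  unfolding lower_entropy_def
proof (rule borel_measurable_liminf)
  show "(\<lambda>\<omega>. ereal (- ln (mass (prefix \<omega> n)) / n)) \<in> borel_measurable \<mu>" for n
    by (rule prefix_fun_measurable[of "\<lambda>w. ereal (- ln (mass w) / n)"]) simp
qed

text \<open>Deleting the first symbol can only increase the mass of a cylinder, by invariance of
  \<mu>. This gives one inequality, and preservation of \<mu> upgrades it to equality.\<close>

lemma lower_entropy_invariant: "AE \<omega> in \<mu>. lower_entropy (shift \<omega>) = lower_entropy \<omega>"
proof (rule AE_invariant_of_le)
  show "AE \<omega> in \<mu>. lower_entropy (shift \<omega>) \<le> lower_entropy \<omega>"
    using AE_mass_pos
  proof (rule AE_mp, intro AE_I2 impI)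
    fix \<omega> assume pos: "\<forall>n. 0 < mass (prefix \<omega> n)"
    have le: "- ln (mass (prefix (shift \<omega>) n)) \<le> - ln (mass (prefix \<omega> (Suc n)))" for n
    proof -
      have "mass ([\<omega> 0] @ prefix (shift \<omega>) n) \<le> mass (prefix (shift \<omega>) n)" by (rule mass_append_le)
      then have "mass (prefix \<omega> (Suc n)) \<le> mass (prefix (shift \<omega>) n)" by (simp add: prefix_Suc)
      moreover have "0 < mass (prefix \<omega> (Suc n))" using pos by blast
      ultimately have "ln (mass (prefix \<omega> (Suc n))) \<le> ln (mass (prefix (shift \<omega>) n))" by simp
      then show ?thesis by simp
    qed
    show "lower_entropy (shift \<omega>) \<le> lower_entropy \<omega>"
      unfolding lower_entropy_def
      by (rule liminf_le_Suc[where C=0]) (use le in simp)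
  qed
qed measurable


lemma ln_oblong_over_n_tendsto_0: "(\<lambda>n. ln (real n * real (Suc n)) / real n) \<longlonglongrightarrow> 0"
proof (rule tendsto_sandwich)
  show "\<forall>\<^sub>F n in sequentially. 0 \<le> ln (real n * real (Suc n)) / real n"
  proof (rule eventually_sequentiallyI[of 1])
    fix n :: nat assume n: "1 \<le> n"
    have "1 * 1 \<le> real n * real (Suc n)" using n by (intro mult_mono) auto
    then show "0 \<le> ln (real n * real (Suc n)) / real n" using n by (intro divide_nonneg_nonneg ln_ge_zero) auto
  qed
  show "\<forall>\<^sub>F n in sequentially. ln (real n * real (Suc n)) / real n \<le> 2 * (ln (real n) / real n) + ln 2 / real n"
  proof (rule eventually_sequentiallyI[of 1])
    fix n :: nat assume n: "1 \<le> n"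
    have "ln (real n * real (Suc n)) \<le> ln (2 * real n ^ 2)"
      using n by (subst ln_le_cancel_iff) (auto simp: power2_eq_square)
    also have "\<dots> = 2 * ln (real n) + ln 2" using n by (simp add: ln_mult ln_realpow)
    finally show "ln (real n * real (Suc n)) / real n \<le> 2 * (ln (real n) / real n) + ln 2 / real n"
      using divide_right_mono[of _ _ "real n"] by (fastforce simp: add_divide_distrib)
  qed
  have "(\<lambda>n. 2 * (ln (real n) / real n) + ln 2 / real n) \<longlonglongrightarrow> 2 * 0 + 0"
    by (intro tendsto_intros lim_const_over_n lim_ln_over_n)
  then show "(\<lambda>n. 2 * (ln (real n) / real n) + ln 2 / real n) \<longlonglongrightarrow> 0" by simp
qed (rule tendsto_const)

lemma eventually_ln_le_linear:
  assumes "0 < e"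
  shows "\<forall>\<^sub>F n in sequentially. 2 * ln (real n + 1) \<le> e * real n"
proof -
  have "\<forall>\<^sub>F n in sequentially. ln (real n * real (Suc n)) / real n < e / 2"
    using ln_oblong_over_n_tendsto_0 assms by (intro order_tendstoD) auto
  then show ?thesis using eventually_ge_at_top[of 1]
  proof eventually_elim
    case (elim n)
    have "1 * (real n + 1) \<le> real n * real (Suc n)" using elim(2) by (intro mult_mono) auto
    then have "ln (real n + 1) \<le> ln (real n * real (Suc n))" by (intro ln_mono) auto
    also have "\<dots> \<le> e / 2 * n" using elim by (simp add: field_simps)
    finally show ?case by simp
  qed
qed

text \<open>Here \<open>c l\<close> is the logarithmic price of a block of length \<open>l\<close>
  in \<open>block_weight\<close>. The absolute value in \<psi> only provides nonnegativity
  everywhere, including at sequences with a cylinder of mass 0.\<close>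

theorem shannon_mcmillan_breiman:
  assumes "Defs.entropy \<mu> < \<infinity>"
  shows "AE \<omega> in \<mu>. (\<lambda>n. ereal (- ln (mass (prefix \<omega> n)) / n)) \<longlonglongrightarrow> lower_entropy \<omega> \<and>
    lower_entropy \<omega> < \<infinity>"
  unfolding lower_entropy_def
proof (rule almost_subadditive_ergodic[where F="\<lambda>n \<omega>. - ln (block_weight (prefix \<omega> n))" and
      c="\<lambda>l. ln (real l * real (Suc l))" and \<psi>="\<lambda>\<omega>. \<bar>- ln (mass (prefix \<omega> 1))\<bar>"])
  let ?p = "\<lambda>l. real l * real (Suc l)"
  show "(\<lambda>\<omega>. - ln (mass (prefix \<omega> n))) \<in> borel_measurable \<mu>" for n
    by (rule prefix_fun_measurable[of "\<lambda>w. - ln (mass w)"]) simp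
  have append: "mass u / ?p (length u) * block_weight v \<le> block_weight (u @ v)" if "u \<noteq> []" for u v
    using block_weight_append[OF that] .
  have pos: "0 < block_weight w" if "0 < mass w" for w
  proof (cases "w = []")
    case False
    then have "0 < mass w / ?p (length w) * block_weight []" using that by simp
    then show ?thesis using append[of w "[]"] False by simp
  qed simp
  show "AE \<omega> in \<mu>. \<forall>l m. 1 \<le> l \<longrightarrow> - ln (block_weight (prefix \<omega> (l + m))) \<le>
      - ln (mass (prefix \<omega> l)) + ln (?p l) + - ln (block_weight (prefix ((shift ^^ l) \<omega>) m))"
    using AE_mass_pos
  proof (rule AE_mp, intro AE_I2 impI allI)
    fix \<omega> and l m :: nat
    assume mp: "\<forall>n. 0 < mass (prefix \<omega> n)" and l: "1 \<le> l"
    let ?u = "prefix \<omega> l" and ?v = "prefix ((shift ^^ l) \<omega>) m"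
    have "0 < mass (?u @ ?v)" using mp unfolding prefix_add[symmetric] by blast
    then have v: "0 < mass ?v" using mass_append_le(2)[of ?u ?v] by linarith
    have u: "0 < mass ?u" using mp by blast
    have p: "0 < ?p l" using l by simp
    have ne: "?u \<noteq> []" using l length_prefix[of \<omega> l] by fastforce
    have "mass ?u / ?p l * block_weight ?v \<le> block_weight (?u @ ?v)" using append[OF ne, of ?v] by simp
    then have "ln (mass ?u / ?p l * block_weight ?v) \<le> ln (block_weight (?u @ ?v))"
      using u p pos[OF v] by (intro ln_mono) auto
    moreover have "ln (mass ?u / ?p l * block_weight ?v) = ln (mass ?u) - ln (?p l) + ln (block_weight ?v)"
      using u l pos[OF v] by (simp add: ln_mult_pos ln_div del: of_nat_Suc)
    ultimately show "- ln (block_weight (prefix \<omega> (l + m))) \<le>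
      - ln (mass ?u) + ln (?p l) + - ln (block_weight ?v)"
      unfolding prefix_add by linarith
  qed
  show "AE \<omega> in \<mu>. - ln (block_weight (prefix \<omega> 0)) \<le> 0" by simp
  show "0 \<le> ln (?p l)" for l
  proof (cases "l = 0")
    case False
    then have "1 * 1 \<le> ?p l" by (intro mult_mono) auto
    then show ?thesis by (intro ln_ge_zero) simp
  qed simp
  show "(\<lambda>l. ln (?p l) / real l) \<longlonglongrightarrow> 0" by (rule ln_oblong_over_n_tendsto_0)
  show "integrable \<mu> (\<lambda>\<omega>. \<bar>- ln (mass (prefix \<omega> 1))\<bar>)"
    using integrable_of_entropy_finite[OF assms] by (rule integrable_abs)
  show "AE \<omega> in \<mu>. - ln (mass (prefix \<omega> 1)) \<le> \<bar>- ln (mass (prefix \<omega> 1))\<bar>" by (rule AE_I2) linarith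
  show "AE \<omega> in \<mu>. \<forall>e>0. \<forall>\<^sub>F n in sequentially.
      - ln (mass (prefix \<omega> n)) \<le> - ln (block_weight (prefix \<omega> n)) + e * real n"
    using AE_mass_pos AE_block_weight_le
  proof eventually_elim
    case (elim \<omega>)
    show ?case
    proof (intro allI impI)
      fix e :: real assume "0 < e"
      from eventually_ln_le_linear[OF this] elim(2)
      show "\<forall>\<^sub>F n in sequentially. - ln (mass (prefix \<omega> n)) \<le> - ln (block_weight (prefix \<omega> n)) + e * real n"
      proof eventually_elim
        case le: (elim n)
        have m: "0 < mass (prefix \<omega> n)" using elim(1) by blast
        have "ln (block_weight (prefix \<omega> n)) \<le> ln ((real n + 1)\<^sup>2 * mass (prefix \<omega> n))"
          using le(2) pos[OF m] by (intro ln_mono)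
        also have "\<dots> = 2 * ln (real n + 1) + ln (mass (prefix \<omega> n))"
          using m by (subst ln_mult_pos) (auto simp: ln_realpow)
        finally show ?case using le(1) by linarith
      qed
    qed
  qed
  show "AE \<omega> in \<mu>. liminf (\<lambda>n. ereal (- ln (mass (prefix (shift \<omega>) n)) / real n)) =
      liminf (\<lambda>n. ereal (- ln (mass (prefix \<omega> n)) / real n))"
    using lower_entropy_invariant unfolding lower_entropy_def .
qed simp

section \<open>Rates of subadditive functions of words\<close>

definition lower_rate :: "('i list \<Rightarrow> real) \<Rightarrow> (nat \<Rightarrow> 'i) \<Rightarrow> ereal" where
  "lower_rate g \<omega> = liminf (\<lambda>n. ereal (g (prefix \<omega> n) / n))"

lemma lower_rate_measurable [measurable]: "lower_rate g \<in> borel_measurable \<mu>"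
  unfolding lower_rate_def
proof (rule borel_measurable_liminf)
  show "(\<lambda>\<omega>. ereal (g (prefix \<omega> n) / n)) \<in> borel_measurable \<mu>" for n
    by (rule prefix_fun_measurable[of "\<lambda>w. ereal (g w / n)"]) simp
qed

text \<open>Since \<open>g\<close> is nonpositive on the first symbol, prepending that symbol raises
  \<open>g\<close> by at most \<open>C\<close>; this bounds the rate at \<omega> by the rate at the
  shifted sequence.\<close>

lemma lower_rate_invariant:
  assumes "\<And>u v. g (u @ v) \<le> C + g u + g v" "\<And>w. g w \<le> 0"
  shows "AE \<omega> in \<mu>. lower_rate g (shift \<omega>) = lower_rate g \<omega>"
proof (rule AE_invariant_of_ge)
  show "AE \<omega> in \<mu>. lower_rate g \<omega> \<le> lower_rate g (shift \<omega>)"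
    unfolding lower_rate_def
  proof (intro AE_I2 liminf_Suc_le)
    fix \<omega> and n
    have "g ([\<omega> 0] @ prefix (shift \<omega>) n) \<le> C + g [\<omega> 0] + g (prefix (shift \<omega>) n)" by (rule assms(1))
    then show "g (prefix \<omega> (Suc n)) \<le> C + g (prefix (shift \<omega>) n)"
      using assms(2)[of "[\<omega> 0]"] by (simp add: prefix_Suc)
  qed
qed measurable

text \<open>Kingman's theorem for functions of words. Nonpositivity of \<open>g\<close> makes \<psi>
  = 0 an admissible upper bound, and the rate may be minus infinity.\<close>

lemma subadditive_rate:
  assumes g: "\<And>u v. g (u @ v) \<le> C + g u + g v" "\<And>w. g w \<le> 0"
  shows "AE \<omega> in \<mu>. (\<lambda>n. ereal (g (prefix \<omega> n) / n)) \<longlonglongrightarrow> lower_rate g \<omega>"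
proof -
  have "AE \<omega> in \<mu>. (\<lambda>n. ereal (g (prefix \<omega> n) / n)) \<longlonglongrightarrow> liminf (\<lambda>n. ereal (g (prefix \<omega> n) / n)) \<and>
    liminf (\<lambda>n. ereal (g (prefix \<omega> n) / n)) < \<infinity>"
  proof (rule almost_subadditive_ergodic[where F="\<lambda>n \<omega>. g (prefix \<omega> n)" and c="\<lambda>_. \<bar>C\<bar>" and \<psi>="\<lambda>_. 0"])
    show "(\<lambda>\<omega>. g (prefix \<omega> n)) \<in> borel_measurable \<mu>" for n
      by (rule prefix_fun_measurable[of g]) simp
    show "AE \<omega> in \<mu>. \<forall>l m. 1 \<le> l \<longrightarrow> g (prefix \<omega> (l + m)) \<le> g (prefix \<omega> l) + \<bar>C\<bar> + g (prefix ((shift ^^ l) \<omega>) m)"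
    proof (intro AE_I2 allI impI)
      fix \<omega> and l m :: nat
      show "g (prefix \<omega> (l + m)) \<le> g (prefix \<omega> l) + \<bar>C\<bar> + g (prefix ((shift ^^ l) \<omega>) m)"
        using g(1)[of "prefix \<omega> l" "prefix ((shift ^^ l) \<omega>) m"] unfolding prefix_add by linarith
    qed
    show "(\<lambda>l. \<bar>C\<bar> / real l) \<longlonglongrightarrow> 0" by (rule lim_const_over_n)
    show "AE \<omega> in \<mu>. liminf (\<lambda>n. ereal (g (prefix (shift \<omega>) n) / real n)) = liminf (\<lambda>n. ereal (g (prefix \<omega> n) / real n))"
      using lower_rate_invariant[OF g] unfolding lower_rate_def .
  qed (use g(2) in auto)
  then show ?thesis unfolding lower_rate_def by (rule AE_mp) (auto intro!: AE_I2)
qed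

lemma AE_invariant_const:
  fixes h :: "(nat \<Rightarrow> 'i) \<Rightarrow> ereal"
  assumes erg: "\<And>X. X \<in> sets \<mu> \<Longrightarrow> shift -` X = X \<Longrightarrow> measure \<mu> X = 0 \<or> measure \<mu> X = 1"
    and h [measurable]: "h \<in> borel_measurable \<mu>" and inv: "AE \<omega> in \<mu>. h (shift \<omega>) = h \<omega>"
  shows "\<exists>c. AE \<omega> in \<mu>. h \<omega> = c"
proof -
  text \<open>The limsup along the orbit is invariant everywhere and not only almost everywhere.\<close>
  define g where "g \<omega> = limsup (\<lambda>n. h ((shift ^^ n) \<omega>))" for \<omega>
  have g_meas [measurable]: "g \<in> borel_measurable \<mu>"
    unfolding g_def by (intro borel_measurable_limsup measurable_compose[OF iter_meas h])
  have g_shift: "g (shift \<omega>) = g \<omega>" for \<omega>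
  proof -
    have "g (shift \<omega>) = limsup (\<lambda>n. h ((shift ^^ Suc n) \<omega>))"
      unfolding g_def by (simp only: funpow_Suc_right comp_def)
    also have "\<dots> = g \<omega>" unfolding g_def
      using limsup_shift[of "\<lambda>n. h ((shift ^^ n) \<omega>)"] by simp
    finally show ?thesis .
  qed
  have gh: "AE \<omega> in \<mu>. g \<omega> = h \<omega>"
    using AE_orbit[OF inv]
  proof (rule AE_mp, intro AE_I2 impI)
    fix \<omega> assume *: "\<forall>k. h (shift ((shift ^^ k) \<omega>)) = h ((shift ^^ k) \<omega>)"
    have "h ((shift ^^ n) \<omega>) = h \<omega>" for n by (induction n) (use * in auto)
    then show "g \<omega> = h \<omega>" unfolding g_def by (simp add: Limsup_const)
  qed
  define X where "X q = {\<omega>. g \<omega> \<le> ereal (real_of_rat q)}" for q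
  have X_meas: "X q \<in> sets \<mu>" for q
  proof -
    have "{\<omega> \<in> space \<mu>. g \<omega> \<le> ereal (real_of_rat q)} \<in> sets \<mu>" by measurable
    then show ?thesis by (simp add: X_def)
  qed
  have X01: "measure \<mu> (X q) = 0 \<or> measure \<mu> (X q) = 1" for q
    by (rule erg[OF X_meas]) (auto simp: X_def g_shift)
  \<comment> \<open>The almost sure value is the infimum of the rational levels whose sublevel set
    has full measure; it may be infinite, the infimum of the empty set included.\<close>
  define c where "c = Inf {ereal (real_of_rat q) | q. measure \<mu> (X q) = 1}"
  have "AE \<omega> in \<mu>. \<forall>q. (measure \<mu> (X q) = 1 \<longrightarrow> \<omega> \<in> X q) \<and> (measure \<mu> (X q) = 0 \<longrightarrow> \<omega> \<notin> X q)"
    unfolding AE_all_countable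
  proof
    fix q
    show "AE \<omega> in \<mu>. (measure \<mu> (X q) = 1 \<longrightarrow> \<omega> \<in> X q) \<and> (measure \<mu> (X q) = 0 \<longrightarrow> \<omega> \<notin> X q)"
    proof (cases "measure \<mu> (X q) = 1")
      case True
      then have "AE \<omega> in \<mu>. \<omega> \<in> X q" using X_meas[of q] by (simp add: prob_eq_1)
      then show ?thesis using True by auto
    next
      case False
      then have "X q \<in> null_sets \<mu>" using X01[of q] X_meas[of q] by (auto simp: emeasure_eq_measure intro!: null_setsI)
      from AE_not_in[OF this] show ?thesis using False by auto
    qed
  qed
  then have "AE \<omega> in \<mu>. g \<omega> = c"
  proof (rule AE_mp, intro AE_I2 impI)
    fix \<omega> assume *: "\<forall>q. (measure \<mu> (X q) = 1 \<longrightarrow> \<omega> \<in> X q) \<and> (measure \<mu> (X q) = 0 \<longrightarrow> \<omega> \<notin> X q)"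
    have "g \<omega> \<le> c" unfolding c_def by (rule Inf_greatest) (use * in \<open>auto simp: X_def\<close>)
    moreover have "\<not> g \<omega> < c"
    proof
      assume "g \<omega> < c"
      then obtain q where q: "g \<omega> < ereal (real_of_rat q)" "ereal (real_of_rat q) < c"
        using ereal_dense3 by blast
      then have "\<omega> \<in> X q" by (simp add: X_def)
      then have "measure \<mu> (X q) = 1" using * X01[of q] by blast
      then have "c \<le> ereal (real_of_rat q)" unfolding c_def by (intro Inf_lower) auto
      then show False using q(2) by simp
    qed
    ultimately show "g \<omega> = c" by (simp add: order_le_less)
  qed
  with gh have "AE \<omega> in \<mu>. h \<omega> = c" by eventually_elim simp
  then show ?thesis ..
qed

end

section \<open>Singular value decomposition\<close>

text \<open>Maximise the Rayleigh quotient on the unit sphere of \<open>V\<close>; let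
  \<open>c\<close> be the maximum and \<open>x\<close> a maximiser. The form
  \<open>c * (y \<bullet> y) - f y \<bullet> y\<close> is nonnegative on \<open>V\<close> and
  vanishes at \<open>x\<close>. Expanding it at \<open>x + t w\<close> along the defect
  \<open>w = c x - f x\<close> makes the linear coefficient, which is twice the squared norm of
  \<open>w\<close>, vanish.\<close>

lemma selfadjoint_eigenvector:
  fixes f :: "'a::euclidean_space \<Rightarrow> 'a"
  assumes V: "subspace V" "V \<noteq> {0}" and f: "linear f" "f ` V \<subseteq> V"
    and sa: "\<And>x y. f x \<bullet> y = x \<bullet> f y"
  shows "\<exists>x\<in>V. norm x = 1 \<and> (\<exists>c. f x = c *\<^sub>R x)"
proof -
  let ?K = "V \<inter> sphere 0 1"
  have "compact ?K" using V(1) by (intro closed_Int_compact closed_subspace) auto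
  moreover have "?K \<noteq> {}"
  proof -
    obtain z where z: "z \<in> V" "z \<noteq> 0" using V subspace_0 by blast
    then have "(1 / norm z) *\<^sub>R z \<in> ?K" using V(1) by (auto simp: subspace_scale)
    then show ?thesis by blast
  qed
  moreover have "continuous_on ?K (\<lambda>x. f x \<bullet> x)"
    by (intro continuous_on_inner continuous_on_id linear_continuous_on f(1)[unfolded linear_conv_bounded_linear])
  ultimately have "\<exists>x\<in>?K. \<forall>y\<in>?K. f y \<bullet> y \<le> f x \<bullet> x" by (rule continuous_attains_sup)
  then obtain x where x: "x \<in> ?K" "\<And>y. y \<in> ?K \<Longrightarrow> f y \<bullet> y \<le> f x \<bullet> x" by blast
  define c where "c = f x \<bullet> x"
  have xV: "x \<in> V" and xn: "x \<bullet> x = 1" using x(1) by (auto simp: dot_square_norm)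
  have q: "0 \<le> c * (y \<bullet> y) - f y \<bullet> y" if "y \<in> V" for y
  proof (cases "y = 0")
    case True then show ?thesis by simp
  next
    case False
    let ?z = "(1 / norm y) *\<^sub>R y"
    have "?z \<in> ?K" using that V(1) False by (auto simp: subspace_scale)
    from x(2)[OF this] have "f ?z \<bullet> ?z \<le> c" by (simp add: c_def)
    moreover have "f ?z \<bullet> ?z = (f y \<bullet> y) / (y \<bullet> y)"
      using f(1) by (simp add: linear_scale dot_square_norm power2_eq_square)
    ultimately have "(f y \<bullet> y) / (y \<bullet> y) \<le> c" by argo
    then show ?thesis using False by (simp add: divide_le_eq)
  qed
  define w where "w = c *\<^sub>R x - f x"
  have wV: "w \<in> V" unfolding w_def using xV f(2) V(1) by (intro subspace_diff subspace_scale) auto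
  define b k where "b = w \<bullet> w" and "k = c * (w \<bullet> w) - f w \<bullet> w"
  have k: "0 \<le> k" unfolding k_def by (rule q[OF wV])
  have "0 \<le> 2 * t * b + t\<^sup>2 * k" for t
  proof -
    have "0 \<le> c * ((x + t *\<^sub>R w) \<bullet> (x + t *\<^sub>R w)) - f (x + t *\<^sub>R w) \<bullet> (x + t *\<^sub>R w)"
      by (rule q) (use xV wV V(1) in \<open>auto intro: subspace_add subspace_scale\<close>)
    also have "\<dots> = (c * (x \<bullet> x) - f x \<bullet> x) + 2 * t * (c * (x \<bullet> w) - f x \<bullet> w) + t\<^sup>2 * k"
      using f(1) sa[of w x]
      by (simp add: linear_add linear_scale inner_add inner_commute k_def algebra_simps power2_eq_square)
    also have "c * (x \<bullet> x) - f x \<bullet> x = 0" using xn by (simp add: c_def)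
    also have "c * (x \<bullet> w) - f x \<bullet> w = b" unfolding b_def by (subst (3) w_def) (simp add: inner_diff_left)
    finally show ?thesis by simp
  qed
  note quad = this
  \<comment> \<open>A value at which the nonnegative quadratic would be negative unless
    \<open>b = 0\<close>; the summand 1 keeps the denominator positive when
    \<open>k = 0\<close>.\<close>
  define t where "t = - b / (k + 1)"
  have b: "b = - t * (k + 1)" using k by (simp add: t_def)
  have "2 * t * b + t\<^sup>2 * k = - (t\<^sup>2 * (k + 2))" unfolding b by (simp add: algebra_simps power2_eq_square)
  then have "t\<^sup>2 * (k + 2) \<le> 0" using quad[of t] by linarith
  then have "t = 0" using k by (simp add: mult_le_0_iff)
  then have "b = 0" using b by simp
  then have "w = 0" by (simp add: b_def)
  then have "f x = c *\<^sub>R x" by (simp add: w_def)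
  then show ?thesis using x(1) by auto
qed

text \<open>Induction on the dimension: split off one unit eigenvector; its orthogonal complement in
  \<open>V\<close> is again invariant because \<open>f\<close> is self-adjoint.\<close>

lemma selfadjoint_eigenbasis:
  fixes f :: "'a::euclidean_space \<Rightarrow> 'a"
  assumes f: "linear f" and sa: "\<And>x y. f x \<bullet> y = x \<bullet> f y"
  shows "subspace V \<Longrightarrow> f ` V \<subseteq> V \<Longrightarrow>
    \<exists>B\<subseteq>V. pairwise orthogonal B \<and> (\<forall>x\<in>B. norm x = 1 \<and> (\<exists>c. f x = c *\<^sub>R x)) \<and> span B = V"
proof (induction "dim V" arbitrary: V rule: less_induct)
  case less
  show ?case
  proof (cases "V = {0}")
    case True
    then show ?thesis by (intro exI[of _ "{}"]) auto
  next
    case False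
    obtain x c where x: "x \<in> V" "norm x = 1" "f x = c *\<^sub>R x"
      using selfadjoint_eigenvector[OF less.prems(1) False f less.prems(2) sa] by blast
    have xx: "x \<bullet> x = 1" using x(2) by (simp add: dot_square_norm)
    define W where "W = {y \<in> V. x \<bullet> y = 0}"
    have W: "subspace W"
      using less.prems(1) unfolding W_def subspace_def by (auto simp: inner_add_right)
    have fW: "f ` W \<subseteq> W"
      using less.prems(2) x(3) by (auto simp: W_def sa[of x, symmetric])
    have "x \<notin> W" using xx by (simp add: W_def)
    moreover have "W \<subseteq> V" by (auto simp: W_def)
    ultimately have "W \<subset> V" using x(1) by blast
    then have "dim W < dim V"
      using W less.prems(1) by (intro dim_psubset) (simp add: span_eq_iff[THEN iffD2])
    from less.hyps[OF this W fW] obtain B where B: "B \<subseteq> W" "pairwise orthogonal B"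
      "\<forall>x\<in>B. norm x = 1 \<and> (\<exists>c. f x = c *\<^sub>R x)" "span B = W" by blast
    have "span (insert x B) = V"
    proof
      show "span (insert x B) \<subseteq> V"
        using B(1) x(1) less.prems(1) by (intro span_minimal) (auto simp: W_def)
      show "V \<subseteq> span (insert x B)"
      proof
        fix y assume y: "y \<in> V"
        have "y - (x \<bullet> y) *\<^sub>R x \<in> W"
          using y x(1) xx less.prems(1) by (auto simp: W_def inner_diff_right intro: subspace_diff subspace_scale)
        then have "y - (x \<bullet> y) *\<^sub>R x \<in> span B" using B(4) by simp
        then show "y \<in> span (insert x B)" by (auto simp: span_insert)
      qed
    qed
    moreover have "pairwise orthogonal (insert x B)"
      using B(1,2) by (auto simp: pairwise_insert W_def orthogonal_def inner_commute)
    ultimately show ?thesis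
      using x B by (intro exI[of _ "insert x B"]) (auto simp: W_def)
  qed
qed

text \<open>Indexed by natural numbers and not by the type \<open>'n\<close>, so that the vectors
  match the positions in the list \<open>sing_vals\<close>.\<close>

definition orthonormal_family :: "(nat \<Rightarrow> real^'n) \<Rightarrow> bool" where
  "orthonormal_family e \<longleftrightarrow> (\<forall>i<CARD('n). \<forall>j<CARD('n). e i \<bullet> e j = (if i = j then 1 else 0))"

lemma orthonormal_familyD:
  fixes e :: "nat \<Rightarrow> real^'n"
  assumes "orthonormal_family e" "i < CARD('n)" "j < CARD('n)"
  shows "e i \<bullet> e j = (if i = j then 1 else 0)"
  using assms by (auto simp: orthonormal_family_def)

lemma orthonormal_family_norm:
  fixes e :: "nat \<Rightarrow> real^'n"
  assumes "orthonormal_family e" "i < CARD('n)"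
  shows "norm (e i) = 1"
  using orthonormal_familyD[OF assms assms(2)] by (simp add: norm_eq_sqrt_inner)

lemma orthonormal_family_inj:
  fixes e :: "nat \<Rightarrow> real^'n"
  assumes "orthonormal_family e"
  shows "inj_on e {..<CARD('n)}"
proof (rule inj_onI)
  fix i j assume ij: "i \<in> {..<CARD('n)}" "j \<in> {..<CARD('n)}" "e i = e j"
  show "i = j"
  proof (rule ccontr)
    assume "i \<noteq> j"
    then have "e i \<bullet> e j = 0" using orthonormal_familyD[OF assms, of i j] ij by simp
    moreover have "e i \<bullet> e i = 1" using orthonormal_familyD[OF assms, of i i] ij by simp
    ultimately show False using ij(3) by simp
  qed
qed

lemma orthonormal_family_expansion:
  fixes e :: "nat \<Rightarrow> real^'n"
  assumes e: "orthonormal_family e"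
  shows "(\<Sum>l<CARD('n). (x \<bullet> e l) *\<^sub>R e l) = x"
proof -
  let ?B = "e ` {..<CARD('n)}"
  have po: "pairwise orthogonal ?B"
    using orthonormal_familyD[OF e] by (auto simp: pairwise_def orthogonal_def) 
  have n1: "norm y = 1" if "y \<in> ?B" for y using orthonormal_family_norm[OF e] that by auto
  have "independent ?B"
    by (rule pairwise_orthogonal_independent[OF po]) (use n1 in force)
  moreover have "card ?B = CARD('n)" using orthonormal_family_inj[OF e] by (simp add: card_image)
  ultimately have "span ?B = UNIV"
    using card_ge_dim_independent[of ?B UNIV] by auto
  then have "(\<Sum>y\<in>?B. (x \<bullet> y) *\<^sub>R y) = x"
    by (intro orthonormal_basis_expand[OF po n1]) auto
  then show ?thesis using orthonormal_family_inj[OF e] by (simp add: sum.reindex)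
qed

lemma orthonormal_family_norm_le:
  fixes e :: "nat \<Rightarrow> real^'n"
  assumes e: "orthonormal_family e"
  shows "norm x \<le> (\<Sum>l<CARD('n). \<bar>x \<bullet> e l\<bar>)"
proof -
  have "norm x = norm (\<Sum>l<CARD('n). (x \<bullet> e l) *\<^sub>R e l)" by (simp only: orthonormal_family_expansion[OF e])
  also have "\<dots> \<le> (\<Sum>l<CARD('n). norm ((x \<bullet> e l) *\<^sub>R e l))" by (rule norm_sum)
  also have "\<dots> = (\<Sum>l<CARD('n). \<bar>x \<bullet> e l\<bar>)"
    using orthonormal_family_norm[OF e] by (intro sum.cong) auto
  finally show ?thesis .
qed

lemma orthonormal_family_of_list:
  fixes xs :: "(real^'n) list"
  assumes "distinct xs" "length xs = CARD('n)" "pairwise orthogonal (set xs)" "\<And>x. x \<in> set xs \<Longrightarrow> norm x = 1"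
  shows "orthonormal_family (nth xs)"
  unfolding orthonormal_family_def
proof (intro allI impI)
  fix i j assume ij: "i < CARD('n)" "j < CARD('n)"
  show "xs ! i \<bullet> xs ! j = (if i = j then 1 else 0)"
  proof (cases "i = j")
    case True
    then show ?thesis using assms(4)[of "xs ! i"] assms(2) ij by (simp add: dot_square_norm)
  next
    case False
    then have "xs ! i \<noteq> xs ! j" using assms(1,2) ij by (simp add: nth_eq_iff_index_eq)
    then have "orthogonal (xs ! i) (xs ! j)"
      using assms(2,3) ij by (auto simp: pairwise_def)
    then show ?thesis using False by (simp add: orthogonal_def)
  qed
qed

text \<open>\<open>idx\<close> is any enumeration of the index type. It lets a family indexed by
  natural numbers serve as the columns of a matrix, with determinant defined up to sign.\<close>

definition column_matrix :: "('n \<Rightarrow> nat) \<Rightarrow> (nat \<Rightarrow> real^'n) \<Rightarrow> real^'n^'n" where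
  "column_matrix idx e = (\<chi> i j. e (idx j) $ i)"

lemma transpose_column_matrix_mult:
  "(transpose (column_matrix idx e) ** X) $ i $ j = e (idx i) \<bullet> column j X"
  by (simp add: column_matrix_def matrix_matrix_mult_def transpose_def inner_vec_def column_def)

lemma column_column_matrix [simp]: "column j (column_matrix idx e) = e (idx j)"
  by (simp add: column_matrix_def column_def vec_eq_iff)

lemma orthonormal_column_matrix:
  fixes e :: "nat \<Rightarrow> real^'n"
  assumes e: "orthonormal_family e" and idx: "bij_betw idx (UNIV :: 'n set) {..<CARD('n)}"
  shows "transpose (column_matrix idx e) ** column_matrix idx e = mat 1"
    "column_matrix idx e ** transpose (column_matrix idx e) = mat 1"
    "\<bar>det (column_matrix idx e)\<bar> = 1"
proof -
  have lt: "idx i < CARD('n)" for i using idx by (auto simp: bij_betw_def)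
  have inj: "idx i = idx j \<longleftrightarrow> i = j" for i j using idx by (auto simp: bij_betw_def inj_on_def)
  show 1: "transpose (column_matrix idx e) ** column_matrix idx e = mat 1"
    using orthonormal_familyD[OF e lt lt] inj by (auto simp: vec_eq_iff transpose_column_matrix_mult mat_def)
  then show "column_matrix idx e ** transpose (column_matrix idx e) = mat 1"
    by (simp add: matrix_left_right_inverse)
  have "det (column_matrix idx e) * det (column_matrix idx e) = 1"
    using arg_cong[OF 1, of det] by (simp add: det_mul)
  then have "\<bar>det (column_matrix idx e)\<bar>\<^sup>2 = 1" by (simp add: power2_eq_square)
  then show "\<bar>det (column_matrix idx e)\<bar> = 1" by (auto simp: power2_eq_1_iff)
qed

lemma ex_index: "\<exists>idx. bij_betw idx (UNIV :: 'n::finite set) {..<CARD('n)}"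
  using ex_bij_betw_finite_nat[of "UNIV :: 'n set"] by (auto simp: atLeast0LessThan)


lemma orthonormal_spanning_set_card:
  fixes B :: "(real^'n) set"
  assumes "pairwise orthogonal B" "\<And>x. x \<in> B \<Longrightarrow> norm x = 1" "span B = UNIV"
  shows "finite B" "card B = CARD('n)"
proof -
  have "independent B" by (rule pairwise_orthogonal_independent) (use assms in force)+
  then show "finite B" "card B = CARD('n)"
    using independent_bound_general[of B] dim_eq_card[of B UNIV] assms(3) by auto
qed

text \<open>Diagonalisation lifted to matrices over polynomials: \<open>C\<close> embeds constants
  and \<open>L X\<close> is the characteristic matrix of \<open>X\<close>. From
  \<open>S ** P = P ** D\<close> one gets \<open>L S ** C P = C P ** L D\<close>, and the nonzero
  determinant of \<open>C P\<close> cancels.\<close>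

lemma proots_charpoly_diagonalised:
  fixes S :: "real^'n^'n" and e :: "nat \<Rightarrow> real^'n" and eva :: "nat \<Rightarrow> real"
  assumes e: "orthonormal_family e" and eig: "\<And>l. l < CARD('n) \<Longrightarrow> S *v e l = eva l *\<^sub>R e l"
  shows "proots (charpoly S) = mset (map eva [0..<CARD('n)])"
proof -
  obtain idx where idx: "bij_betw idx (UNIV :: 'n set) {..<CARD('n)}" using ex_index by blast
  have lt: "idx i < CARD('n)" for i using idx by (auto simp: bij_betw_def)
  let ?P = "column_matrix idx e"
  let ?D = "(\<chi> i j. if i = j then eva (idx j) else 0) :: real^'n^'n"
  define C :: "real^'n^'n \<Rightarrow> (real poly)^'n^'n" where "C X = (\<chi> i j. [:X $ i $ j:])" for X
  define L :: "real^'n^'n \<Rightarrow> (real poly)^'n^'n" where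
    "L X = (\<chi> i j. (if i = j then [:0, 1:] else 0) - [:X $ i $ j:])" for X
  have C_mult: "C (X ** Y) = C X ** C Y" for X Y
    by (simp add: C_def matrix_matrix_mult_def vec_eq_iff sum_to_poly mult.commute)
  have SP: "S ** ?P = ?P ** ?D"
  proof -
    have "(S ** ?P) $ i $ j = (?P ** ?D) $ i $ j" for i j
    proof -
      have "(S ** ?P) $ i $ j = (S *v e (idx j)) $ i"
        by (simp add: matrix_matrix_mult_def matrix_vector_mult_def column_matrix_def)
      also have "\<dots> = eva (idx j) * e (idx j) $ i" using eig[OF lt] by simp
      also have "\<dots> = (?P ** ?D) $ i $ j"
        by (simp add: matrix_matrix_mult_def column_matrix_def if_distrib[of "\<lambda>x. _ * x"] sum.delta cong: if_cong)
      finally show ?thesis .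
    qed
    then show ?thesis by (simp add: vec_eq_iff)
  qed
  have "(L S ** C ?P) $ i $ j = (C ?P ** L ?D) $ i $ j" for i j
  proof -
    have "(L S ** C ?P) $ i $ j = (\<Sum>k\<in>UNIV. (if i = k then [:0, 1:] * C ?P $ k $ j else 0) - C S $ i $ k * C ?P $ k $ j)"
      unfolding matrix_matrix_mult_def by (auto simp: L_def C_def left_diff_distrib intro!: sum.cong)
    also have "\<dots> = [:0, 1:] * C ?P $ i $ j - C (S ** ?P) $ i $ j"
      unfolding C_mult sum_subtractf by (simp add: sum.delta matrix_matrix_mult_def)
    also have "\<dots> = C ?P $ i $ j * [:0, 1:] - C (?P ** ?D) $ i $ j" by (simp only: SP mult.commute)
    also have "\<dots> = (\<Sum>k\<in>UNIV. (if k = j then C ?P $ i $ k * [:0, 1:] else 0) - C ?P $ i $ k * C ?D $ k $ j)"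
      unfolding C_mult sum_subtractf by (simp add: sum.delta matrix_matrix_mult_def)
    also have "\<dots> = (C ?P ** L ?D) $ i $ j"
      unfolding matrix_matrix_mult_def by (auto simp: L_def C_def right_diff_distrib intro!: sum.cong)
    finally show ?thesis .
  qed
  then have "L S ** C ?P = C ?P ** L ?D" by (simp add: vec_eq_iff)
  then have "det (L S) * det (C ?P) = det (C ?P) * det (L ?D)" unfolding det_mul[symmetric] by simp
  moreover have "det (C ?P) \<noteq> 0"
  proof -
    have "C (mat 1) = mat 1" by (auto simp: C_def mat_def vec_eq_iff)
    then have "det (C (transpose ?P)) * det (C ?P) = 1"
      unfolding det_mul[symmetric] C_mult[symmetric] orthonormal_column_matrix(1)[OF e idx] by simp
    then show ?thesis by auto
  qed
  ultimately have "det (L S) = det (L ?D)" by simp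
  moreover have "det (L ?D) = (\<Prod>i\<in>UNIV. [:- eva (idx i), 1:])"
    by (subst det_diagonal) (auto simp: L_def)
  moreover have "charpoly S = det (L S)" by (simp add: charpoly_def L_def)
  ultimately have "proots (charpoly S) = (\<Sum>i\<in>UNIV. proots [:- eva (idx i), 1:])"
    by (simp add: proots_prod)
  also have "\<dots> = (\<Sum>i\<in>UNIV. {#eva (idx i)#})" by (simp add: proots_linear_factor)
  also have "\<dots> = (\<Sum>l<CARD('n). {#eva l#})" by (rule sum.reindex_bij_betw[OF idx])
  also have "\<dots> = mset (map eva [0..<CARD('n)])"
  proof -
    have "(\<Sum>l<n. {#eva l#}) = mset (map eva [0..<n])" for n by (induction n) auto
    then show ?thesis .
  qed
  finally show ?thesis .
qed

text \<open>Connects the definition of \<open>sing_vals\<close> by roots of a polynomial with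
  geometry: the eigenvectors of \<open>transpose M ** M\<close> are sorted by decreasing eigenvalue,
  so position \<open>i\<close> of the list belongs to \<open>v i\<close>. The last clause says that
  \<open>M\<close> maps \<open>v\<close> to orthogonal vectors of lengths
  \<open>sing_vals M ! i\<close>.\<close>

lemma gram_eigenbasis:
  fixes M :: "real^'n^'n"
  shows "\<exists>v. orthonormal_family v \<and> length (sing_vals M) = CARD('n) \<and>
    (\<forall>i<CARD('n). 0 \<le> sing_vals M ! i) \<and>
    (\<forall>i j. i \<le> j \<longrightarrow> j < CARD('n) \<longrightarrow> sing_vals M ! j \<le> sing_vals M ! i) \<and>
    (\<forall>i<CARD('n). \<forall>x. (M *v v i) \<bullet> (M *v x) = (sing_vals M ! i)\<^sup>2 * (v i \<bullet> x))"
proof -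
  let ?S = "transpose M ** M"
  have S: "(?S *v x) \<bullet> y = (M *v x) \<bullet> (M *v y)" for x y
    by (simp add: matrix_vector_mul_assoc[symmetric] dot_lmul_matrix[symmetric] vector_transpose_matrix)
  have sa: "(?S *v x) \<bullet> y = x \<bullet> (?S *v y)" for x y
    using S[of x y] S[of y x] by (simp add: inner_commute)
  obtain B where B: "pairwise orthogonal B" "\<forall>x\<in>B. norm x = 1 \<and> (\<exists>c. ?S *v x = c *\<^sub>R x)" "span B = UNIV"
    using selfadjoint_eigenbasis[OF matrix_vector_mul_linear[of ?S] sa, of UNIV] by auto
  have fin: "finite B" "card B = CARD('n)" using orthonormal_spanning_set_card[of B] B by auto
  define eva where "eva x = (M *v x) \<bullet> (M *v x)" for x
  have eva: "?S *v x = eva x *\<^sub>R x" if x: "x \<in> B" for x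
  proof -
    obtain c where c: "?S *v x = c *\<^sub>R x" using B(2) x by blast
    have "x \<bullet> x = 1" using B(2) x by (simp add: dot_square_norm)
    then have "c = (?S *v x) \<bullet> x" using c by simp
    also have "\<dots> = eva x" unfolding S eva_def ..
    finally show ?thesis using c by simp
  qed
  obtain ys where ys: "set ys = B" "distinct ys" using finite_distinct_list[OF fin(1)] by blast
  define xs where "xs = rev (sort_key eva ys)"
  have xs: "set xs = B" "distinct xs" "length xs = CARD('n)"
    using ys fin(2) distinct_card[OF ys(2)] by (auto simp: xs_def)
  have srt: "sorted (rev (map eva xs))" by (simp add: xs_def rev_map[symmetric])
  have on: "orthonormal_family (nth xs)"
    by (rule orthonormal_family_of_list) (use xs B in auto)
  have eig: "?S *v (xs ! l) = eva (xs ! l) *\<^sub>R (xs ! l)" if "l < CARD('n)" for l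
    using eva xs that by (auto simp: nth_mem)
  have "proots (charpoly ?S) = mset (map (\<lambda>l. eva (xs ! l)) [0..<CARD('n)])"
    by (rule proots_charpoly_diagonalised[OF on eig])
  also have "map (\<lambda>l. eva (xs ! l)) [0..<CARD('n)] = map eva xs"
    using xs(3) by (intro nth_equalityI) auto
  finally have pr: "proots (charpoly ?S) = mset (rev (map eva xs))" by simp
  have sv: "sing_vals M = map sqrt (map eva xs)"
    unfolding sing_vals_def pr sorted_list_of_multiset_mset sorted_sort_id[OF srt] by simp
  have nth: "sing_vals M ! i = sqrt (eva (xs ! i))" if "i < CARD('n)" for i
    using that xs(3) by (simp add: sv)
  have ev0: "0 \<le> eva x" for x by (simp add: eva_def)
  have mono: "sing_vals M ! j \<le> sing_vals M ! i" if "i \<le> j" "j < CARD('n)" for i j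
  proof -
    have "eva (xs ! j) \<le> eva (xs ! i)"
      using sorted_rev_nth_mono[of "map eva xs" i j] srt that xs(3) by simp
    then show ?thesis using nth[of i] nth[of j] that by simp
  qed
  have "(M *v (xs ! i)) \<bullet> (M *v x) = (sing_vals M ! i)\<^sup>2 * (xs ! i \<bullet> x)" if "i < CARD('n)" for i x
    using S[of "xs ! i" x] eig[OF that] nth[OF that] ev0 by simp
  then show ?thesis using on mono nth ev0 xs(3) by (intro exI[of _ "nth xs"]) (auto simp: sv)
qed

lemma sing_vals_facts:
  fixes M :: "real^'n^'n"
  shows length_sing_vals [simp]: "length (sing_vals M) = CARD('n)"
    and sing_vals_nonneg: "i < CARD('n) \<Longrightarrow> 0 \<le> sing_vals M ! i"
    and sing_vals_antimono: "i \<le> j \<Longrightarrow> j < CARD('n) \<Longrightarrow> sing_vals M ! j \<le> sing_vals M ! i"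
  using gram_eigenbasis[of M] by blast+

text \<open>The left singular vectors are the normalised images of the right ones; invertibility
  makes the singular values positive, so the normalisation is possible.\<close>

lemma svd:
  fixes M :: "real^'n^'n"
  assumes "invertible M"
  obtains u v where "orthonormal_family u" "orthonormal_family v"
    "\<And>l. l < CARD('n) \<Longrightarrow> 0 < sing_vals M ! l"
    "\<And>l. l < CARD('n) \<Longrightarrow> M *v v l = sing_vals M ! l *\<^sub>R u l"
    "\<And>l x. l < CARD('n) \<Longrightarrow> (M *v x) \<bullet> u l = sing_vals M ! l * (x \<bullet> v l)"
proof -
  obtain v where v: "orthonormal_family v"
    and Mv: "\<And>i x. i < CARD('n) \<Longrightarrow> (M *v v i) \<bullet> (M *v x) = (sing_vals M ! i)\<^sup>2 * (v i \<bullet> x)"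
    using gram_eigenbasis[of M] by blast
  have pos: "0 < sing_vals M ! l" if "l < CARD('n)" for l
  proof -
    have "v l \<noteq> 0" using orthonormal_family_norm[OF v that] by auto
    then have "M *v v l \<noteq> 0"
      using assms by (metis invertible_eq_bij bij_is_inj inj_eq matrix_vector_mult_0_right)
    then have "(M *v v l) \<bullet> (M *v v l) \<noteq> 0" by simp
    then show ?thesis using Mv[OF that, of "v l"] sing_vals_nonneg[OF that, of M] by auto
  qed
  define u where "u l = (1 / sing_vals M ! l) *\<^sub>R (M *v v l)" for l
  have "orthonormal_family u"
    unfolding orthonormal_family_def
  proof (intro allI impI)
    fix i j assume ij: "i < CARD('n)" "j < CARD('n)"
    show "u i \<bullet> u j = (if i = j then 1 else 0)"
      using Mv[OF ij(1), of "v j"] orthonormal_familyD[OF v ij] pos[OF ij(1)] pos[OF ij(2)]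
      by (auto simp: u_def power2_eq_square)
  qed
  moreover have "M *v v l = sing_vals M ! l *\<^sub>R u l" if "l < CARD('n)" for l
    using pos[OF that] by (simp add: u_def)
  moreover have "(M *v x) \<bullet> u l = sing_vals M ! l * (x \<bullet> v l)" if "l < CARD('n)" for l x
    using Mv[OF that, of x] pos[OF that]
    by (simp add: u_def inner_commute power2_eq_square)
  ultimately show thesis using that v pos by blast
qed


section \<open>Submultiplicativity of the norms of exterior powers\<close>

definition sv_prod :: "nat \<Rightarrow> real^'n^'n \<Rightarrow> real" where
  "sv_prod k M = (\<Prod>l<k. sing_vals M ! l)"

lemma prod_subset_le_prod_initial:
  fixes a :: "nat \<Rightarrow> real"
  assumes nonneg: "\<And>i. i < d \<Longrightarrow> 0 \<le> a i" and anti: "\<And>i j. i \<le> j \<Longrightarrow> j < d \<Longrightarrow> a j \<le> a i"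
    and J: "J \<subseteq> {..<d}" "card J = k"
  shows "prod a J \<le> prod a {..<k}"
proof -
  have fin: "finite J" using J(1) finite_subset by blast
  have kd: "k \<le> d" using card_mono[OF _ J(1)] J(2) by simp
  show ?thesis
  proof (cases "k = d")
    case True
    then have "J = {..<d}" using J by (intro card_subset_eq) auto
    then show ?thesis using True by simp
  next
    case False
    then have k: "k < d" using kd by simp
    let ?T = "{..<k}"
    have card_eq: "card (J - ?T) = card (?T - J)"
      using J(2) fin by (simp add: card_Diff_subset_Int Int_commute)
    have "prod a J = prod a (J \<inter> ?T) * prod a (J - ?T)"
      using fin by (metis Int_Diff_Un Int_Diff_disjoint finite_Diff finite_Int prod.union_disjoint)
    also have "\<dots> \<le> prod a (J \<inter> ?T) * prod a (?T - J)"
    proof (rule mult_left_mono)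
      have "prod a (J - ?T) \<le> prod (\<lambda>_. a k) (J - ?T)"
        using J(1) nonneg anti by (intro prod_mono) (auto simp: subset_iff)
      also have "\<dots> = prod (\<lambda>_. a k) (?T - J)" using card_eq by simp
      also have "\<dots> \<le> prod a (?T - J)"
        using k nonneg anti by (intro prod_mono) auto
      finally show "prod a (J - ?T) \<le> prod a (?T - J)" .
      show "0 \<le> prod a (J \<inter> ?T)" using J(1) nonneg by (intro prod_nonneg) auto
    qed
    also have "\<dots> = prod a ?T"
      by (metis Int_Diff_Un Int_Diff_disjoint Int_commute finite_Diff finite_Int finite_lessThan prod.union_disjoint)
    finally show ?thesis .
  qed
qed

text \<open>In the basis of left singular vectors the entries of the first \<open>k\<close> columns
  are bounded by the singular value of their row and all others by 1. A term of the Leibniz formula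
  meets the first \<open>k\<close> columns in \<open>k\<close> different rows, so it is at most the
  product of the \<open>k\<close> largest singular values; the factorial counts the terms.\<close>

lemma det_mixed_columns_le:
  fixes M :: "real^'n^'n"
  assumes M: "invertible M" and idx: "bij_betw idx (UNIV :: 'n set) {..<CARD('n)}" and k: "k \<le> CARD('n)"
    and x: "\<And>l. l < CARD('n) \<Longrightarrow> norm (x l) \<le> 1" and y: "\<And>l. l < CARD('n) \<Longrightarrow> norm (y l) \<le> 1"
  shows "\<bar>det (column_matrix idx (\<lambda>l. if l < k then M *v x l else y l))\<bar> \<le> fact CARD('n) * sv_prod k M"
proof -
  obtain u v where uv: "orthonormal_family u" "orthonormal_family v"
    "\<And>l. l < CARD('n) \<Longrightarrow> 0 < sing_vals M ! l"
    "\<And>l x. l < CARD('n) \<Longrightarrow> (M *v x) \<bullet> u l = sing_vals M ! l * (x \<bullet> v l)"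
    using svd[OF M] by metis
  have lt: "idx i < CARD('n)" for i using idx by (auto simp: bij_betw_def)
  let ?w = "\<lambda>l. if l < k then M *v x l else y l"
  let ?U = "column_matrix idx u" and ?W = "column_matrix idx ?w"
  let ?a = "\<lambda>l. sing_vals M ! l"
  define N where "N = transpose ?U ** ?W"
  have "\<bar>det N\<bar> = \<bar>det ?W\<bar>"
    using orthonormal_column_matrix(3)[OF uv(1) idx] by (simp add: N_def det_mul abs_mult)
  have entry: "\<bar>N $ i $ j\<bar> \<le> (if idx j < k then ?a (idx i) else 1)" for i j
  proof -
    have Nij: "N $ i $ j = u (idx i) \<bullet> ?w (idx j)"
      unfolding N_def transpose_column_matrix_mult column_column_matrix ..
    have cs: "\<bar>z \<bullet> z'\<bar> \<le> 1" if "norm z \<le> 1" "norm z' \<le> 1" for z z' :: "real^'n"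
      using Cauchy_Schwarz_ineq2[of z z'] mult_mono[OF that] by simp
    show ?thesis
    proof (cases "idx j < k")
      case True
      then have "N $ i $ j = ?a (idx i) * (x (idx j) \<bullet> v (idx i))"
        using uv(4)[OF lt, of "x (idx j)" i] Nij by (simp add: inner_commute)
      moreover have "\<bar>x (idx j) \<bullet> v (idx i)\<bar> \<le> 1"
        using x[OF lt] orthonormal_family_norm[OF uv(2) lt] by (intro cs) auto
      ultimately show ?thesis using True uv(3)[OF lt, of i] mult_left_le[of "\<bar>x (idx j) \<bullet> v (idx i)\<bar>" "?a (idx i)"]
        by (simp add: abs_mult)
    next
      case False
      then show ?thesis using Nij y[OF lt] orthonormal_family_norm[OF uv(1) lt] by (auto intro!: cs)
    qed
  qed
  have perm: "(\<Prod>i\<in>UNIV. \<bar>N $ i $ p i\<bar>) \<le> sv_prod k M" if p: "p permutes UNIV" for p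
  proof -
    define I where "I = {i. idx (p i) < k}"
    have bij: "bij_betw (idx \<circ> p) UNIV {..<CARD('n)}"
      using permutes_imp_bij[OF p] idx by (rule bij_betw_trans)
    have "bij_betw (idx \<circ> p) I {..<k}"
    proof (rule bij_betwI')
      fix a b show "((idx \<circ> p) a = (idx \<circ> p) b) = (a = b)"
        using bij by (auto simp: bij_betw_def inj_on_def)
    next
      fix l assume "l \<in> {..<k}"
      then have "l \<in> (idx \<circ> p) ` UNIV" using bij k by (auto simp: bij_betw_def)
      then show "\<exists>a\<in>I. l = (idx \<circ> p) a" using \<open>l \<in> {..<k}\<close> by (auto simp: I_def)
    qed (auto simp: I_def)
    then have cI: "card I = k" by (metis bij_betw_same_card card_lessThan)
    have inj: "inj_on idx I" using idx by (auto simp: bij_betw_def inj_on_def)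
    have "(\<Prod>i\<in>UNIV. \<bar>N $ i $ p i\<bar>) \<le> (\<Prod>i\<in>UNIV. if idx (p i) < k then ?a (idx i) else 1)"
      using entry by (intro prod_mono) auto
    also have "\<dots> = (\<Prod>i\<in>I. ?a (idx i))"
      unfolding I_def by (subst prod.inter_filter[symmetric]) auto
    also have "\<dots> = prod ?a (idx ` I)" using inj by (simp add: prod.reindex)
    also have "\<dots> \<le> prod ?a {..<k}"
      using lt cI inj sing_vals_nonneg sing_vals_antimono
      by (intro prod_subset_le_prod_initial[where d="CARD('n)"]) (auto simp: card_image)
    finally show ?thesis by (simp add: sv_prod_def)
  qed
  have "\<bar>det N\<bar> \<le> (\<Sum>p | p permutes UNIV. \<bar>of_int (sign p) * (\<Prod>i\<in>UNIV. N $ i $ p i)\<bar>)"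
    unfolding det_def by (rule sum_abs)
  also have "\<dots> \<le> (\<Sum>p | p permutes (UNIV :: 'n set). sv_prod k M)"
  proof (rule sum_mono)
    fix p assume "p \<in> {p. p permutes (UNIV :: 'n set)}"
    then show "\<bar>of_int (sign p) * (\<Prod>i\<in>UNIV. N $ i $ p i)\<bar> \<le> sv_prod k M"
      using perm[of p] by (simp add: abs_mult abs_prod sign_def)
  qed
  also have "\<dots> = fact CARD('n) * sv_prod k M" by (simp add: card_permutations[OF refl])
  finally show ?thesis using \<open>\<bar>det N\<bar> = \<bar>det ?W\<bar>\<close> by simp
qed

text \<open>A basis of the span of the first \<open>k\<close> vectors is listed before a basis of
  its complement. The span has dimension at most \<open>k\<close>, hence all indices from
  \<open>k\<close> on lie in the complement. With \<open>k = 0\<close> this merely provides some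
  orthonormal family.\<close>

lemma ex_adapted_orthonormal_family:
  fixes x :: "nat \<Rightarrow> real^'n"
  shows "\<exists>f. orthonormal_family f \<and> (\<forall>l<k. \<forall>i. k \<le> i \<longrightarrow> i < CARD('n) \<longrightarrow> x l \<bullet> f i = 0)"
proof -
  let ?S = "span (x ` {..<k})"
  let ?C = "{y. \<forall>z\<in>?S. orthogonal z y}"
  obtain B1 where B1: "B1 \<subseteq> ?S" "pairwise orthogonal B1" "\<And>z. z \<in> B1 \<Longrightarrow> norm z = 1"
    "independent B1" "card B1 = dim ?S"
    by (rule orthonormal_basis_subspace[of ?S]) (simp, blast)
  have sub: "subspace ?C" by (rule subspace_orthogonal_to_vectors)
  obtain B2 where B2: "B2 \<subseteq> ?C" "pairwise orthogonal B2" "\<And>z. z \<in> B2 \<Longrightarrow> norm z = 1"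
    "independent B2" "card B2 = dim ?C"
    by (rule orthonormal_basis_subspace[OF sub]) blast
  have fin: "finite B1" "finite B2" using B1(4) B2(4) independent_imp_finite by auto
  have dims: "card B1 + card B2 = CARD('n)"
    using dim_subspace_orthogonal_to_vectors[of ?S UNIV] B1(5) B2(5) by simp
  have "card B1 \<le> card (x ` {..<k})" using B1(5) dim_le_card[of "x ` {..<k}" "x ` {..<k}"] by (simp add: span_superset)
  also have "\<dots> \<le> k" using card_image_le[of "{..<k}" x] by simp
  finally have c1: "card B1 \<le> k" .
  obtain xs1 where xs1: "set xs1 = B1" "distinct xs1" using finite_distinct_list[OF fin(1)] by blast
  obtain xs2 where xs2: "set xs2 = B2" "distinct xs2" using finite_distinct_list[OF fin(2)] by blast
  note xs = xs1 xs2
  have disj: "B1 \<inter> B2 = {}"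
  proof -
    have False if "z \<in> B1" "z \<in> B2" for z
    proof -
      have "orthogonal z z" using that B1(1) B2(1) by auto
      then show False using B1(3)[OF that(1)] by (simp add: orthogonal_self)
    qed
    then show ?thesis by blast
  qed
  have cross: "orthogonal a b" if "a \<in> B1" "b \<in> B2" for a b
    using that B1(1) B2(1) by auto
  let ?f = "nth (xs1 @ xs2)"
  have len: "length xs1 = card B1" "length xs2 = card B2" using distinct_card[OF xs(2)] distinct_card[OF xs(4)] xs by simp_all
  have "orthonormal_family ?f"
  proof (rule orthonormal_family_of_list)
    show "distinct (xs1 @ xs2)" using xs disj by simp
    show "length (xs1 @ xs2) = CARD('n)" using len dims by simp
    show "pairwise orthogonal (set (xs1 @ xs2))"
      using B1(2) B2(2) cross cross[THEN orthogonal_commute[THEN iffD1]]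
      unfolding set_append xs(1,3) pairwise_def by blast
    show "norm z = 1" if "z \<in> set (xs1 @ xs2)" for z using that xs B1(3) B2(3) by auto
  qed
  moreover have "x l \<bullet> ?f i = 0" if l: "l < k" and i: "k \<le> i" "i < CARD('n)" for l i
  proof -
    have "?f i \<in> B2" using i c1 len dims xs(3) by (auto simp: nth_append)
    then have "orthogonal (x l) (?f i)" using B2(1) l by (auto intro: span_base)
    then show ?thesis by (simp add: orthogonal_def)
  qed
  ultimately show ?thesis by blast
qed

lemma sum_idx:
  fixes g :: "nat \<Rightarrow> 'b::comm_monoid_add"
  assumes "bij_betw idx (UNIV :: 'n::finite set) {..<CARD('n)}"
  shows "(\<Sum>i\<in>UNIV. g (idx i)) = (\<Sum>l<CARD('n). g l)"
  by (rule sum.reindex_bij_betw[OF assms])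

text \<open>\<open>sv_prod k\<close> is the norm of the \<open>k\<close>-th exterior power, which is
  submultiplicative; here this is shown up to a constant with determinants. The first
  \<open>k\<close> right singular vectors of the product span the most expanded volume, and this
  volume is factored through an orthonormal family adapted to their images under
  \<open>B\<close>.\<close>

lemma sv_prod_mult_le:
  fixes A B :: "real^'n^'n"
  assumes A: "invertible A" and B: "invertible B" and k: "k \<le> CARD('n)"
  shows "sv_prod k (A ** B) \<le> (fact CARD('n))\<^sup>2 * sv_prod k A * sv_prod k B"
proof -
  have AB: "invertible (A ** B)" using A B by (rule invertible_mult)
  obtain u v where uv: "orthonormal_family u" "orthonormal_family v"
    "\<And>l. l < CARD('n) \<Longrightarrow> 0 < sing_vals (A ** B) ! l"
    "\<And>l. l < CARD('n) \<Longrightarrow> (A ** B) *v v l = sing_vals (A ** B) ! l *\<^sub>R u l"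
    using svd[OF AB] by metis
  obtain f where f: "orthonormal_family f"
    "\<And>l i. l < k \<Longrightarrow> k \<le> i \<Longrightarrow> i < CARD('n) \<Longrightarrow> (B *v v l) \<bullet> f i = 0"
    using ex_adapted_orthonormal_family[of k "\<lambda>l. B *v v l"] by metis
  obtain idx where idx: "bij_betw idx (UNIV :: 'n set) {..<CARD('n)}" using ex_index by blast
  have lt: "idx i < CARD('n)" for i using idx by (auto simp: bij_betw_def)
  let ?X = "column_matrix idx (\<lambda>l. if l < k then B *v v l else f l)"
  let ?W = "column_matrix idx (\<lambda>l. if l < k then A *v f l else u l)"
  let ?Y = "column_matrix idx (\<lambda>l. if l < k then A *v (B *v v l) else u l)"
  let ?E = "column_matrix idx f"
  \<comment> \<open>The coordinates of the columns of \<open>?X\<close> in the family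
    \<open>f\<close>. As the images under \<open>B\<close> have no component from index
    \<open>k\<close> on, the replaced columns of \<open>?W\<close> never meet them, and so
    \<open>?W ** R = ?Y\<close>.\<close>
  define R where "R = transpose ?E ** ?X"
  have R: "R $ i $ j = f (idx i) \<bullet> (if idx j < k then B *v v (idx j) else f (idx j))" for i j
    unfolding R_def transpose_column_matrix_mult column_column_matrix ..
  have WR: "?W ** R = ?Y"
  proof -
    have "column j (?W ** R) = column j ?Y" for j
    proof -
      let ?w = "\<lambda>l. if l < k then A *v f l else u l"
      have "column j (?W ** R) = (\<Sum>i\<in>UNIV. R $ i $ j *\<^sub>R ?w (idx i))"
        by (simp add: column_def matrix_matrix_mult_def column_matrix_def vec_eq_iff mult.commute)
      also have "\<dots> = (if idx j < k then A *v (B *v v (idx j)) else u (idx j))"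
      proof (cases "idx j < k")
        case True
        let ?b = "B *v v (idx j)"
        have "(\<Sum>i\<in>UNIV. R $ i $ j *\<^sub>R ?w (idx i)) = (\<Sum>i\<in>UNIV. (?b \<bullet> f (idx i)) *\<^sub>R (A *v f (idx i)))"
        proof (rule sum.cong[OF refl])
          fix i :: 'n
          show "R $ i $ j *\<^sub>R ?w (idx i) = (?b \<bullet> f (idx i)) *\<^sub>R (A *v f (idx i))"
            using R[of i j] True f(2)[OF True, of "idx i"] lt[of i] by (auto simp: inner_commute)
        qed
        also have "\<dots> = (\<Sum>l<CARD('n). (?b \<bullet> f l) *\<^sub>R (A *v f l))" by (rule sum_idx[OF idx])
        also have "\<dots> = A *v (\<Sum>l<CARD('n). (?b \<bullet> f l) *\<^sub>R f l)"
          by (simp add: linear_sum[OF matrix_vector_mul_linear[of A]] linear_scale[OF matrix_vector_mul_linear[of A]])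
        also have "\<dots> = A *v ?b" by (simp only: orthonormal_family_expansion[OF f(1)])
        finally show ?thesis using True by simp
      next
        case False
        have "(\<Sum>i\<in>UNIV. R $ i $ j *\<^sub>R ?w (idx i)) = (\<Sum>i\<in>UNIV. if i = j then u (idx j) else 0)"
        proof (rule sum.cong[OF refl])
          fix i :: 'n
          have "idx i = idx j \<longleftrightarrow> i = j" using idx by (auto simp: bij_betw_def inj_on_def)
          then show "R $ i $ j *\<^sub>R ?w (idx i) = (if i = j then u (idx j) else 0)"
            using R[of i j] False orthonormal_familyD[OF f(1) lt lt, of i j] by auto
        qed
        then show ?thesis using False by simp
      qed
      also have "\<dots> = column j ?Y" by simp
      finally show ?thesis .
    qed
    then show ?thesis by (simp add: vec_eq_iff column_def)
  qed
  have "\<bar>det ?Y\<bar> = \<bar>det ?W\<bar> * \<bar>det ?X\<bar>"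
    using orthonormal_column_matrix(3)[OF f(1) idx] unfolding WR[symmetric] R_def
    by (simp add: det_mul abs_mult)
  moreover have "\<bar>det ?W\<bar> \<le> fact CARD('n) * sv_prod k A"
    using orthonormal_family_norm[OF f(1)] orthonormal_family_norm[OF uv(1)]
    by (intro det_mixed_columns_le[OF A idx k]) auto
  moreover have "\<bar>det ?X\<bar> \<le> fact CARD('n) * sv_prod k B"
    using orthonormal_family_norm[OF f(1)] orthonormal_family_norm[OF uv(2)]
    by (intro det_mixed_columns_le[OF B idx k]) auto
  ultimately have "\<bar>det ?Y\<bar> \<le> (fact CARD('n) * sv_prod k A) * (fact CARD('n) * sv_prod k B)"
    by (simp add: mult_mono)
  \<comment> \<open>The columns of \<open>?Y\<close> are multiples of the left singular vectors: by
    the singular value for indices below \<open>k\<close>, and by 1 for the others.\<close>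
  moreover have "\<bar>det ?Y\<bar> = sv_prod k (A ** B)"
  proof -
    let ?U = "column_matrix idx u"
    let ?a = "\<lambda>l. if l < k then sing_vals (A ** B) ! l else 1"
    let ?D = "(\<chi> i j. if i = j then ?a (idx j) else 0) :: real^'n^'n"
    have "?Y = ?U ** ?D"
    proof -
      have "?Y $ i $ j = (?U ** ?D) $ i $ j" for i j
      proof -
        have "(?U ** ?D) $ i $ j = u (idx j) $ i * ?a (idx j)"
          by (simp add: matrix_matrix_mult_def column_matrix_def if_distrib[of "\<lambda>x. _ * x"] sum.delta cong: if_cong)
        moreover have "A *v (B *v v (idx j)) = sing_vals (A ** B) ! idx j *\<^sub>R u (idx j)"
          using uv(4)[OF lt[of j]] by (simp add: matrix_vector_mul_assoc)
        ultimately show ?thesis by (simp add: column_matrix_def)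
      qed
      then show ?thesis by (simp add: vec_eq_iff)
    qed
    then have "\<bar>det ?Y\<bar> = \<bar>det ?D\<bar>"
      using orthonormal_column_matrix(3)[OF uv(1) idx] by (simp add: det_mul abs_mult)
    also have "det ?D = (\<Prod>i\<in>UNIV. ?a (idx i))" by (subst det_diagonal) auto
    also have "\<dots> = (\<Prod>l<CARD('n). ?a l)" by (rule prod.reindex_bij_betw[OF idx])
    also have "\<dots> = (\<Prod>l<k. ?a l)"
      using k by (intro prod.mono_neutral_right) auto
    also have "\<dots> = sv_prod k (A ** B)" by (simp add: sv_prod_def)
    finally have "\<bar>det ?Y\<bar> = \<bar>sv_prod k (A ** B)\<bar>" .
    moreover have "0 \<le> sv_prod k (A ** B)"
      unfolding sv_prod_def using k by (intro prod_nonneg) (auto intro!: sing_vals_nonneg)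
    ultimately show ?thesis by simp
  qed
  ultimately show ?thesis by (simp add: power2_eq_square mult_ac)
qed

section \<open>The singular value function\<close>

lemma sing_vals_le:
  fixes M :: "real^'n^'n"
  assumes M: "invertible M" and c: "\<And>x. norm (M *v x) \<le> c * norm x" and l: "l < CARD('n)"
  shows "sing_vals M ! l \<le> c"
proof -
  obtain u v where uv: "orthonormal_family u" "orthonormal_family v"
    "\<And>l. l < CARD('n) \<Longrightarrow> 0 < sing_vals M ! l"
    "\<And>l. l < CARD('n) \<Longrightarrow> M *v v l = sing_vals M ! l *\<^sub>R u l"
    by (rule svd[OF M]) blast
  have "norm (M *v v l) = sing_vals M ! l"
    using uv(4)[OF l] uv(3)[OF l] orthonormal_family_norm[OF uv(1) l] by simp
  then show ?thesis using c[of "v l"] orthonormal_family_norm[OF uv(2) l] by simp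
qed

lemma sing_vals_pos:
  fixes M :: "real^'n^'n"
  assumes "invertible M" "l < CARD('n)"
  shows "0 < sing_vals M ! l"
  by (rule svd[OF assms(1)]) (use assms(2) in blast)

lemma sv_prod_pos:
  fixes M :: "real^'n^'n"
  assumes "invertible M" "k \<le> CARD('n)"
  shows "0 < sv_prod k M"
  unfolding sv_prod_def using assms by (intro prod_pos) (auto intro!: sing_vals_pos)

text \<open>The exponent of the singular value with index \<open>l\<close> (counted from 0) in the singular value function.\<close>

definition sv_weight :: "real \<Rightarrow> nat \<Rightarrow> real" where
  "sv_weight s l = max 0 (min 1 (s - real l))"

lemma sv_weight_range: "0 \<le> sv_weight s l" "sv_weight s l \<le> 1"
  by (auto simp: sv_weight_def)

lemma sv_weight_mono: "s \<le> t \<Longrightarrow> sv_weight s l \<le> sv_weight t l"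
  by (auto simp: sv_weight_def)

text \<open>Both ends \<open>s = k\<close> and \<open>s = k + 1\<close> are allowed, because
  \<open>k\<close> is later taken as the floor of \<open>s\<close> in one place and as the ceiling
  minus 1 in another.\<close>

lemma sv_weight_split:
  assumes "real k \<le> s" "s \<le> real k + 1" "k < d"
  shows "(\<Sum>l<d. sv_weight s l * g l) = (\<Sum>l<k. g l) + (s - real k) * g k"
proof -
  have "(\<Sum>l<d. sv_weight s l * g l) = (\<Sum>l<Suc k. sv_weight s l * g l)"
    using assms by (intro sum.mono_neutral_right) (auto simp: sv_weight_def)
  also have "\<dots> = (\<Sum>l<k. sv_weight s l * g l) + sv_weight s k * g k" by simp
  also have "(\<Sum>l<k. sv_weight s l * g l) = (\<Sum>l<k. g l)"
    using assms by (intro sum.cong) (auto simp: sv_weight_def)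
  also have "sv_weight s k = s - real k" using assms by (auto simp: sv_weight_def)
  finally show ?thesis .
qed

lemma nat_floor_bounds:
  assumes "0 \<le> s"
  shows "real (nat \<lfloor>s\<rfloor>) \<le> s" "s < real (nat \<lfloor>s\<rfloor>) + 1"
  using assms by linarith+

lemma sv_weight_sum:
  assumes "0 \<le> s" "s < real d"
  shows "(\<Sum>l<d. sv_weight s l) = s"
proof -
  have "nat \<lfloor>s\<rfloor> < d" using assms nat_floor_bounds[OF assms(1)] by linarith
  then show ?thesis
    using sv_weight_split[of "nat \<lfloor>s\<rfloor>" s d "\<lambda>_. 1"] nat_floor_bounds[OF assms(1)] by simp
qed

lemma ln_sv_prod:
  fixes M :: "real^'n^'n"
  assumes "invertible M" "k \<le> CARD('n)"
  shows "ln (sv_prod k M) = (\<Sum>l<k. ln (sing_vals M ! l))"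
  using assms(2)
proof (induction k)
  case (Suc k)
  have "0 < sv_prod k M" "0 < sing_vals M ! k" using Suc.prems sv_prod_pos[OF assms(1)] sing_vals_pos[OF assms(1)] by auto
  then show ?case using Suc by (simp add: sv_prod_def ln_mult_pos)
qed (simp add: sv_prod_def)

lemma sv_fun_small:
  fixes M :: "real^'n^'n"
  assumes M: "invertible M" and s: "0 \<le> s" "s < real CARD('n)"
  shows "0 < sv_fun s M" "ln (sv_fun s M) = (\<Sum>l<CARD('n). sv_weight s l * ln (sing_vals M ! l))"
proof -
  define k where "k = nat \<lfloor>s\<rfloor>"
  have k: "k < CARD('n)" "real k \<le> s" "s \<le> real k + 1"
    using s nat_floor_bounds[OF s(1)] unfolding k_def by linarith+
  have e: "sv_fun s M = sv_prod k M * (sing_vals M ! k) powr (s - real k)"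
    using s(2) by (simp add: sv_fun_def k_def sv_prod_def Let_def)
  have p: "0 < sv_prod k M" using sv_prod_pos[OF M, of k] k by simp
  have q: "0 < (sing_vals M ! k) powr (s - real k)" using sing_vals_pos[OF M k(1)] by simp
  show "0 < sv_fun s M" unfolding e using p q by simp
  have "ln (sv_fun s M) = ln (sv_prod k M) + (s - real k) * ln (sing_vals M ! k)"
    unfolding e using p q sing_vals_pos[OF M k(1)] by (simp add: ln_mult_pos ln_powr)
  also have "ln (sv_prod k M) = (\<Sum>l<k. ln (sing_vals M ! l))" using k by (intro ln_sv_prod[OF M]) simp
  finally show "ln (sv_fun s M) = (\<Sum>l<CARD('n). sv_weight s l * ln (sing_vals M ! l))"
    using sv_weight_split[OF k(2,3,1), of "\<lambda>l. ln (sing_vals M ! l)"] by simp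
qed

text \<open>Between consecutive integers \<open>ln (sv_fun s M)\<close> is affine in
  \<open>s\<close>. Hence the rates of the finitely many \<open>sv_prod k\<close> determine the rate
  of \<open>sv_fun s\<close> for all exponents at once.\<close>

lemma ln_sv_fun_interpolation:
  fixes M :: "real^'n^'n"
  assumes M: "invertible M" and k: "real k \<le> s" "s \<le> real k + 1" "k < CARD('n)" and s: "s < real CARD('n)"
  shows "ln (sv_fun s M) = (real k + 1 - s) * ln (sv_prod k M) + (s - real k) * ln (sv_prod (Suc k) M)"
proof -
  have "0 \<le> s" using k(1) by linarith
  then have "ln (sv_fun s M) = (\<Sum>l<k. ln (sing_vals M ! l)) + (s - real k) * ln (sing_vals M ! k)"
    using sv_fun_small(2)[OF M _ s] sv_weight_split[OF k] by simp
  moreover have "ln (sv_prod k M) = (\<Sum>l<k. ln (sing_vals M ! l))"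
    "ln (sv_prod (Suc k) M) = (\<Sum>l<k. ln (sing_vals M ! l)) + ln (sing_vals M ! k)"
    using k(3) ln_sv_prod[OF M, of k] ln_sv_prod[OF M, of "Suc k"] by simp_all
  ultimately show ?thesis by (simp add: algebra_simps)
qed

lemma sv_fun_large:
  fixes M :: "real^'n^'n"
  assumes M: "invertible M" and s: "real CARD('n) \<le> s"
  shows "0 < sv_fun s M" "ln (sv_fun s M) = (s / real CARD('n)) * ln (sv_prod CARD('n) M)"
proof -
  have e: "sv_fun s M = sv_prod CARD('n) M powr (s / real CARD('n))"
    using s by (simp add: sv_fun_def sv_prod_def Let_def)
  have p: "0 < sv_prod CARD('n) M" using sv_prod_pos[OF M] by simp
  show "0 < sv_fun s M" "ln (sv_fun s M) = (s / real CARD('n)) * ln (sv_prod CARD('n) M)"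
    unfolding e using p by (simp_all add: ln_powr)
qed

lemma sv_fun_pos:
  fixes M :: "real^'n^'n"
  assumes "invertible M" "0 \<le> s"
  shows "0 < sv_fun s M"
  using sv_fun_small(1)[OF assms] sv_fun_large(1)[OF assms(1), of s] by (cases "s < real CARD('n)") auto

text \<open>\<open>min 1 x\<close> is at most \<open>x powr t\<close> for every \<open>t\<close> in
  [0, 1]. Taking for \<open>t\<close> the weights of the singular values in \<open>sv_fun s\<close>,
  which sum to \<open>s\<close>, produces the right-hand side.\<close>

lemma prod_min_le_sv_fun:
  fixes M :: "real^'n^'n"
  assumes M: "invertible M" and s: "0 \<le> s" "s < real CARD('n)" and r: "0 < r"
  shows "(\<Prod>l<CARD('n). min 1 (r / sing_vals M ! l)) \<le> r powr s / sv_fun s M"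
proof -
  have "(\<Prod>l<CARD('n). min 1 (r / sing_vals M ! l)) \<le> (\<Prod>l<CARD('n). exp (sv_weight s l * (ln r - ln (sing_vals M ! l))))"
  proof (rule prod_mono)
    fix l assume "l \<in> {..<CARD('n)}"
    then have a: "0 < sing_vals M ! l" using sing_vals_pos[OF M] by simp
    define x where "x = r / sing_vals M ! l"
    have x: "0 < x" using a r by (simp add: x_def)
    have "min 1 x \<le> x powr sv_weight s l"
    proof (cases "x \<le> 1")
      case True
      then have "x powr 1 \<le> x powr sv_weight s l" using x sv_weight_range by (intro powr_mono') auto
      then show ?thesis using x by simp
    next
      case False
      then show ?thesis using sv_weight_range[of s l] by (simp add: ge_one_powr_ge_zero)
    qed
    also have "x powr sv_weight s l = exp (sv_weight s l * (ln r - ln (sing_vals M ! l)))"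
      using x a r by (simp add: powr_def x_def ln_div)
    finally show "0 \<le> min 1 (r / sing_vals M ! l) \<and> min 1 (r / sing_vals M ! l) \<le> exp (sv_weight s l * (ln r - ln (sing_vals M ! l)))"
      using x by (simp add: x_def)
  qed
  also have "\<dots> = exp ((\<Sum>l<CARD('n). sv_weight s l) * ln r - (\<Sum>l<CARD('n). sv_weight s l * ln (sing_vals M ! l)))"
    by (simp add: exp_sum[symmetric] right_diff_distrib sum_subtractf sum_distrib_right)
  also have "\<dots> = exp (s * ln r - ln (sv_fun s M))"
    using sv_weight_sum[OF s] sv_fun_small(2)[OF M s] by simp
  also have "\<dots> = r powr s / sv_fun s M"
    using r sv_fun_small(1)[OF M s] by (simp add: exp_diff powr_def)
  finally show ?thesis .
qed

section \<open>Coverings and a volume estimate\<close>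

lemma norm_cubeQ_le:
  fixes x :: "real^'n"
  assumes "x \<in> cubeQ"
  shows "norm x \<le> real CARD('n)"
proof -
  have "\<bar>x $ i\<bar> \<le> 1" for i
  proof -
    have "- (1/2) \<le> x $ i" "x $ i \<le> 1/2" using assms by (auto simp: cubeQ_def mem_box_cart)
    then show ?thesis by linarith
  qed
  then have "(\<Sum>i\<in>UNIV. \<bar>x $ i\<bar>) \<le> (\<Sum>i\<in>(UNIV :: 'n set). 1)" by (intro sum_mono)
  then show ?thesis using norm_le_l1_cart[of x] by simp
qed

lemma card_bounded_lists:
  fixes S :: "nat \<Rightarrow> 'b set"
  assumes "\<And>l. l < k \<Longrightarrow> finite (S l)"
  shows "finite {xs. length xs = k \<and> (\<forall>l<k. xs ! l \<in> S l)}"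
    "card {xs. length xs = k \<and> (\<forall>l<k. xs ! l \<in> S l)} \<le> (\<Prod>l<k. card (S l))"
proof -
  let ?A = "{xs. length xs = k \<and> (\<forall>l<k. xs ! l \<in> S l)}"
  let ?f = "\<lambda>xs :: 'b list. restrict (nth xs) {..<k}"
  have fin: "finite (PiE {..<k} S)" using assms by (intro finite_PiE) auto
  have inj: "inj_on ?f ?A"
  proof (rule inj_onI)
    fix xs ys assume "xs \<in> ?A" "ys \<in> ?A" "?f xs = ?f ys"
    then show "xs = ys" by (intro nth_equalityI) (auto simp: restrict_def fun_eq_iff split: if_splits)
  qed
  have sub: "?f ` ?A \<subseteq> PiE {..<k} S" by (rule image_subsetI) (simp add: restrict_PiE_iff)
  show "finite ?A" using finite_imageD[OF finite_subset[OF sub fin] inj] .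
  show "card ?A \<le> (\<Prod>l<k. card (S l))"
    using card_inj_on_le[OF inj sub fin] by (simp add: card_PiE)
qed

text \<open>Only the first \<open>k\<close> coordinates are cut, into intervals of length \<rho>;
  the others have width comparable to \<rho> already. A cell is encoded by its list of floors, which
  gives a measurable label with countably many values.\<close>

lemma box_partition:
  fixes u :: "nat \<Rightarrow> real^'n"
  assumes u: "orthonormal_family u" and \<rho>: "0 < \<rho>" and k: "k \<le> CARD('n)" and a: "\<And>l. l < CARD('n) \<Longrightarrow> 0 \<le> a l"
    and B: "0 \<le> B" "\<And>l. k \<le> l \<Longrightarrow> l < CARD('n) \<Longrightarrow> a l \<le> B * \<rho>"
  shows "\<exists>(lab :: real^'n \<Rightarrow> int list) L. finite L \<and> real (card L) \<le> (\<Prod>l<k. 2 * a l / \<rho> + 2) \<and>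
    lab \<in> measurable borel (count_space UNIV) \<and>
    (\<forall>p. (\<forall>l<CARD('n). \<bar>p \<bullet> u l\<bar> \<le> a l) \<longrightarrow> lab p \<in> L) \<and>
    (\<forall>p p'. (\<forall>l<CARD('n). \<bar>p \<bullet> u l\<bar> \<le> a l) \<longrightarrow> (\<forall>l<CARD('n). \<bar>p' \<bullet> u l\<bar> \<le> a l) \<longrightarrow> lab p = lab p' \<longrightarrow>
        norm (p - p') \<le> real CARD('n) * (1 + 2 * B) * \<rho>)"
proof -
  define lab where "lab p = map (\<lambda>l. \<lfloor>(p \<bullet> u l) / \<rho>\<rfloor>) [0..<k]" for p
  define S where "S l = {\<lfloor>- a l / \<rho>\<rfloor>..\<lfloor>a l / \<rho>\<rfloor>}" for l
  let ?L = "{xs. length xs = k \<and> (\<forall>l<k. xs ! l \<in> S l)}"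
  have fin: "finite (S l)" for l by (simp add: S_def)
  have "real (card ?L) \<le> real (\<Prod>l<k. card (S l))"
    using card_bounded_lists(2)[of k S] fin by (simp only: of_nat_le_iff)
  also have "\<dots> = (\<Prod>l<k. real (card (S l)))" by simp
  also have "\<dots> \<le> (\<Prod>l<k. 2 * a l / \<rho> + 2)"
  proof (rule prod_mono)
    fix l assume "l \<in> {..<k}"
    then have "0 \<le> a l / \<rho>" using a[of l] k \<rho> by simp
    then show "0 \<le> real (card (S l)) \<and> real (card (S l)) \<le> 2 * a l / \<rho> + 2"
      unfolding S_def card_atLeastAtMost_int by (simp add: minus_divide_left[symmetric]) linarith
  qed
  finally have card: "real (card ?L) \<le> (\<Prod>l<k. 2 * a l / \<rho> + 2)" .
  have meas: "(\<lambda>p. map (\<lambda>l. \<lfloor>(p \<bullet> u l) / \<rho>\<rfloor>) [0..<m]) \<in> measurable borel (count_space UNIV)" for m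
  proof (induction m)
    case (Suc m)
    have "(\<lambda>p. \<lfloor>(p \<bullet> u m) / \<rho>\<rfloor>) \<in> measurable borel (count_space UNIV)" by measurable
    from measurable_Pair[OF Suc this]
    have "(\<lambda>p. (map (\<lambda>l. \<lfloor>(p \<bullet> u l) / \<rho>\<rfloor>) [0..<m], \<lfloor>(p \<bullet> u m) / \<rho>\<rfloor>)) \<in> measurable borel (count_space UNIV)"
      by (simp add: pair_measure_countable)
    from measurable_compose[OF this, of "\<lambda>(w, i). w @ [i]" "count_space UNIV"]
    show ?case by simp
  qed simp
  have inL: "lab p \<in> ?L" if "\<forall>l<CARD('n). \<bar>p \<bullet> u l\<bar> \<le> a l" for p
  proof -
    have "lab p ! l \<in> S l" if l: "l < k" for l
    proof -
      have "\<bar>p \<bullet> u l\<bar> \<le> a l" using that \<open>\<forall>l<CARD('n). \<bar>p \<bullet> u l\<bar> \<le> a l\<close> k by simp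
      then have "- a l / \<rho> \<le> (p \<bullet> u l) / \<rho>" "(p \<bullet> u l) / \<rho> \<le> a l / \<rho>"
        using \<rho> by (intro divide_right_mono; simp add: abs_le_iff)+
      then show ?thesis using l by (simp add: lab_def S_def floor_mono)
    qed
    then show ?thesis by (simp add: lab_def)
  qed
  have close: "norm (p - p') \<le> real CARD('n) * (1 + 2 * B) * \<rho>"
    if p: "\<forall>l<CARD('n). \<bar>p \<bullet> u l\<bar> \<le> a l" and p': "\<forall>l<CARD('n). \<bar>p' \<bullet> u l\<bar> \<le> a l" and eq: "lab p = lab p'" for p p'
  proof -
    have "norm (p - p') \<le> (\<Sum>l<CARD('n). \<bar>(p - p') \<bullet> u l\<bar>)" by (rule orthonormal_family_norm_le[OF u])
    also have "\<dots> \<le> (\<Sum>l<CARD('n). (1 + 2 * B) * \<rho>)"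
    proof (rule sum_mono)
      fix l assume "l \<in> {..<CARD('n)}"
      then have l: "l < CARD('n)" by simp
      have "0 \<le> B * \<rho>" using B(1) \<rho> by simp
      show "\<bar>(p - p') \<bullet> u l\<bar> \<le> (1 + 2 * B) * \<rho>"
      proof (cases "l < k")
        case True
        have "lab p ! l = lab p' ! l" using eq by simp
        then have "\<lfloor>(p \<bullet> u l) / \<rho>\<rfloor> = \<lfloor>(p' \<bullet> u l) / \<rho>\<rfloor>" using True by (simp add: lab_def)
        then have "\<bar>(p \<bullet> u l) / \<rho> - (p' \<bullet> u l) / \<rho>\<bar> < 1" by linarith
        then have "\<bar>p \<bullet> u l - p' \<bullet> u l\<bar> < \<rho>" using \<rho> by (simp add: diff_divide_distrib[symmetric] abs_divide)
        then show ?thesis using \<open>0 \<le> B * \<rho>\<close> by (simp add: inner_diff_left algebra_simps)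
      next
        case False
        have "\<bar>p \<bullet> u l - p' \<bullet> u l\<bar> \<le> a l + a l" using p p' l by (intro order_trans[OF abs_triangle_ineq4 add_mono]) auto
        then show ?thesis using B(2)[of l] False l \<rho> by (simp add: inner_diff_left algebra_simps)
      qed
    qed
    also have "\<dots> = real CARD('n) * (1 + 2 * B) * \<rho>" by simp
    finally show ?thesis .
  qed
  show ?thesis
    using card_bounded_lists(1)[of k S] fin card meas[of k] inL close
    by (intro exI[of _ lab] exI[of _ ?L]) (auto simp: lab_def[abs_def])
qed


text \<open>A box around any point of the set works. It is returned as a Borel superset because
  \<open>X\<close> may fail to be Borel.\<close>

lemma emeasure_diameter_le:
  fixes X :: "(real^'n) set"
  assumes "0 \<le> t" "\<And>x y. x \<in> X \<Longrightarrow> y \<in> X \<Longrightarrow> norm (x - y) \<le> t"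
  shows "\<exists>Y. X \<subseteq> Y \<and> Y \<in> sets borel \<and> emeasure lborel Y \<le> ennreal ((2 * t) ^ CARD('n))"
proof (cases "X = {}")
  case True
  then show ?thesis by (intro exI[of _ "{}"]) auto
next
  case False
  then obtain z where z: "z \<in> X" by blast
  let ?l = "z - t *\<^sub>R One" and ?u = "z + t *\<^sub>R One"
  have "X \<subseteq> cbox ?l ?u"
  proof
    fix x assume x: "x \<in> X"
    have "\<bar>(x - z) \<bullet> b\<bar> \<le> t" if "b \<in> Basis" for b
      using Basis_le_norm[OF that, of "x - z"] assms(2)[OF x z] by linarith
    then show "x \<in> cbox ?l ?u" by (force simp: mem_box inner_diff_left inner_add_left abs_le_iff)
  qed
  moreover have "emeasure lborel (cbox ?l ?u) = ennreal ((2 * t) ^ CARD('n))"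
  proof -
    have "emeasure lborel (cbox ?l ?u) = ennreal (\<Prod>b\<in>Basis. (?u - ?l) \<bullet> b)"
      using assms(1) by (intro emeasure_lborel_cbox) (auto simp: inner_diff_left inner_add_left)
    also have "(\<Prod>b\<in>Basis. (?u - ?l) \<bullet> b) = (\<Prod>b\<in>(Basis :: (real^'n) set). 2 * t)"
    proof (rule prod.cong[OF refl])
      fix b :: "real^'n" assume b: "b \<in> Basis"
      have "(?u - ?l) \<bullet> b = 2 * (t * (One \<bullet> b))"
        unfolding inner_diff_left inner_add_left inner_scaleR_left by linarith
      then show "(?u - ?l) \<bullet> b = 2 * t" using b by simp
    qed
    finally show ?thesis by simp
  qed
  ultimately show ?thesis by (intro exI[of _ "cbox ?l ?u"]) auto
qed

text \<open>In the direction \<open>v l\<close> the condition confines \<open>T x\<close> to an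
  interval of half-length \<open>r\<close> over the singular value, and membership in the cube
  confines it to a bounded one; so \<open>T x\<close> lies in a box. Small cells of this box pull
  back through \<open>T\<close>, which contracts by at most the factor \<open>q\<close>, to sets of
  small diameter, whose volumes are added up.\<close>

lemma measure_affine_preimage_le:
  fixes M :: "real^'n^'n" and T :: "real^'n \<Rightarrow> real^'n"
  assumes M: "invertible M" and T: "linear T" and q: "0 < q" "\<And>x. q * norm x \<le> norm (T x)"
    and K: "0 \<le> K" "\<And>x. norm (T x) \<le> K * norm x" and r: "0 < r"
  shows "emeasure lborel {x \<in> cubeQ. norm (M *v (b + T x)) \<le> r} \<le>
    ennreal ((8 * real CARD('n) * (1 + K * real CARD('n)) / q) ^ CARD('n) * (\<Prod>l<CARD('n). min 1 (r / sing_vals M ! l)))"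
proof -
  let ?d = "CARD('n)"
  let ?S = "{x \<in> cubeQ. norm (M *v (b + T x)) \<le> r}"
  obtain u v where uv: "orthonormal_family u" "orthonormal_family v"
    "\<And>l. l < CARD('n) \<Longrightarrow> 0 < sing_vals M ! l"
    "\<And>l x. l < CARD('n) \<Longrightarrow> (M *v x) \<bullet> u l = sing_vals M ! l * (x \<bullet> v l)"
    by (rule svd[OF M]) blast
  define y where "y l = r / sing_vals M ! l" for l
  have y: "0 < y l" if "l < ?d" for l using uv(3)[OF that] r by (simp add: y_def)
  define kd where "kd = K * real ?d"
  have kd: "0 \<le> kd" using K(1) by (simp add: kd_def)
  define a where "a l = (1 + kd) * min 1 (y l)" for l
  have a: "0 < a l" if "l < ?d" for l using y[OF that] kd by (simp add: a_def)
  \<comment> \<open>The centre of the box: minus the coordinate of \<open>b\<close> in the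
    directions where the condition is restrictive, and 0 in the others.\<close>
  define z where "z = (\<Sum>l<?d. (if y l \<le> 1 then - (b \<bullet> v l) else 0) *\<^sub>R v l)"
  have z: "z \<bullet> v l = (if y l \<le> 1 then - (b \<bullet> v l) else 0)" if l: "l < ?d" for l
  proof -
    have "z \<bullet> v l = (\<Sum>j<?d. (if y j \<le> 1 then - (b \<bullet> v j) else 0) * (v j \<bullet> v l))"
      by (simp add: z_def inner_sum_left)
    also have "\<dots> = (\<Sum>j<?d. if j = l then (if y l \<le> 1 then - (b \<bullet> v l) else 0) else 0)"
      using l by (intro sum.cong) (auto simp: orthonormal_familyD[OF uv(2)])
    finally show ?thesis using l by simp
  qed
  have box: "\<bar>(T x - z) \<bullet> v l\<bar> \<le> a l" if x: "x \<in> ?S" and l: "l < ?d" for x l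
  proof (cases "y l \<le> 1")
    case True
    have "\<bar>(M *v (b + T x)) \<bullet> u l\<bar> \<le> r"
      using Cauchy_Schwarz_ineq2[of "M *v (b + T x)" "u l"] orthonormal_family_norm[OF uv(1) l] x by simp
    then have "sing_vals M ! l * \<bar>b \<bullet> v l + T x \<bullet> v l\<bar> \<le> r"
      using uv(3)[OF l] by (simp add: uv(4)[OF l] abs_mult inner_add_left)
    then have "\<bar>b \<bullet> v l + T x \<bullet> v l\<bar> \<le> y l" using uv(3)[OF l] by (simp add: y_def field_simps)
    moreover have "y l \<le> (1 + kd) * y l" using kd y[OF l] by simp
    ultimately show ?thesis using z[OF l] True by (simp add: a_def inner_diff_left add.commute)
  next
    case False
    have "\<bar>T x \<bullet> v l\<bar> \<le> norm (T x)"
      using Cauchy_Schwarz_ineq2[of "T x" "v l"] orthonormal_family_norm[OF uv(2) l] by simp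
    also have "\<dots> \<le> kd"
      using K(2)[of x] mult_left_mono[OF norm_cubeQ_le K(1), of x] x by (simp add: kd_def)
    finally show ?thesis using z[OF l] False by (simp add: a_def inner_diff_left)
  qed
  \<comment> \<open>With the smallest half-side as cell size, each factor
    \<open>2 * a l / \<rho> + 2\<close> of the cell count is at most
    \<open>4 * a l / \<rho>\<close>; the powers of \<rho> then cancel against the volumes of the
    cells.\<close>
  define \<rho> where "\<rho> = Min (a ` {..<?d})"
  have \<rho>: "0 < \<rho>" unfolding \<rho>_def using a by (subst Min_gr_iff) (auto simp: lessThan_empty_iff)
  have \<rho>_le: "\<rho> \<le> a l" if "l < ?d" for l unfolding \<rho>_def using that by (intro Min_le) auto
  obtain lab :: "real^'n \<Rightarrow> int list" and L where L: "finite L" "real (card L) \<le> (\<Prod>l<?d. 2 * a l / \<rho> + 2)"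
    "\<And>p. (\<forall>l<?d. \<bar>p \<bullet> v l\<bar> \<le> a l) \<Longrightarrow> lab p \<in> L"
    "\<And>p p'. (\<forall>l<?d. \<bar>p \<bullet> v l\<bar> \<le> a l) \<Longrightarrow> (\<forall>l<?d. \<bar>p' \<bullet> v l\<bar> \<le> a l) \<Longrightarrow> lab p = lab p' \<Longrightarrow>
        norm (p - p') \<le> real ?d * (1 + 2 * 0) * \<rho>"
    using box_partition[OF uv(2) \<rho> order_refl less_imp_le[OF a], where B=0] by force
  let ?X = "\<lambda>w. {x \<in> ?S. lab (T x - z) = w}"
  define t where "t = real ?d * \<rho> / q"
  have t: "0 \<le> t" using \<rho> q(1) by (simp add: t_def)
  have diam: "norm (x - x') \<le> t" if "x \<in> ?X w" "x' \<in> ?X w" for x x' w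
  proof -
    have "norm ((T x - z) - (T x' - z)) \<le> real ?d * (1 + 2 * 0) * \<rho>"
      by (rule L(4)) (use that box in auto)
    then have "norm (T (x - x')) \<le> real ?d * \<rho>" using linear_diff[OF T, of x x'] by simp
    then show ?thesis using q(1) q(2)[of "x - x'"] by (simp add: t_def field_simps)
  qed
  obtain Y where Y: "\<And>w. ?X w \<subseteq> Y w" "\<And>w. Y w \<in> sets borel" "\<And>w. emeasure lborel (Y w) \<le> ennreal ((2 * t) ^ ?d)"
  proof -
    have "\<forall>w. \<exists>Y. ?X w \<subseteq> Y \<and> Y \<in> sets borel \<and> emeasure lborel Y \<le> ennreal ((2 * t) ^ ?d)"
      by (intro allI emeasure_diameter_le[OF t] diam)
    from choice[OF this] show thesis using that by blast
  qed
  have "?S \<subseteq> (\<Union>w\<in>L. Y w)"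
  proof
    fix x assume x: "x \<in> ?S"
    then have "lab (T x - z) \<in> L" by (intro L(3)) (use box in blast)
    then show "x \<in> (\<Union>w\<in>L. Y w)" using Y(1)[of "lab (T x - z)"] x by blast
  qed
  then have "emeasure lborel ?S \<le> emeasure lborel (\<Union>w\<in>L. Y w)"
    using Y(2) L(1) by (intro emeasure_mono) auto
  also have "\<dots> \<le> (\<Sum>w\<in>L. emeasure lborel (Y w))"
    using Y(2) L(1) by (intro emeasure_subadditive_finite) auto
  also have "\<dots> \<le> (\<Sum>w\<in>L. ennreal ((2 * t) ^ ?d))" by (intro sum_mono Y(3))
  also have "\<dots> = ennreal (real (card L) * (2 * t) ^ ?d)"
    using t by (simp add: ennreal_mult ennreal_of_nat_eq_real_of_nat)
  also have "\<dots> \<le> ennreal ((8 * real ?d * (1 + kd) / q) ^ ?d * (\<Prod>l<?d. min 1 (y l)))"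
  proof (rule ennreal_leI)
    have "real (card L) \<le> (\<Prod>l<?d. 4 * a l / \<rho>)"
    proof (rule order_trans[OF L(2) prod_mono])
      fix l assume "l \<in> {..<?d}"
      then have "\<rho> \<le> a l" "0 < a l" using \<rho>_le a by auto
      then show "0 \<le> 2 * a l / \<rho> + 2 \<and> 2 * a l / \<rho> + 2 \<le> 4 * a l / \<rho>"
        using \<rho> by (simp add: field_simps)
    qed
    then have "real (card L) * (2 * t) ^ ?d \<le> (\<Prod>l<?d. 4 * a l / \<rho>) * (2 * t) ^ ?d"
      using t by (intro mult_right_mono) auto
    also have "\<dots> = (\<Prod>l<?d. (4 * a l / \<rho>) * (2 * t))"
      by (subst prod.distrib) (simp only: prod_constant card_lessThan)
    also have "\<dots> = (\<Prod>l<?d. (8 * real ?d * (1 + kd) / q) * min 1 (y l))"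
      using \<rho> q(1) by (intro prod.cong) (auto simp: a_def t_def field_simps)
    also have "\<dots> = (8 * real ?d * (1 + kd) / q) ^ ?d * (\<Prod>l<?d. min 1 (y l))"
      by (subst prod.distrib) (simp only: prod_constant card_lessThan)
    finally show "real (card L) * (2 * t) ^ ?d \<le> (8 * real ?d * (1 + kd) / q) ^ ?d * (\<Prod>l<?d. min 1 (y l))" .
  qed
  finally show ?thesis by (simp only: kd_def y_def)
qed

section \<open>The coding map\<close>

lemma word_mat_Nil [simp]: "word_mat A [] = mat 1" by (simp add: word_mat_def)

lemma word_mat_Cons: "word_mat A (i # w) = A i ** word_mat A w" by (simp add: word_mat_def)

lemma word_mat_append: "word_mat A (u @ v) = word_mat A u ** word_mat A v"
  by (induction u) (simp_all add: word_mat_Cons matrix_mul_assoc)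

lemma word_fun_Nil [simp]: "word_fun A a [] x = x" by (simp add: word_fun_def)

lemma word_fun_Cons: "word_fun A a (i # w) x = A i *v word_fun A a w x + a i"
  by (simp add: word_fun_def ifs_map_def)

lemma word_fun_affine: "word_fun A a w x = word_mat A w *v x + word_fun A a w 0"
  by (induction w) (simp_all add: word_fun_Cons word_mat_Cons matrix_vector_right_distrib matrix_vector_mul_assoc[symmetric])

text \<open>The limit point as a series, which makes it visibly linear in the translations. For
  bounded translations \<open>proj_eq_coding_map\<close> identifies it with
  \<open>proj\<close>.\<close>

definition coding_map :: "('i \<Rightarrow> real^'n^'n) \<Rightarrow> ('i \<Rightarrow> real^'n) \<Rightarrow> (nat \<Rightarrow> 'i) \<Rightarrow> real^'n" where
  "coding_map A a \<omega> = (\<Sum>n. word_mat A (prefix \<omega> n) *v a (\<omega> n))"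

locale contracting_ifs =
  fixes A :: "'i::countable \<Rightarrow> real^'n^'n" and c :: real
  assumes invertible_A: "\<And>i. invertible (A i)"
    and norm_A: "\<And>i x. norm (A i *v x) \<le> c * norm x"
    and c_pos: "0 < c" and c_less: "c < 1 / 2"
begin

lemma invertible_word_mat: "invertible (word_mat A w)"
proof (induction w)
  case Nil
  have "invertible (mat 1 :: real^'n^'n)" unfolding invertible_def by (intro exI[of _ "mat 1"]) simp
  then show ?case by simp
qed (simp add: word_mat_Cons invertible_mult invertible_A)

lemma norm_word_mat: "norm (word_mat A w *v x) \<le> c ^ length w * norm x"
proof (induction w)
  case (Cons i w)
  have "norm (word_mat A (i # w) *v x) = norm (A i *v (word_mat A w *v x))"
    by (simp add: word_mat_Cons matrix_vector_mul_assoc)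
  also have "\<dots> \<le> c * norm (word_mat A w *v x)" by (rule norm_A)
  also have "\<dots> \<le> c * (c ^ length w * norm x)" using Cons c_pos by (intro mult_left_mono) auto
  finally show ?case by simp
qed simp

lemma sing_vals_word_le: "l < CARD('n) \<Longrightarrow> sing_vals (word_mat A w) ! l \<le> c ^ length w"
  by (rule sing_vals_le[OF invertible_word_mat norm_word_mat])

lemma norm_coding_term:
  assumes "\<And>i. norm (a i) \<le> D"
  shows "norm (word_mat A (prefix \<omega> n) *v a (\<omega> n)) \<le> c ^ n * D"
proof -
  have "norm (word_mat A (prefix \<omega> n) *v a (\<omega> n)) \<le> c ^ n * norm (a (\<omega> n))"
    using norm_word_mat[of "prefix \<omega> n"] by simp
  also have "\<dots> \<le> c ^ n * D" using assms c_pos by (intro mult_left_mono) auto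
  finally show ?thesis .
qed

lemma summable_geometric_c: "summable (\<lambda>n. c ^ n * D)"
  using c_pos c_less by (intro summable_mult2 summable_geometric) auto

lemma coding_summable:
  assumes "\<And>i. norm (a i) \<le> D"
  shows "summable (\<lambda>n. word_mat A (prefix \<omega> n) *v a (\<omega> n))"
  by (rule summable_comparison_test'[OF summable_geometric_c, of 0])
    (rule norm_coding_term[OF assms])

lemma norm_coding_map_le:
  assumes "\<And>i. norm (a i) \<le> D"
  shows "norm (coding_map A a \<omega>) \<le> D / (1 - c)"
proof -
  have "norm (coding_map A a \<omega>) \<le> (\<Sum>n. c ^ n * D)"
    unfolding coding_map_def
    by (rule norm_suminf_le[OF norm_coding_term[OF assms] summable_geometric_c])
  also have "\<dots> = D / (1 - c)"
    using c_pos c_less by (subst suminf_mult2[symmetric]) (auto simp: suminf_geometric)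
  finally show ?thesis .
qed

lemma coding_map_step:
  assumes a: "\<And>i. norm (a i) \<le> D"
  shows "coding_map A a \<omega> = A (\<omega> 0) *v coding_map A a (shift \<omega>) + a (\<omega> 0)"
proof -
  have "coding_map A a \<omega> = (\<Sum>n. word_mat A (prefix \<omega> (Suc n)) *v a (\<omega> (Suc n))) + a (\<omega> 0)"
    unfolding coding_map_def by (subst suminf_split_head[OF coding_summable[where a=a, OF a]]) simp
  also have "(\<lambda>n. word_mat A (prefix \<omega> (Suc n)) *v a (\<omega> (Suc n))) =
      (\<lambda>n. A (\<omega> 0) *v (word_mat A (prefix (shift \<omega>) n) *v a (shift \<omega> n)))"
    by (simp add: prefix_Suc word_mat_Cons matrix_vector_mul_assoc shift_def)
  also have "(\<Sum>n. A (\<omega> 0) *v (word_mat A (prefix (shift \<omega>) n) *v a (shift \<omega> n))) = A (\<omega> 0) *v coding_map A a (shift \<omega>)"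
    unfolding coding_map_def
    by (rule bounded_linear.suminf[OF matrix_vector_mul_bounded_linear coding_summable[where a=a, OF a], symmetric])
  finally show ?thesis .
qed

lemma coding_map_word:
  assumes a: "\<And>i. norm (a i) \<le> D"
  shows "coding_map A a \<omega> = word_fun A a (prefix \<omega> n) (coding_map A a ((shift ^^ n) \<omega>))"
proof (induction n arbitrary: \<omega>)
  case (Suc n)
  have "coding_map A a \<omega> = A (\<omega> 0) *v coding_map A a (shift \<omega>) + a (\<omega> 0)" by (rule coding_map_step[where a=a, OF a])
  also have "coding_map A a (shift \<omega>) = word_fun A a (prefix (shift \<omega>) n) (coding_map A a ((shift ^^ n) (shift \<omega>)))"
    by (rule Suc)
  finally show ?case unfolding prefix_Suc word_fun_Cons funpow_Suc_right comp_def .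
qed simp

text \<open>\<open>R\<close> is arbitrary because \<open>proj\<close> leaves the radius of the
  invariant ball open: points of \<open>cball 0 R\<close> and limit points are brought together at
  rate \<open>c ^ n\<close> whatever \<open>R\<close> is.\<close>

lemma coding_map_unique:
  assumes a: "\<And>i. norm (a i) \<le> D" and y: "\<And>n. y \<in> word_fun A a (prefix \<omega> n) ` cball 0 R"
  shows "y = coding_map A a \<omega>"
proof -
  have "norm (y - coding_map A a \<omega>) \<le> c ^ n * (R + D / (1 - c))" for n
  proof -
    obtain z where z: "norm z \<le> R" "y = word_fun A a (prefix \<omega> n) z" using y[of n] by auto
    let ?x = "coding_map A a ((shift ^^ n) \<omega>)"
    have "y - coding_map A a \<omega> = word_mat A (prefix \<omega> n) *v z - word_mat A (prefix \<omega> n) *v ?x"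
      unfolding z(2) coding_map_word[where a=a, OF a, where \<omega>=\<omega> and n=n]
      by (subst (1 2) word_fun_affine) simp
    also have "\<dots> = word_mat A (prefix \<omega> n) *v (z - ?x)" by (simp add: matrix_vector_mult_diff_distrib)
    finally have "norm (y - coding_map A a \<omega>) \<le> c ^ n * norm (z - ?x)"
      using norm_word_mat[of "prefix \<omega> n" "z - ?x"] by simp
    also have "\<dots> \<le> c ^ n * (R + D / (1 - c))"
      using z(1) norm_coding_map_le[where a=a, OF a, where \<omega>="(shift ^^ n) \<omega>"] norm_triangle_ineq4[of z ?x] c_pos
      by (intro mult_left_mono) auto
    finally show ?thesis .
  qed
  moreover have "(\<lambda>n. c ^ n * (R + D / (1 - c))) \<longlonglongrightarrow> 0"
    using c_pos c_less by (intro tendsto_mult_left_zero LIMSEQ_power_zero) auto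
  ultimately have "norm (y - coding_map A a \<omega>) \<le> 0" by (intro LIMSEQ_le_const) auto
  then show ?thesis by simp
qed

lemma proj_eq_coding_map:
  assumes a: "\<And>i. norm (a i) \<le> D" and D: "0 < D"
  shows "proj A a \<omega> = coding_map A a \<omega>"
  unfolding proj_def
proof (rule the_equality)
  \<comment> \<open>The radius with \<open>c * R + D = R\<close>, so every map sends the ball into
    itself and every limit point lies in it.\<close>
  define R where "R = D / (1 - c)"
  have R: "0 < R" "c * R + D = R" using D c_less by (simp_all add: R_def field_simps)
  have "ifs_map A a i ` cball 0 R \<subseteq> cball 0 R" for i
  proof safe
    fix x :: "real^'n" assume "x \<in> cball 0 R"
    then have "norm (A i *v x) \<le> c * R" using norm_A[of i x] c_pos by (auto intro: order_trans[OF _ mult_left_mono])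
    then show "ifs_map A a i x \<in> cball 0 R"
      using norm_triangle_ineq[of "A i *v x" "a i"] a[of i] R(2) by (simp add: ifs_map_def)
  qed
  moreover have "(\<Inter>n. word_fun A a (prefix \<omega> n) ` cball 0 R) = {coding_map A a \<omega>}"
  proof -
    have "coding_map A a \<omega> \<in> word_fun A a (prefix \<omega> n) ` cball 0 R" for n
    proof -
      have "coding_map A a ((shift ^^ n) \<omega>) \<in> cball 0 R"
        using norm_coding_map_le[where a=a, OF a] by (simp add: R_def)
      from imageI[OF this, of "word_fun A a (prefix \<omega> n)"] show ?thesis
        by (simp only: coding_map_word[where a=a, OF a, where \<omega>=\<omega> and n=n, symmetric])
    qed
    then have "{coding_map A a \<omega>} \<subseteq> (\<Inter>n. word_fun A a (prefix \<omega> n) ` cball 0 R)" by blast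
    moreover have "x = coding_map A a \<omega>" if "x \<in> (\<Inter>n. word_fun A a (prefix \<omega> n) ` cball 0 R)" for x
      by (rule coding_map_unique[where a=a, OF a]) (use that in blast)
    ultimately show ?thesis by blast
  qed
  ultimately show "\<exists>R>0. (\<forall>i. ifs_map A a i ` cball 0 R \<subseteq> cball 0 R) \<and>
      (\<Inter>n. word_fun A a (prefix \<omega> n) ` cball 0 R) = {coding_map A a \<omega>}"
    using R(1) by blast
next
  fix x assume "\<exists>R>0. (\<forall>i. ifs_map A a i ` cball 0 R \<subseteq> cball 0 R) \<and>
      (\<Inter>n. word_fun A a (prefix \<omega> n) ` cball 0 R) = {x}"
  then obtain R where "(\<Inter>n. word_fun A a (prefix \<omega> n) ` cball 0 R) = {x}" by blast
  then have "x \<in> word_fun A a (prefix \<omega> n) ` cball 0 R" for n by blast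
  then show "x = coding_map A a \<omega>" by (rule coding_map_unique[where a=a, OF a])
qed

section \<open>Dependence on the translation of one symbol\<close>

lemma coding_map_add:
  assumes a: "\<And>i. norm (a i) \<le> D" and b: "\<And>i. norm (b i) \<le> D'"
  shows "coding_map A (\<lambda>i. a i + b i) \<omega> = coding_map A a \<omega> + coding_map A b \<omega>"
  unfolding coding_map_def
  by (subst suminf_add[OF coding_summable[where a=a, OF a] coding_summable[OF b]])
    (simp add: matrix_vector_right_distrib)

text \<open>The linear map that describes how the limit point of \<open>\<omega>\<close> moves with
  the translation of symbol \<open>i\<close>, all other translations being fixed.\<close>

definition symbol_part :: "'i \<Rightarrow> (nat \<Rightarrow> 'i) \<Rightarrow> real^'n \<Rightarrow> real^'n" where
  "symbol_part i \<omega> x = coding_map A (\<lambda>j. if j = i then x else 0) \<omega>"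

lemma symbol_part_bound: "norm (if j = i then x else 0) \<le> norm x" by simp

lemma coding_map_update:
  assumes a: "\<And>i. norm (a i) \<le> D" and D: "0 \<le> D"
  shows "coding_map A (a(i := x)) \<omega> = coding_map A (a(i := 0)) \<omega> + symbol_part i \<omega> x"
proof -
  have "a(i := x) = (\<lambda>j. (a(i := 0)) j + (if j = i then x else 0))" by auto
  moreover have "norm ((a(i := 0)) j) \<le> D" for j using a D by simp
  ultimately show ?thesis
    unfolding symbol_part_def using coding_map_add[where a="a(i := 0)" and b="\<lambda>j. if j = i then x else 0" and D=D, OF _ symbol_part_bound] by simp
qed

lemma symbol_part_linear: "linear (symbol_part i \<omega>)"
proof (rule linearI)
  fix x y :: "real^'n" and t :: real
  have "(\<lambda>j. if j = i then x + y else 0) = (\<lambda>j. (if j = i then x else 0) + (if j = i then y else 0))" by auto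
  then show "symbol_part i \<omega> (x + y) = symbol_part i \<omega> x + symbol_part i \<omega> y"
    unfolding symbol_part_def using coding_map_add[where a="\<lambda>j. if j = i then x else 0" and b="\<lambda>j. if j = i then y else 0",
        OF symbol_part_bound symbol_part_bound] by simp
  have "(\<lambda>n. word_mat A (prefix \<omega> n) *v (if \<omega> n = i then t *\<^sub>R x else 0)) =
    (\<lambda>n. t *\<^sub>R (word_mat A (prefix \<omega> n) *v (if \<omega> n = i then x else 0)))"
    by (auto simp: matrix_vector_mult_scaleR)
  then show "symbol_part i \<omega> (t *\<^sub>R x) = t *\<^sub>R symbol_part i \<omega> x"
    unfolding symbol_part_def coding_map_def
    using suminf_scaleR_right[OF coding_summable[where a="\<lambda>j. if j = i then x else 0" and \<omega>=\<omega>, OF symbol_part_bound], of t] by simp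
qed

text \<open>A bound for the visits to \<open>i\<close> after the initial position, each discounted
  by the contraction up to that time. The initial position is left out because it contributes the
  identity exactly.\<close>

definition visit_weight :: "'i \<Rightarrow> (nat \<Rightarrow> 'i) \<Rightarrow> real" where
  "visit_weight i \<omega> = (\<Sum>k. c ^ Suc k * (if \<omega> (Suc k) = i then 1 else 0))"

lemma visit_weight_summable: "summable (\<lambda>k. c ^ Suc k * (if \<omega> (Suc k) = i then 1 else 0))"
proof (rule summable_comparison_test'[of "\<lambda>k. c ^ k * c" 0])
  show "norm (c ^ Suc k * (if \<omega> (Suc k) = i then 1 else 0)) \<le> c ^ k * c" for k
    using c_pos by (simp add: mult.commute)
qed (rule summable_geometric_c)

lemma visit_weight_add_le:
  assumes "i \<noteq> j"
  shows "visit_weight i \<omega> + visit_weight j \<omega> \<le> c / (1 - c)"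
proof -
  have "visit_weight i \<omega> + visit_weight j \<omega> =
      (\<Sum>k. c ^ Suc k * (if \<omega> (Suc k) = i then 1 else 0) + c ^ Suc k * (if \<omega> (Suc k) = j then 1 else 0))"
    unfolding visit_weight_def by (rule suminf_add[OF visit_weight_summable visit_weight_summable])
  also have "\<dots> \<le> (\<Sum>k. c ^ k * c)"
    using assms c_pos
    by (intro suminf_le summable_add visit_weight_summable summable_geometric_c) (auto simp: mult.commute)
  also have "\<dots> = c / (1 - c)"
    using c_pos c_less by (subst suminf_mult2[symmetric]) (auto simp: suminf_geometric)
  finally show ?thesis .
qed

text \<open>The term of index 0 of the series is the identity or 0; the remaining terms are bounded
  by the discounted visits.\<close>

lemma symbol_part_approx:
  "norm (symbol_part i \<omega> x - (if \<omega> 0 = i then x else 0)) \<le> visit_weight i \<omega> * norm x"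
proof -
  let ?t = "\<lambda>n. word_mat A (prefix \<omega> n) *v (if \<omega> n = i then x else 0)"
  have s: "summable ?t" by (rule coding_summable[where a="\<lambda>j. if j = i then x else 0", OF symbol_part_bound])
  have "symbol_part i \<omega> x - (if \<omega> 0 = i then x else 0) = (\<Sum>n. ?t (Suc n))"
    unfolding symbol_part_def coding_map_def by (subst suminf_split_head[OF s]) simp
  also have "norm \<dots> \<le> (\<Sum>k. (c ^ Suc k * (if \<omega> (Suc k) = i then 1 else 0)) * norm x)"
  proof (rule norm_suminf_le)
    show "norm (?t (Suc k)) \<le> c ^ Suc k * (if \<omega> (Suc k) = i then 1 else 0) * norm x" for k
      using norm_word_mat[of "prefix \<omega> (Suc k)" x] by simp
    show "summable (\<lambda>k. c ^ Suc k * (if \<omega> (Suc k) = i then 1 else 0) * norm x)"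
      by (rule summable_mult2[OF visit_weight_summable])
  qed
  also have "\<dots> = visit_weight i \<omega> * norm x"
    unfolding visit_weight_def by (rule suminf_mult2[OF visit_weight_summable, symmetric])
  finally show ?thesis .
qed

text \<open>Of the two first symbols, one has total visit weight at most \<open>c / (1 - c) < 1\<close>, because
  the two symbols share the positions; this is where \<open>c < 1/2\<close> is used.\<close>

lemma transversality:
  assumes ne: "\<tau> 0 \<noteq> \<omega> 0"
  obtains i T where "linear T" "\<And>x. (1 - c / (1 - c)) * norm x \<le> norm (T x)" "\<And>x. norm (T x) \<le> 2 * norm x"
    "\<And>x. T x = symbol_part i \<tau> x - symbol_part i \<omega> x"
proof -
  define q where "q = c / (1 - c)"
  have q: "q < 1" using c_less by (simp add: q_def)
  let ?T = "\<lambda>i x. symbol_part i \<tau> x - symbol_part i \<omega> x"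
  have "(visit_weight (\<tau> 0) \<tau> + visit_weight (\<tau> 0) \<omega>) + (visit_weight (\<omega> 0) \<tau> + visit_weight (\<omega> 0) \<omega>) \<le> q + q"
    using visit_weight_add_le[OF ne, of \<tau>] visit_weight_add_le[OF ne, of \<omega>] by (simp add: q_def)
  then consider "visit_weight (\<tau> 0) \<tau> + visit_weight (\<tau> 0) \<omega> \<le> q" | "visit_weight (\<omega> 0) \<tau> + visit_weight (\<omega> 0) \<omega> \<le> q"
    by linarith
  \<comment> \<open>The difference of the symbol parts is close to the identity if \<open>i\<close>
    is the first symbol of \<tau>, and to minus the identity if it is that of \<omega>;
    \<open>s\<close> records the sign.\<close>
  then obtain s :: real and i where i: "\<bar>s\<bar> = 1" "\<And>x. norm (?T i x - s *\<^sub>R x) \<le> q * norm x"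
  proof cases
    case 1
    have "norm (?T (\<tau> 0) x - 1 *\<^sub>R x) \<le> q * norm x" for x
    proof -
      have "norm (?T (\<tau> 0) x - 1 *\<^sub>R x) \<le> visit_weight (\<tau> 0) \<tau> * norm x + visit_weight (\<tau> 0) \<omega> * norm x"
        using symbol_part_approx[of "\<tau> 0" \<tau> x] symbol_part_approx[of "\<tau> 0" \<omega> x] ne
          norm_triangle_ineq4[of "symbol_part (\<tau> 0) \<tau> x - x" "symbol_part (\<tau> 0) \<omega> x"]
        by (auto simp: algebra_simps)
      also have "\<dots> \<le> q * norm x" using 1 by (simp add: distrib_right[symmetric] mult_right_mono)
      finally show ?thesis .
    qed
    then show thesis using that[of 1 "\<tau> 0"] by simp
  next
    case 2
    have "norm (?T (\<omega> 0) x - (-1) *\<^sub>R x) \<le> q * norm x" for x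
    proof -
      have "norm (?T (\<omega> 0) x - (-1) *\<^sub>R x) \<le> visit_weight (\<omega> 0) \<tau> * norm x + visit_weight (\<omega> 0) \<omega> * norm x"
        using symbol_part_approx[of "\<omega> 0" \<tau> x] symbol_part_approx[of "\<omega> 0" \<omega> x] ne
          norm_triangle_ineq4[of "symbol_part (\<omega> 0) \<tau> x" "symbol_part (\<omega> 0) \<omega> x - x"]
        by (auto simp: algebra_simps)
      also have "\<dots> \<le> q * norm x" using 2 by (simp add: distrib_right[symmetric] mult_right_mono)
      finally show ?thesis .
    qed
    then show thesis using that[of "-1" "\<omega> 0"] by simp
  qed
  show thesis
  proof (rule that)
    show "linear (?T i)" by (intro linear_compose_sub symbol_part_linear)
    have n: "norm (s *\<^sub>R x) = norm x" for x :: "real^'n" using i(1) by simp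
    show "(1 - c / (1 - c)) * norm x \<le> norm (?T i x)" for x
    proof -
      have "norm (s *\<^sub>R x) - norm (?T i x) \<le> norm (s *\<^sub>R x - ?T i x)" by (rule norm_triangle_ineq2)
      also have "\<dots> = norm (?T i x - s *\<^sub>R x)" by (rule norm_minus_commute)
      finally have "norm x - q * norm x \<le> norm (?T i x)" using i(2)[of x] unfolding n by linarith
      then show ?thesis by (simp add: q_def left_diff_distrib)
    qed
    show "norm (?T i x) \<le> 2 * norm x" for x
    proof -
      have "norm (?T i x) \<le> norm x + q * norm x"
        using i(2)[of x] norm_triangle_sub[of "?T i x" "s *\<^sub>R x"] unfolding n by linarith
      also have "\<dots> \<le> norm x + 1 * norm x" using q by (intro add_left_mono mult_right_mono) auto
      finally show ?thesis by simp
    qed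
  qed simp
qed

end

section \<open>Random translations\<close>

lemma cubeQ_borel [measurable]: "(cubeQ :: (real^'n) set) \<in> sets borel"
  by (simp add: cubeQ_def)

lemma prob_space_cube: "prob_space (restrict_space lborel (cubeQ :: (real^'n) set))"
proof (rule prob_spaceI)
  have "emeasure (restrict_space lborel (cubeQ :: (real^'n) set)) (space (restrict_space lborel cubeQ))
      = emeasure lborel (cubeQ :: (real^'n) set)"
    by (simp add: emeasure_restrict_space space_restrict_space)
  also have "\<dots> = ennreal (\<Prod>b\<in>Basis. ((\<chi> _. 1/2) - (\<chi> _. - 1/2) :: real^'n) \<bullet> b)"
    unfolding cubeQ_def by (rule emeasure_lborel_cbox) (auto simp: Basis_vec_def inner_axis)
  also have "(\<Prod>b\<in>Basis. ((\<chi> _. 1/2) - (\<chi> _. - 1/2) :: real^'n) \<bullet> b) = (\<Prod>b\<in>(Basis :: (real^'n) set). 1)"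
    by (rule prod.cong) (auto simp: Basis_vec_def inner_axis)
  finally show "emeasure (restrict_space lborel (cubeQ :: (real^'n) set)) (space (restrict_space lborel cubeQ)) = 1"
    by simp
qed

lemma prob_space_trans: "prob_space (trans_measure :: ('i \<Rightarrow> real^'n) measure)"
  unfolding trans_measure_def by (intro prob_space_PiM prob_space_cube)

lemma space_trans: "space (trans_measure :: ('i \<Rightarrow> real^'n) measure) = {a. \<forall>i. a i \<in> cubeQ}"
  by (auto simp: trans_measure_def space_PiM space_restrict_space)

lemma translation_measurable [measurable]: "(\<lambda>a. a i) \<in> borel_measurable (trans_measure :: ('i \<Rightarrow> real^'n) measure)"
proof -
  have "(\<lambda>a. a i) \<in> measurable (trans_measure :: ('i \<Rightarrow> real^'n) measure) (restrict_space lborel cubeQ)"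
    unfolding trans_measure_def by (rule measurable_component_singleton) simp
  moreover have "(\<lambda>x. x) \<in> measurable (restrict_space lborel (cubeQ :: (real^'n) set)) borel"
    by (rule measurable_restrict_space1) simp
  ultimately show ?thesis by (rule measurable_compose)
qed

text \<open>Resampling coordinate \<open>i\<close> independently preserves the product measure, so
  by Fubini a bound on every one-coordinate slice bounds the whole set.\<close>

lemma emeasure_trans_le:
  fixes S :: "('i \<Rightarrow> real^'n) set"
  assumes S: "S \<in> sets trans_measure"
    and le: "\<And>a. a \<in> space trans_measure \<Longrightarrow> emeasure lborel {x \<in> cubeQ. a(i := x) \<in> S} \<le> C"
  shows "emeasure trans_measure S \<le> C"
proof -
  let ?Q = "restrict_space lborel (cubeQ :: (real^'n) set)"
  let ?M = "trans_measure :: ('i \<Rightarrow> real^'n) measure"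
  interpret Q: prob_space ?Q by (rule prob_space_cube)
  interpret M: prob_space ?M by (rule prob_space_trans)
  interpret QM: pair_prob_space ?Q ?M ..
  let ?f = "\<lambda>(x, X). X(i := x)"
  have d: "distr (?Q \<Otimes>\<^sub>M ?M) ?M ?f = ?M"
    using distr_pair_PiM_eq_PiM[of UNIV "\<lambda>_. ?Q" i] prob_space_cube
    by (simp add: trans_measure_def)
  have f [measurable]: "?f \<in> measurable (?Q \<Otimes>\<^sub>M ?M) ?M"
    unfolding trans_measure_def case_prod_beta
  proof (rule measurable_fun_upd[where J=UNIV])
    show "fst \<in> measurable (?Q \<Otimes>\<^sub>M Pi\<^sub>M UNIV (\<lambda>_. ?Q)) ?Q" by measurable
    show "snd \<in> measurable (?Q \<Otimes>\<^sub>M Pi\<^sub>M UNIV (\<lambda>_. ?Q)) (Pi\<^sub>M UNIV (\<lambda>_. ?Q))" by measurable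
  qed simp
  have fS: "?f -` S \<inter> space (?Q \<Otimes>\<^sub>M ?M) \<in> sets (?Q \<Otimes>\<^sub>M ?M)" using f S by (rule measurable_sets)
  have "emeasure ?M S = emeasure (distr (?Q \<Otimes>\<^sub>M ?M) ?M ?f) S" by (simp only: d)
  also have "\<dots> = emeasure (?Q \<Otimes>\<^sub>M ?M) (?f -` S \<inter> space (?Q \<Otimes>\<^sub>M ?M))"
    using f S by (rule emeasure_distr)
  also have "\<dots> = (\<integral>\<^sup>+ a. emeasure ?Q ((\<lambda>x. (x, a)) -` (?f -` S \<inter> space (?Q \<Otimes>\<^sub>M ?M))) \<partial>?M)"
    by (rule QM.emeasure_pair_measure_alt2[OF fS])
  also have "\<dots> \<le> (\<integral>\<^sup>+ a. C \<partial>?M)"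
  proof (rule nn_integral_mono)
    fix a assume a: "a \<in> space ?M"
    have "(\<lambda>x. (x, a)) -` (?f -` S \<inter> space (?Q \<Otimes>\<^sub>M ?M)) = {x \<in> cubeQ. a(i := x) \<in> S}"
      using a by (auto simp: space_pair_measure space_restrict_space)
    then show "emeasure ?Q ((\<lambda>x. (x, a)) -` (?f -` S \<inter> space (?Q \<Otimes>\<^sub>M ?M))) \<le> C"
      using le[OF a] by (subst emeasure_restrict_space) auto
  qed
  also have "\<dots> = C" by (simp add: M.emeasure_space_1)
  finally show ?thesis .
qed

lemma coding_map_measurable_pair:
  fixes A :: "'i::countable \<Rightarrow> real^'n^'n"
  shows "(\<lambda>p. coding_map A (fst p) (snd p)) \<in> borel_measurable (trans_measure \<Otimes>\<^sub>M seq_space)"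
  unfolding coding_map_def
proof (rule borel_measurable_suminf)
  fix n
  let ?N = "(trans_measure :: ('i \<Rightarrow> real^'n) measure) \<Otimes>\<^sub>M (seq_space :: (nat \<Rightarrow> 'i) measure)"
  \<comment> \<open>Term \<open>n\<close> of the series depends on \<omega> only through its first
    \<open>Suc n\<close> symbols; splitting by the countably many words gives joint
    measurability.\<close>
  let ?f = "\<lambda>w p. word_mat A (take n w) *v (fst p (w ! n))"
  have "(\<lambda>p. ?f (prefix (snd p) (Suc n)) p) \<in> borel_measurable ?N"
  proof (rule measurable_compose_countable[where f="?f" and g="\<lambda>p. prefix (snd p) (Suc n)"])
    show "(\<lambda>p. prefix (snd p) (Suc n)) \<in> measurable ?N (count_space UNIV)"
      by (rule measurable_compose[OF measurable_snd prefix_measurable])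
    fix w :: "'i list"
    have "(\<lambda>p. fst p (w ! n)) \<in> borel_measurable ?N"
      by (rule measurable_compose[OF measurable_fst translation_measurable])
    moreover have "(\<lambda>x. word_mat A (take n w) *v x) \<in> borel_measurable borel"
      by (intro borel_measurable_continuous_onI linear_continuous_on matrix_vector_mul_bounded_linear)
    ultimately show "?f w \<in> borel_measurable ?N" by (rule measurable_compose)
  qed
  then show "(\<lambda>p. word_mat A (prefix (snd p) n) *v fst p (snd p n)) \<in> borel_measurable ?N"
    by (simp add: prefix_def take_map nth_append)
qed

lemma coding_map_measurable:
  fixes A :: "'i::countable \<Rightarrow> real^'n^'n"
  shows "(\<lambda>a. coding_map A a \<omega>) \<in> borel_measurable trans_measure"
    "a \<in> space trans_measure \<Longrightarrow> coding_map A a \<in> borel_measurable seq_space"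
proof -
  have "(\<lambda>a. (a, \<omega>)) \<in> measurable (trans_measure :: ('i \<Rightarrow> real^'n) measure) (trans_measure \<Otimes>\<^sub>M seq_space)"
    by (rule measurable_Pair2') simp
  from measurable_compose[OF this coding_map_measurable_pair[of A]]
  show "(\<lambda>a. coding_map A a \<omega>) \<in> borel_measurable trans_measure" by simp
  assume "a \<in> space trans_measure"
  from measurable_compose[OF measurable_Pair1'[OF this] coding_map_measurable_pair[of A]]
  show "coding_map A a \<in> borel_measurable seq_space" by simp
qed

context contracting_ifs
begin

text \<open>The constant of \<open>measure_affine_preimage_le\<close> with the bounds
  \<open>1 - c / (1 - c)\<close> from below and 2 from above that \<open>transversality\<close>
  provides.\<close>

definition separation_const :: real where
  "separation_const = (8 * real CARD('n) * (1 + 2 * real CARD('n)) / (1 - c / (1 - c))) ^ CARD('n)"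

lemma separation_const_pos: "0 < separation_const"
proof -
  have "0 < 8 * real CARD('n) * (1 + 2 * real CARD('n))" by (intro mult_pos_pos) (auto intro: add_pos_nonneg)
  moreover have "0 < 1 - c / (1 - c)" using c_less c_pos by (simp add: field_simps)
  ultimately show ?thesis unfolding separation_const_def by (intro zero_less_power divide_pos_pos)
qed

lemma separation_const_nonneg: "0 \<le> separation_const"
  using separation_const_pos by simp

lemma ln_sing_vals_word_le:
  assumes "l < CARD('n)"
  shows "ln (sing_vals (word_mat A w) ! l) \<le> real (length w) * ln c"
proof -
  have "ln (sing_vals (word_mat A w) ! l) \<le> ln (c ^ length w)"
    using sing_vals_word_le[OF assms, of w] sing_vals_pos[OF invertible_word_mat assms, of w] by (intro ln_mono)
  then show ?thesis using c_pos by (simp add: ln_realpow)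
qed

lemma ln_c_neg: "ln c < 0"
  using c_pos c_less by simp

lemma ln_sing_vals_word_nonpos:
  assumes "l < CARD('n)"
  shows "ln (sing_vals (word_mat A w) ! l) \<le> 0"
  using ln_sing_vals_word_le[OF assms, of w] ln_c_neg by (meson less_imp_le mult_nonneg_nonpos of_nat_0_le_iff order_trans)

lemma sv_fun_word_le_1:
  assumes s: "0 \<le> s" "s < real CARD('n)"
  shows "sv_fun s (word_mat A w) \<le> 1"
proof -
  have "ln (sv_fun s (word_mat A w)) \<le> 0"
    unfolding sv_fun_small(2)[OF invertible_word_mat s]
    using sv_weight_range(1) ln_sing_vals_word_nonpos by (intro sum_nonpos mult_nonneg_nonpos) auto
  then show ?thesis using sv_fun_small(1)[OF invertible_word_mat s, of w] by simp
qed

lemma norm_translation_le: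
  fixes a :: "'i \<Rightarrow> real^'n"
  assumes "a \<in> space trans_measure"
  shows "norm (a i) \<le> real CARD('n)"
  using assms by (intro norm_cubeQ_le) (auto simp: space_trans)

text \<open>The common prefix acts on both points by the same affine map, so their difference is its
  linear part applied to the difference of the tails. The tails start with different symbols, and
  varying one suitable translation moves their difference by an expanding-enough linear map.\<close>

lemma separation:
  assumes pre: "prefix \<tau> n = prefix \<omega> n" and ne: "\<tau> n \<noteq> \<omega> n" and r: "0 < r"
  shows "emeasure trans_measure {a \<in> space trans_measure. norm (coding_map A a \<tau> - coding_map A a \<omega>) \<le> r} \<le>
    ennreal (separation_const * (\<Prod>l<CARD('n). min 1 (r / sing_vals (word_mat A (prefix \<omega> n)) ! l)))"
proof -
  define \<tau>' \<omega>' where "\<tau>' = (shift ^^ n) \<tau>" and "\<omega>' = (shift ^^ n) \<omega>"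
  have "\<tau>' 0 \<noteq> \<omega>' 0" using ne by (simp add: \<tau>'_def \<omega>'_def funpow_shift)
  then obtain i T where T: "linear T" "\<And>x. (1 - c / (1 - c)) * norm x \<le> norm (T x)" "\<And>x. norm (T x) \<le> 2 * norm x"
    "\<And>x. T x = symbol_part i \<tau>' x - symbol_part i \<omega>' x"
    by (rule transversality) blast
  let ?M = "word_mat A (prefix \<omega> n)"
  let ?S = "{a \<in> space trans_measure. norm (coding_map A a \<tau> - coding_map A a \<omega>) \<le> r}"
  show ?thesis
  proof (rule emeasure_trans_le[where i=i])
    have "(\<lambda>a. norm (coding_map A a \<tau> - coding_map A a \<omega>)) \<in> borel_measurable trans_measure"
      by (rule measurable_compose[OF borel_measurable_diff[OF coding_map_measurable(1) coding_map_measurable(1)]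
            borel_measurable_norm])
    then show "?S \<in> sets trans_measure" by measurable
  next
    fix a :: "'i \<Rightarrow> real^'n" assume a: "a \<in> space trans_measure"
    note na = norm_translation_le[OF a]
    let ?b = "coding_map A (a(i := 0)) \<tau>' - coding_map A (a(i := 0)) \<omega>'"
    have "{x \<in> cubeQ. a(i := x) \<in> ?S} \<subseteq> {x \<in> cubeQ. norm (?M *v (?b + T x)) \<le> r}"
    proof safe
      fix x assume x: "x \<in> cubeQ" and le: "norm (coding_map A (a(i := x)) \<tau> - coding_map A (a(i := x)) \<omega>) \<le> r"
        and "a(i := x) \<in> space trans_measure"
      then have n: "norm ((a(i := x)) j) \<le> real CARD('n)" for j using norm_translation_le by blast
      have "coding_map A (a(i := x)) \<tau> - coding_map A (a(i := x)) \<omega> =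
          ?M *v (coding_map A (a(i := x)) \<tau>' - coding_map A (a(i := x)) \<omega>')"
        unfolding coding_map_word[where a="a(i := x)" and D="real CARD('n)" and n=n and \<omega>=\<tau>, OF n]
          coding_map_word[where a="a(i := x)" and D="real CARD('n)" and n=n and \<omega>=\<omega>, OF n]
        by (subst (1 2) word_fun_affine) (simp add: pre \<tau>'_def \<omega>'_def matrix_vector_mult_diff_distrib)
      also have "coding_map A (a(i := x)) \<tau>' - coding_map A (a(i := x)) \<omega>' = ?b + T x"
        using coding_map_update[where a=a and D="real CARD('n)" and i=i and x=x, OF na]
        by (simp add: T(4))
      finally have eq: "coding_map A (a(i := x)) \<tau> - coding_map A (a(i := x)) \<omega> = ?M *v (?b + T x)" .
      from le show "norm (?M *v (?b + T x)) \<le> r" unfolding eq .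
    qed
    then have "emeasure lborel {x \<in> cubeQ. a(i := x) \<in> ?S} \<le> emeasure lborel {x \<in> cubeQ. norm (?M *v (?b + T x)) \<le> r}"
    proof (rule emeasure_mono)
      have "closed {x. norm (?M *v (?b + T x)) \<le> r}"
        by (intro closed_Collect_le continuous_on_norm continuous_on_const continuous_on_add
            linear_continuous_on_compose[OF _ matrix_vector_mul_linear] linear_continuous_on
            T(1)[unfolded linear_conv_bounded_linear])
      then show "{x \<in> cubeQ. norm (?M *v (?b + T x)) \<le> r} \<in> sets lborel"
        by (simp add: Collect_conj_eq borel_closed)
    qed
    also have "\<dots> \<le> ennreal (separation_const * (\<Prod>l<CARD('n). min 1 (r / sing_vals ?M ! l)))"
      unfolding separation_const_def
      using c_less c_pos
      by (intro measure_affine_preimage_le invertible_word_mat T(1-3) r) (simp_all add: field_simps)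
    finally show "emeasure lborel {x \<in> cubeQ. a(i := x) \<in> ?S} \<le>
      ennreal (separation_const * (\<Prod>l<CARD('n). min 1 (r / sing_vals ?M ! l)))" .
  qed
qed


end

lemma first_difference:
  assumes "\<tau> \<noteq> (\<omega> :: nat \<Rightarrow> 'i)"
  obtains n where "prefix \<tau> n = prefix \<omega> n" "\<tau> n \<noteq> \<omega> n"
proof -
  obtain m where "\<tau> m \<noteq> \<omega> m" using assms by blast
  define n where "n = (LEAST m. \<tau> m \<noteq> \<omega> m)"
  have "\<tau> n \<noteq> \<omega> n" unfolding n_def by (rule LeastI[of _ m]) fact
  moreover have "\<tau> k = \<omega> k" if "k < n" for k using not_less_Least[of k "\<lambda>m. \<tau> m \<noteq> \<omega> m"] that n_def by blast
  then have "prefix \<tau> n = prefix \<omega> n" by (simp add: prefix_def)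
  ultimately show thesis using that by blast
qed

section \<open>Expected mass of balls\<close>

locale ifs_measure = contracting_ifs A c + invariant_shift \<mu>
  for A :: "'i::countable \<Rightarrow> real^'n^'n" and c :: real and \<mu> :: "(nat \<Rightarrow> 'i) measure"
begin

lemma measurable_\<mu>: "measurable \<mu> N = measurable seq_space N"
  by (rule measurable_cong_sets[OF sets_\<mu> refl])

lemma coding_pair_measurable [measurable]:
  "(\<lambda>p. coding_map A (fst p) (snd p)) \<in> borel_measurable (trans_measure \<Otimes>\<^sub>M \<mu>)"
proof -
  have "measurable (trans_measure \<Otimes>\<^sub>M \<mu>) (borel :: (real^'n) measure) = measurable (trans_measure \<Otimes>\<^sub>M seq_space) borel"
    by (intro measurable_cong_sets sets_pair_measure_cong refl sets_\<mu>)
  then show ?thesis using coding_map_measurable_pair[of A] by simp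
qed

lemma coding_measurable_\<mu>: "a \<in> space trans_measure \<Longrightarrow> coding_map A a \<in> borel_measurable \<mu>"
  unfolding measurable_\<mu> by (rule coding_map_measurable(2))

definition ball_mass :: "('i \<Rightarrow> real^'n) \<Rightarrow> (nat \<Rightarrow> 'i) \<Rightarrow> real \<Rightarrow> ennreal" where
  "ball_mass a \<omega> r = emeasure \<mu> {\<tau>. norm (coding_map A a \<tau> - coding_map A a \<omega>) \<le> r}"

lemma ball_mass_measurable [measurable]:
  "(\<lambda>p. ball_mass (fst p) (snd p) r) \<in> borel_measurable (trans_measure \<Otimes>\<^sub>M \<mu>)"
proof -
  let ?N = "(trans_measure :: ('i \<Rightarrow> real^'n) measure) \<Otimes>\<^sub>M \<mu>"
  let ?Q = "{z \<in> space (?N \<Otimes>\<^sub>M \<mu>). norm (coding_map A (fst (fst z)) (snd z) - coding_map A (fst (fst z)) (snd (fst z))) \<le> r}"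
  have m1: "(\<lambda>z. coding_map A (fst (fst z)) (snd z)) \<in> borel_measurable (?N \<Otimes>\<^sub>M \<mu>)"
  proof -
    have "(\<lambda>z. (fst (fst z), snd z)) \<in> measurable (?N \<Otimes>\<^sub>M \<mu>) ?N"
      by (intro measurable_Pair measurable_snd measurable_compose[OF measurable_fst measurable_fst])
    from measurable_compose[OF this coding_pair_measurable] show ?thesis by simp
  qed
  have m2: "(\<lambda>z. coding_map A (fst (fst z)) (snd (fst z))) \<in> borel_measurable (?N \<Otimes>\<^sub>M \<mu>)"
    by (rule measurable_compose[OF measurable_fst coding_pair_measurable])
  have "(\<lambda>z. norm (coding_map A (fst (fst z)) (snd z) - coding_map A (fst (fst z)) (snd (fst z)))) \<in> borel_measurable (?N \<Otimes>\<^sub>M \<mu>)"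
    by (rule measurable_compose[OF borel_measurable_diff[OF m1 m2] borel_measurable_norm])
  then have "?Q \<in> sets (?N \<Otimes>\<^sub>M \<mu>)" by (rule borel_measurable_le[OF _ borel_measurable_const])
  from measurable_emeasure_Pair[OF this]
  have "(\<lambda>p. emeasure \<mu> (Pair p -` ?Q)) \<in> borel_measurable ?N" .
  moreover have "emeasure \<mu> (Pair p -` ?Q) = ball_mass (fst p) (snd p) r" if "p \<in> space ?N" for p
    unfolding ball_mass_def using that by (intro arg_cong[where f="emeasure \<mu>"]) (auto simp: space_pair_measure)
  ultimately show ?thesis by (simp cong: measurable_cong)
qed

text \<open>After exchanging the integrals, the inner one is the probability that a fixed \<tau>
  projects near \<omega>. Sequences \<tau> are sorted by the length \<open>n\<close> of the common
  prefix, and the cylinder of that prefix contributes its mass.\<close>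

lemma expected_ball_mass:
  assumes s: "0 \<le> s" "s < real CARD('n)" and r: "0 < r"
  shows "(\<integral>\<^sup>+ a. ball_mass a \<omega> r \<partial>trans_measure) \<le>
    ennreal (separation_const * r powr s) * (\<Sum>n. ennreal (mass (prefix \<omega> n) / sv_fun s (word_mat A (prefix \<omega> n))))"
proof -
  let ?T = "trans_measure :: ('i \<Rightarrow> real^'n) measure"
  interpret T: prob_space ?T by (rule prob_space_trans)
  interpret TM: pair_prob_space ?T \<mu> ..
  let ?g = "\<lambda>n. separation_const * (r powr s / sv_fun s (word_mat A (prefix \<omega> n)))"
  have g: "0 \<le> ?g n" for n
    using separation_const_nonneg sv_fun_pos[OF invertible_word_mat s(1), of "prefix \<omega> n"] by (simp add: less_imp_le)
  let ?Q = "{p \<in> space (?T \<Otimes>\<^sub>M \<mu>). norm (coding_map A (fst p) (snd p) - coding_map A (fst p) \<omega>) \<le> r}"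
  have m2: "(\<lambda>p. coding_map A (fst p) \<omega>) \<in> borel_measurable (?T \<Otimes>\<^sub>M \<mu>)"
    by (rule measurable_compose[OF measurable_fst coding_map_measurable(1)])
  have "(\<lambda>p. norm (coding_map A (fst p) (snd p) - coding_map A (fst p) \<omega>)) \<in> borel_measurable (?T \<Otimes>\<^sub>M \<mu>)"
    by (rule measurable_compose[OF borel_measurable_diff[OF coding_pair_measurable m2] borel_measurable_norm])
  then have Q: "?Q \<in> sets (?T \<Otimes>\<^sub>M \<mu>)" by (rule borel_measurable_le[OF _ borel_measurable_const])
  have "(\<integral>\<^sup>+ a. ball_mass a \<omega> r \<partial>?T) = (\<integral>\<^sup>+ a. emeasure \<mu> (Pair a -` ?Q) \<partial>?T)"
    unfolding ball_mass_def
    by (intro nn_integral_cong arg_cong[where f="emeasure \<mu>"]) (auto simp: space_pair_measure)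
  also have "\<dots> = emeasure (?T \<Otimes>\<^sub>M \<mu>) ?Q" by (rule emeasure_pair_measure_alt[OF Q, symmetric])
  also have "\<dots> = (\<integral>\<^sup>+ \<tau>. emeasure ?T ((\<lambda>a. (a, \<tau>)) -` ?Q) \<partial>\<mu>)" by (rule TM.emeasure_pair_measure_alt2[OF Q])
  also have "\<dots> \<le> (\<integral>\<^sup>+ \<tau>. (\<Sum>n. ennreal (?g n) * indicator (cyl (prefix \<omega> n)) \<tau>) \<partial>\<mu>)"
  proof (rule nn_integral_mono)
    fix \<tau> :: "nat \<Rightarrow> 'i"
    have eq: "(\<lambda>a. (a, \<tau>)) -` ?Q = {a \<in> space ?T. norm (coding_map A a \<tau> - coding_map A a \<omega>) \<le> r}"
      by (auto simp: space_pair_measure)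
    let ?F = "\<Sum>n. ennreal (?g n) * indicator (cyl (prefix \<omega> n)) \<tau>"
    show "emeasure ?T ((\<lambda>a. (a, \<tau>)) -` ?Q) \<le> ?F"
    proof (cases "\<tau> = \<omega>")
      case False
      then obtain n where n: "prefix \<tau> n = prefix \<omega> n" "\<tau> n \<noteq> \<omega> n" by (rule first_difference)
      have "emeasure ?T ((\<lambda>a. (a, \<tau>)) -` ?Q) \<le> ennreal (separation_const * (\<Prod>l<CARD('n). min 1 (r / sing_vals (word_mat A (prefix \<omega> n)) ! l)))"
        unfolding eq by (rule separation[OF n r])
      also have "\<dots> \<le> ennreal (?g n)"
        by (intro ennreal_leI mult_left_mono prod_min_le_sv_fun[OF invertible_word_mat s r] separation_const_nonneg)
      also have "\<dots> = ennreal (?g n) * indicator (cyl (prefix \<omega> n)) \<tau>" using n by (simp add: cyl_prefix)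
      also have "\<dots> = (\<Sum>n\<in>{n}. ennreal (?g n) * indicator (cyl (prefix \<omega> n)) \<tau>)"
        by (simp only: sum.insert finite.emptyI empty_iff not_False_eq_True sum.empty add_0_right)
      also have "\<dots> \<le> ?F" by (rule sum_le_suminf) auto
      finally show ?thesis .
    next
      case True
      \<comment> \<open>For \<tau> = \<omega> there is no first difference and the probability may
        be 1, which matters if \<omega> is an atom. Then every indicator is 1 and every summand is
        at least \<open>e\<close>, so finitely many summands already exceed 1.\<close>
      define e where "e = separation_const * r powr s"
      have e: "0 < e" using separation_const_pos r by (simp add: e_def)
      have ge: "e \<le> ?g n" for n
      proof -
        have "e * 1 \<le> e * (1 / sv_fun s (word_mat A (prefix \<omega> n)))"
          using e sv_fun_pos[OF invertible_word_mat s(1), of "prefix \<omega> n"] sv_fun_word_le_1[OF s, of "prefix \<omega> n"]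
          by (intro mult_left_mono) (auto simp: field_simps)
        then show ?thesis by (simp add: e_def)
      qed
      obtain N :: nat where N: "1 / e \<le> real N" using real_arch_simple by blast
      have "emeasure ?T ((\<lambda>a. (a, \<tau>)) -` ?Q) \<le> 1" by (rule T.emeasure_le_1)
      also have "1 \<le> ennreal (\<Sum>n<N. e)" using N e by (simp add: field_simps flip: ennreal_1)
      also have "\<dots> = (\<Sum>n<N. ennreal e)" by (rule sum_ennreal[symmetric]) (use e in simp)
      also have "\<dots> \<le> (\<Sum>n<N. ennreal (?g n) * indicator (cyl (prefix \<omega> n)) \<tau>)"
      proof (rule sum_mono)
        fix n
        show "ennreal e \<le> ennreal (?g n) * indicator (cyl (prefix \<omega> n)) \<tau>"
          using ennreal_leI[OF ge[of n]] True by (simp add: cyl_prefix)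
      qed
      also have "\<dots> \<le> ?F" by (rule sum_le_suminf) auto
      finally show ?thesis .
    qed
  qed
  also have "\<dots> = (\<Sum>n. ennreal (?g n) * emeasure \<mu> (cyl (prefix \<omega> n)))"
    by (subst nn_integral_suminf) (auto intro!: suminf_cong nn_integral_cmult_indicator)
  also have "\<dots> = (\<Sum>n. ennreal (separation_const * r powr s) * ennreal (mass (prefix \<omega> n) / sv_fun s (word_mat A (prefix \<omega> n))))"
  proof (rule suminf_cong)
    fix n
    show "ennreal (?g n) * emeasure \<mu> (cyl (prefix \<omega> n)) =
      ennreal (separation_const * r powr s) * ennreal (mass (prefix \<omega> n) / sv_fun s (word_mat A (prefix \<omega> n)))"
      using g[of n] separation_const_nonneg sv_fun_pos[OF invertible_word_mat s(1), of "prefix \<omega> n"]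
      by (simp add: emeasure_eq_measure mass_def ennreal_mult[symmetric])
  qed
  also have "\<dots> = ennreal (separation_const * r powr s) * (\<Sum>n. ennreal (mass (prefix \<omega> n) / sv_fun s (word_mat A (prefix \<omega> n))))"
    by (rule ennreal_suminf_cmult)
  finally show ?thesis .
qed

text \<open>The exponents are rational so that the exceptional set is measurable in the pair, as
  needed to exchange the two almost-everywhere quantifiers.\<close>

lemma AE_ball_mass_le:
  "AE a in trans_measure. AE \<omega> in \<mu>. \<forall>q::rat. 0 \<le> q \<longrightarrow> real_of_rat q < real CARD('n) \<longrightarrow>
     (\<Sum>n. ennreal (mass (prefix \<omega> n) / sv_fun (real_of_rat q) (word_mat A (prefix \<omega> n)))) < \<infinity> \<longrightarrow>
     (\<exists>N. \<forall>m\<ge>N. ball_mass a \<omega> ((1/2) ^ m) \<le> ennreal ((real m + 1)\<^sup>2 * ((1/2) ^ m) powr real_of_rat q))"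
proof -
  let ?T = "trans_measure :: ('i \<Rightarrow> real^'n) measure"
  interpret T: prob_space ?T by (rule prob_space_trans)
  interpret TM: pair_prob_space ?T \<mu> ..
  let ?S = "\<lambda>q \<omega>. (\<Sum>n. ennreal (mass (prefix \<omega> n) / sv_fun (real_of_rat q) (word_mat A (prefix \<omega> n))))"
  let ?R = "\<lambda>q a \<omega>. \<exists>N. \<forall>m\<ge>N. ball_mass a \<omega> ((1/2) ^ m) \<le> ennreal ((real m + 1)\<^sup>2 * ((1/2) ^ m) powr real_of_rat q)"
  let ?P = "\<lambda>a \<omega>. \<forall>q::rat. 0 \<le> q \<longrightarrow> real_of_rat q < real CARD('n) \<longrightarrow> ?S q \<omega> < \<infinity> \<longrightarrow> ?R q a \<omega>"
  have S_meas [measurable]: "?S q \<in> borel_measurable \<mu>" for q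
    by (intro borel_measurable_suminf_order prefix_fun_measurable[of "\<lambda>w. ennreal (mass w / sv_fun (real_of_rat q) (word_mat A w))"]) simp
  have S2 [measurable]: "(\<lambda>p. ?S q (snd p)) \<in> borel_measurable (?T \<Otimes>\<^sub>M \<mu>)" for q
    by (rule measurable_compose[OF measurable_snd S_meas])
  have "{p \<in> space (?T \<Otimes>\<^sub>M \<mu>). ?P (fst p) (snd p)} \<in> sets (?T \<Otimes>\<^sub>M \<mu>)"
    by measurable
  from TM.AE_commute[OF this]
  have "(AE a in ?T. AE \<omega> in \<mu>. ?P a \<omega>) \<longleftrightarrow> (AE \<omega> in \<mu>. AE a in ?T. ?P a \<omega>)" .
  moreover have "AE \<omega> in \<mu>. AE a in ?T. ?P a \<omega>"
  proof (rule AE_I2)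
    fix \<omega> :: "nat \<Rightarrow> 'i"
    show "AE a in ?T. ?P a \<omega>"
      unfolding AE_all_countable
    proof
      fix q :: rat
      let ?s = "real_of_rat q"
      show "AE a in ?T. 0 \<le> q \<longrightarrow> ?s < real CARD('n) \<longrightarrow> ?S q \<omega> < \<infinity> \<longrightarrow> ?R q a \<omega>"
      proof (cases "0 \<le> q \<and> ?s < real CARD('n) \<and> ?S q \<omega> < \<infinity>")
        case False then show ?thesis by (intro AE_I2) blast
      next
        case True
        then have s: "0 \<le> ?s" "?s < real CARD('n)" by simp_all
        obtain K where K: "0 \<le> K" "?S q \<omega> = ennreal K" using True by (cases "?S q \<omega>") auto
        let ?r = "\<lambda>m. (1/2::real) ^ m"
        \<comment> \<open>Normalised so that the expectations are at most a constant times
          \<open>1 / (m + 1)^2\<close>; the values are then eventually below 1 for almost every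
          \<open>a\<close>.\<close>
        let ?f = "\<lambda>m a. ennreal (1 / ((real m + 1)\<^sup>2 * ?r m powr ?s)) * ball_mass a \<omega> (?r m)"
        have bm: "(\<lambda>a. ball_mass a \<omega> r) \<in> borel_measurable ?T" for r
        proof -
          have "(\<lambda>a. (a, \<omega>)) \<in> measurable ?T (?T \<Otimes>\<^sub>M \<mu>)" by (rule measurable_Pair2') simp
          from measurable_compose[OF this ball_mass_measurable[of r]] show ?thesis by simp
        qed
        have fm: "?f m \<in> borel_measurable ?T" for m
          by (intro borel_measurable_times_ennreal borel_measurable_const bm)
        have "(\<integral>\<^sup>+ a. ?f m a \<partial>?T) \<le> ennreal (separation_const * K / (real m + 1)\<^sup>2)" for m
        proof -
          have "(\<integral>\<^sup>+ a. ?f m a \<partial>?T) = ennreal (1 / ((real m + 1)\<^sup>2 * ?r m powr ?s)) * (\<integral>\<^sup>+ a. ball_mass a \<omega> (?r m) \<partial>?T)"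
            by (rule nn_integral_cmult[OF bm])
          also have "\<dots> \<le> ennreal (1 / ((real m + 1)\<^sup>2 * ?r m powr ?s)) * (ennreal (separation_const * ?r m powr ?s) * ennreal K)"
            using expected_ball_mass[OF s, of "?r m" \<omega>] unfolding K(2) by (intro mult_left_mono) auto
          also have "\<dots> = ennreal (1 / ((real m + 1)\<^sup>2 * ?r m powr ?s) * (separation_const * ?r m powr ?s * K))"
          proof -
            have "ennreal (y * (z * K)) = ennreal y * (ennreal z * ennreal K)" if "0 \<le> y" "0 \<le> z" for y z
              using that by (simp only: ennreal_mult')
            from this[symmetric] show ?thesis using separation_const_nonneg by simp
          qed
          also have "1 / ((real m + 1)\<^sup>2 * ?r m powr ?s) * (separation_const * ?r m powr ?s * K) = separation_const * K / (real m + 1)\<^sup>2"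
            by (simp add: field_simps)
          finally show ?thesis .
        qed
        note le = this
        have "AE a in ?T. \<forall>\<^sub>F m in sequentially. ?f m a < 1"
          by (rule AE_eventually_less_1[OF fm _ le]) (use K(1) separation_const_nonneg in simp)
        then have "AE a in ?T. ?R q a \<omega>"
        proof (rule AE_mp, intro AE_I2 impI)
          fix a assume "\<forall>\<^sub>F m in sequentially. ?f m a < 1"
          then obtain N where N: "\<And>m. m \<ge> N \<Longrightarrow> ?f m a < 1" unfolding eventually_sequentially by blast
          have "ball_mass a \<omega> (?r m) \<le> ennreal ((real m + 1)\<^sup>2 * ?r m powr ?s)" if m: "m \<ge> N" for m
          proof -
            define x where "x = measure \<mu> {\<tau>. norm (coding_map A a \<tau> - coding_map A a \<omega>) \<le> ?r m}"
            define y where "y = (real m + 1)\<^sup>2 * ?r m powr ?s"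
            have y: "0 < y" by (simp add: y_def)
            have bx: "ball_mass a \<omega> (?r m) = ennreal x" by (simp add: ball_mass_def x_def emeasure_eq_measure)
            have x: "0 \<le> x" by (simp add: x_def)
            have "ennreal (1 / y * x) = ennreal (1 / y) * ennreal x" by (rule ennreal_mult') (use y in simp)
            then have "ennreal (1 / y * x) < 1" using N[OF m] unfolding bx y_def[symmetric] by simp
            then have "1 / y * x < 1" by simp
            then have "x \<le> y" using y by (simp add: field_simps)
            then show ?thesis unfolding bx y_def[symmetric] by (rule ennreal_leI)
          qed
          then show "?R q a \<omega>" by blast
        qed
        then show ?thesis by (rule AE_mp) (auto intro!: AE_I2)
      qed
    qed
  qed
  ultimately show ?thesis by blast
qed

end

section \<open>Local dimension along dyadic scales\<close>

text \<open>Almost surely the observed cell is lighter than the average cell of its class by at most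
  a quadratic factor in \<open>n\<close>, from some \<open>n\<close> on.\<close>

lemma (in prob_space) AE_cell_mass:
  fixes X :: "nat \<Rightarrow> 'a \<Rightarrow> 'c::countable" and Y :: "nat \<Rightarrow> 'a \<Rightarrow> 'e::countable"
  assumes X [measurable]: "\<And>n. X n \<in> measurable M (count_space UNIV)"
    and Y [measurable]: "\<And>n. Y n \<in> measurable M (count_space UNIV)"
    and L: "\<And>n w. finite (L n w)" "\<And>n w. real (card (L n w)) \<le> N n w" "\<And>n w. 0 < N n w"
      "\<And>n \<omega>. \<omega> \<in> space M \<Longrightarrow> Y n \<omega> \<in> L n (X n \<omega>)"
  shows "AE \<omega> in M. \<forall>\<^sub>F n in sequentially. measure M {\<omega>' \<in> space M. X n \<omega>' = X n \<omega>} \<le>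
     (real n + 1)\<^sup>2 * N n (X n \<omega>) * measure M {\<omega>' \<in> space M. X n \<omega>' = X n \<omega> \<and> Y n \<omega>' = Y n \<omega>}"
proof -
  let ?m = "\<lambda>n w. measure M {\<omega> \<in> space M. X n \<omega> = w}"
  let ?Z = "\<lambda>n \<omega>. (X n \<omega>, Y n \<omega>)"
  \<comment> \<open>The mass of each class of \<open>X n\<close> is spread evenly over its at most
    \<open>N\<close> labels; this is a subprobability on pairs, to be compared with the actual
    masses.\<close>
  define q where "q n p = (?m n (fst p) / N n (fst p)) * indicator (L n (fst p)) (snd p)" for n p
  have "AE \<omega> in M. \<forall>\<^sub>F n in sequentially. q n (?Z n \<omega>) \<le> (real n + 1)\<^sup>2 * measure M {\<omega>' \<in> space M. ?Z n \<omega>' = ?Z n \<omega>}"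
  proof (rule AE_weight_le_mass)
    show "?Z n \<in> measurable M (count_space UNIV)" for n
    proof -
      have "?Z n \<in> measurable M (count_space UNIV \<Otimes>\<^sub>M count_space UNIV)" by (rule measurable_Pair[OF X Y])
      then show ?thesis by (simp add: pair_measure_countable)
    qed
    show "0 \<le> q n p" for n p unfolding q_def using L(3)[of n "fst p"] by (simp add: less_imp_le)
    show "(\<integral>\<^sup>+ p. ennreal (q n p) \<partial>count_space UNIV) \<le> 1" for n
    proof -
      have "(\<integral>\<^sup>+ p. ennreal (q n p) \<partial>count_space UNIV) = (\<integral>\<^sup>+ w. (\<integral>\<^sup>+ y. ennreal (q n (w, y)) \<partial>count_space UNIV) \<partial>count_space UNIV)"
        by (rule nn_integral_fst_count_space[symmetric])
      also have "\<dots> \<le> (\<integral>\<^sup>+ w. 1 * emeasure M {\<omega> \<in> space M. X n \<omega> = w} \<partial>count_space UNIV)"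
      proof (rule nn_integral_mono)
        fix w
        have "(\<integral>\<^sup>+ y. ennreal (q n (w, y)) \<partial>count_space UNIV) = (\<integral>\<^sup>+ y. ennreal (?m n w / N n w) * indicator (L n w) y \<partial>count_space UNIV)"
          unfolding q_def by (intro nn_integral_cong) (auto simp: indicator_def)
        also have "\<dots> = ennreal (?m n w / N n w) * of_nat (card (L n w))"
          using L(1) by (simp add: nn_integral_cmult_indicator)
        also have "\<dots> = ennreal (?m n w / N n w * real (card (L n w)))"
          using L(3)[of n w] by (simp add: ennreal_mult[symmetric] ennreal_of_nat_eq_real_of_nat less_imp_le)
        also have "\<dots> \<le> ennreal (?m n w)"
          using L(2,3)[of n w] mult_left_mono[OF L(2), of "?m n w" n w] by (intro ennreal_leI) (simp add: field_simps)
        finally show "(\<integral>\<^sup>+ y. ennreal (q n (w, y)) \<partial>count_space UNIV) \<le> 1 * emeasure M {\<omega> \<in> space M. X n \<omega> = w}"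
          by (simp add: emeasure_eq_measure)
      qed
      also have "\<dots> = (\<integral>\<^sup>+ \<omega>. 1 \<partial>M)" by (rule nn_integral_countable_valued[OF X, symmetric])
      also have "\<dots> = 1" by (simp add: emeasure_space_1)
      finally show ?thesis .
    qed
  qed
  then show ?thesis
  proof (rule AE_mp, intro AE_I2 impI)
    fix \<omega> assume \<omega>: "\<omega> \<in> space M"
    assume "\<forall>\<^sub>F n in sequentially. q n (?Z n \<omega>) \<le> (real n + 1)\<^sup>2 * measure M {\<omega>' \<in> space M. ?Z n \<omega>' = ?Z n \<omega>}"
    then show "\<forall>\<^sub>F n in sequentially. ?m n (X n \<omega>) \<le>
     (real n + 1)\<^sup>2 * N n (X n \<omega>) * measure M {\<omega>' \<in> space M. X n \<omega>' = X n \<omega> \<and> Y n \<omega>' = Y n \<omega>}"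
    proof eventually_elim
      case (elim n)
      then have "?m n (X n \<omega>) / N n (X n \<omega>) \<le> (real n + 1)\<^sup>2 * measure M {\<omega>' \<in> space M. X n \<omega>' = X n \<omega> \<and> Y n \<omega>' = Y n \<omega>}"
        using L(4)[OF \<omega>, of n] by (simp add: q_def)
      then show ?case using L(3)[of n "X n \<omega>"] by (simp add: divide_le_eq mult_ac)
    qed
  qed
qed

text \<open>Radii with an exact exponential rate have gaps of subexponential relative size, so a
  mass estimate along them passes to all dyadic radii at the price of an arbitrarily small increase
  of the exponent.\<close>

lemma dyadic_lower_bound_of_scales:
  fixes \<beta> :: "real \<Rightarrow> real" and r :: "nat \<Rightarrow> real" and s t \<kappa> :: real
  assumes mono: "\<And>x y. x \<le> y \<Longrightarrow> \<beta> x \<le> \<beta> y" and r: "\<And>n. 0 < r n"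
    and lim: "(\<lambda>n. - ln (r n) / n) \<longlonglongrightarrow> \<kappa>" and \<kappa>: "0 < \<kappa>" and s: "0 \<le> s" "s < t"
    and \<beta>: "\<forall>\<^sub>F n in sequentially. exp (- (s * \<kappa> * n)) \<le> \<beta> (r n)"
  shows "\<forall>\<^sub>F m in sequentially. ((1/2) ^ m) powr t \<le> \<beta> ((1/2) ^ m)"
proof -
  \<comment> \<open>A rate slightly below \<kappa>: \<open>s < t\<close> gives both \<kappa>' <
    \<kappa>, so \<open>r n\<close> is eventually below \<open>exp (- (\<kappa>' * n))\<close>, and
    \<open>s * \<kappa> < t * \<kappa>'\<close>, the gain that absorbs rounding.\<close>
  define \<kappa>' where "\<kappa>' = \<kappa> * (t + s) / (2 * t)"
  have t: "0 < t" using s by simp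
  have \<kappa>'_pos: "0 < \<kappa>'" using \<kappa> s t by (simp add: \<kappa>'_def)
  have \<kappa>'_less: "\<kappa>' < \<kappa>" using \<kappa> s t by (simp add: \<kappa>'_def field_simps)
  have gap: "0 < t - s * \<kappa> / \<kappa>'"
  proof -
    have "s * \<kappa> < t * \<kappa>'" using \<kappa> s t by (simp add: \<kappa>'_def field_simps)
    then show ?thesis using \<kappa>'_pos by (simp add: field_simps)
  qed
  have "\<forall>\<^sub>F n in sequentially. \<kappa>' < - ln (r n) / n" using lim \<kappa>'_less by (rule order_tendstoD)
  then have "\<forall>\<^sub>F n in sequentially. \<kappa>' < - ln (r n) / n \<and> exp (- (s * \<kappa> * n)) \<le> \<beta> (r n)"
    using \<beta> by (rule eventually_conj)
  then obtain N where N: "\<And>n. N \<le> n \<Longrightarrow> \<kappa>' < - ln (r n) / n \<and> exp (- (s * \<kappa> * n)) \<le> \<beta> (r n)"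
    unfolding eventually_sequentially by blast
  obtain N1 :: nat where N1: "real (Suc N) * \<kappa>' / ln 2 \<le> real N1" using real_arch_simple by blast
  obtain N2 :: nat where N2: "s * \<kappa> / (ln 2 * (t - s * \<kappa> / \<kappa>')) \<le> real N2" using real_arch_simple by blast
  show ?thesis
    unfolding eventually_sequentially
  proof (intro exI allI impI)
    fix m assume m: "max N1 N2 \<le> m"
    \<comment> \<open>The least \<open>n\<close> with \<open>exp (- (\<kappa>' * n))\<close> at most
      \<open>(1/2) ^ m\<close>, so that \<open>r n\<close> fits below the dyadic radius.
      \<open>N1\<close> ensures that \<open>n\<close> is large, and \<open>N2\<close> pays for
      rounding up.\<close>
    define n where "n = nat \<lceil>m * ln 2 / \<kappa>'\<rceil>"
    have n0: "0 \<le> m * ln 2 / \<kappa>'" using \<kappa>'_pos by simp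
    have n_ge: "m * ln 2 / \<kappa>' \<le> real n" unfolding n_def by linarith
    have n_le: "real n \<le> m * ln 2 / \<kappa>' + 1" unfolding n_def using n0 by linarith
    have "real (Suc N) * \<kappa>' / ln 2 \<le> real m" using N1 m by linarith
    then have "real (Suc N) \<le> m * ln 2 / \<kappa>'" using \<kappa>'_pos by (simp add: field_simps)
    then have nN: "N \<le> n" "0 < n" using n_ge by linarith+
    have "\<kappa>' * n < - ln (r n)" using N[OF nN(1)] nN(2) by (simp add: field_simps)
    moreover have "m * ln 2 \<le> \<kappa>' * n" using n_ge \<kappa>'_pos by (simp add: field_simps)
    ultimately have "ln (r n) \<le> ln ((1/2) ^ m)" by (simp add: ln_realpow ln_div)
    then have rm: "r n \<le> (1/2) ^ m" using r by simp
    have "s * \<kappa> \<le> m * (ln 2 * (t - s * \<kappa> / \<kappa>'))"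
    proof -
      have "s * \<kappa> / (ln 2 * (t - s * \<kappa> / \<kappa>')) \<le> real m" using N2 m by linarith
      moreover have "0 < ln 2 * (t - s * \<kappa> / \<kappa>')" using gap by simp
      ultimately show ?thesis by (simp only: pos_divide_le_eq)
    qed
    moreover have "s * \<kappa> * n \<le> s * \<kappa> * (m * ln 2 / \<kappa>' + 1)" using n_le s \<kappa> by (intro mult_left_mono) auto
    moreover have "s * \<kappa> * (m * ln 2 / \<kappa>' + 1) = m * (ln 2 * (s * \<kappa> / \<kappa>')) + s * \<kappa>" by (simp add: algebra_simps)
    moreover have "m * (ln 2 * (t - s * \<kappa> / \<kappa>')) = t * (m * ln 2) - m * (ln 2 * (s * \<kappa> / \<kappa>'))" by (simp add: algebra_simps)
    ultimately have "s * \<kappa> * n \<le> t * (m * ln 2)" by linarith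
    then have "exp (- (t * (m * ln 2))) \<le> exp (- (s * \<kappa> * n))" by simp
    also have "\<dots> \<le> \<beta> (r n)" using N[OF nN(1)] by blast
    also have "\<dots> \<le> \<beta> ((1/2) ^ m)" by (rule mono[OF rm])
    finally show "((1/2) ^ m) powr t \<le> \<beta> ((1/2) ^ m)"
      by (simp add: powr_def ln_realpow ln_div mult_ac)
  qed
qed

text \<open>A countable version of local dimension \<open>D\<close>: with rational exponents and
  dyadic radii the set of such \<open>x\<close> is measurable, while the condition still implies
  \<open>local_dim_eq\<close>.\<close>

definition dyadic_dim :: "'a::metric_space measure \<Rightarrow> 'a \<Rightarrow> real \<Rightarrow> bool" where
  "dyadic_dim \<nu> x D \<longleftrightarrow> (\<forall>q::rat.
     (D < real_of_rat q \<longrightarrow> (\<forall>\<^sub>F m in sequentially. ((1/2) ^ m) powr real_of_rat q \<le> measure \<nu> (ball x ((1/2) ^ m)))) \<and>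
     (real_of_rat q < D \<longrightarrow> (\<forall>\<^sub>F m in sequentially. measure \<nu> (ball x ((1/2) ^ m)) \<le> ((1/2) ^ m) powr real_of_rat q)))"

lemma dyadic_bracket:
  fixes r :: real
  assumes "0 < r" "r < (1/2) ^ N"
  obtains m where "N \<le> m" "(1/2) ^ Suc m \<le> r" "r < (1/2) ^ m"
proof -
  define P where "P m \<longleftrightarrow> (1/2::real) ^ Suc m \<le> r" for m
  obtain k where "(1/2::real) ^ k < r" using real_arch_pow_inv[OF assms(1), of "1/2"] by auto
  then have "(1/2::real) ^ Suc k \<le> r" using power_decreasing[of k "Suc k" "1/2::real"] by linarith
  then have Pk: "P k" by (simp add: P_def)
  define m where "m = (LEAST m. P m)"
  have Pm: "P m" unfolding m_def by (rule LeastI[of P, OF Pk])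
  have "N \<le> m"
  proof (rule ccontr)
    assume "\<not> N \<le> m"
    then have "(1/2::real) ^ N \<le> (1/2) ^ Suc m" by (intro power_decreasing) auto
    then show False using Pm assms(2) by (simp add: P_def)
  qed
  moreover have "r < (1/2) ^ m"
  proof (cases m)
    case 0 then show ?thesis using assms(2) power_le_one[of "1/2::real" N] by simp
  next
    case (Suc j)
    then have "\<not> P j" using not_less_Least[of j P] m_def by simp
    then show ?thesis using Suc by (simp add: P_def)
  qed
  ultimately show thesis using that Pm by (simp add: P_def)
qed

lemma ln_half_power: "ln ((1/2::real) ^ m) = - (real m * ln 2)"
  by (simp add: ln_realpow ln_div)

text \<open>Each radius lies between two consecutive dyadic ones; the resulting factor 2 is
  negligible against the gap between the rational exponent \<open>q\<close> and the target
  \<open>t\<close>. Dividing by \<open>ln r\<close> reverses inequalities because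
  \<open>r < 1\<close>.\<close>

lemma local_dim_eq_of_dyadic_dim:
  fixes \<nu> :: "'a::metric_space measure"
  assumes \<nu>: "prob_space \<nu>" "sets \<nu> = sets borel" and D: "0 \<le> D" and dy: "dyadic_dim \<nu> x D"
  shows "local_dim_eq \<nu> x (ereal D)"
proof -
  interpret prob_space \<nu> by fact
  have mono: "measure \<nu> (ball x r) \<le> measure \<nu> (ball x r')" if "r \<le> r'" for r r'
    using that \<nu>(2) by (intro finite_measure_mono subset_ball) auto
  have upper: "Limsup (at_right 0) (dim_ratio \<nu> x) \<le> ereal t" if t: "D < t" for t
  proof (rule Limsup_bounded)
    obtain q where q: "D < real_of_rat q" "real_of_rat q < t" using of_rat_dense[OF t] by blast
    let ?q = "real_of_rat q"
    obtain N where N: "\<And>m. N \<le> m \<Longrightarrow> ((1/2) ^ m) powr ?q \<le> measure \<nu> (ball x ((1/2) ^ m))"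
      using dy q(1) unfolding dyadic_dim_def eventually_sequentially by blast
    \<comment> \<open>From index \<open>N'\<close> on, \<open>q * (m + 1) \<le> t * m\<close>, which
      makes up for passing to the next smaller dyadic radius.\<close>
    obtain N' :: nat where N': "?q / (t - ?q) \<le> real N'" using real_arch_simple by blast
    let ?N = "max 1 (max N N')"
    show "\<forall>\<^sub>F r in at_right 0. dim_ratio \<nu> x r \<le> ereal t"
    proof (rule eventually_at_rightI[of 0 "(1/2) ^ ?N"])
      fix r :: real assume "r \<in> {0<..<(1/2) ^ ?N}"
      then have r: "0 < r" "r < (1/2) ^ ?N" by auto
      obtain m where m: "?N \<le> m" "(1/2) ^ Suc m \<le> r" "r < (1/2) ^ m" by (rule dyadic_bracket[OF r])
      define p where "p = measure \<nu> (ball x r)"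
      have le: "((1/2) ^ Suc m) powr ?q \<le> p"
        using N[of "Suc m"] mono[OF m(2)] m(1) by (simp add: p_def)
      have "0 < ((1/2::real) ^ Suc m) powr ?q" by (simp only: powr_gt_zero) simp
      with le have p: "0 < p" by linarith
      have "ln (((1/2) ^ Suc m) powr ?q) \<le> ln p" by (subst ln_le_cancel_iff) (use le p in simp_all)
      then have lnp: "- (?q * (real (Suc m) * ln 2)) \<le> ln p" by (simp only: ln_powr ln_half_power mult_minus_right)
      have "ln r < ln ((1/2) ^ m)" using r(1) m(3) by simp
      then have lnr: "ln r < - (real m * ln 2)" by (simp only: ln_half_power)
      have m1: "1 \<le> m" using m(1) by simp
      then have lnr0: "ln r < 0" using lnr by (smt (verit) mult_nonneg_nonneg of_nat_0_le_iff ln_ge_zero)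
      have "?q \<le> real m * (t - ?q)"
      proof -
        have "?q / (t - ?q) \<le> real m" using N' m(1) by linarith
        then show ?thesis using q(2) by (simp only: pos_divide_le_eq diff_gt_0_iff_gt)
      qed
      then have "?q * real (Suc m) \<le> t * real m" by (simp add: algebra_simps)
      then have "?q * real (Suc m) * ln 2 \<le> t * real m * ln 2" by (intro mult_right_mono) auto
      moreover have "t * ln r \<le> t * (- (real m * ln 2))" using lnr t D by (intro mult_left_mono) auto
      ultimately have "t * ln r \<le> ln p" using lnp by (simp add: algebra_simps)
      then have "ln p / ln r \<le> t" using lnr0 by (simp add: neg_divide_le_eq)
      then show "dim_ratio \<nu> x r \<le> ereal t" using p by (simp add: dim_ratio_def p_def)
    qed simp
  qed
  have lower: "ereal t \<le> Liminf (at_right 0) (dim_ratio \<nu> x)" if t: "t < D" for t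
  proof (rule Liminf_bounded)
    show "\<forall>\<^sub>F r in at_right 0. ereal t \<le> dim_ratio \<nu> x r"
    \<comment> \<open>For negative \<open>t\<close> the claim is immediate, as the ratio is
      nonnegative for radii below 1. The other case multiplies a bound on \<open>ln r\<close> by
      \<open>t\<close> and relies on its sign.\<close>
    proof (cases "t < 0")
      case True
      show ?thesis
      proof (rule eventually_at_rightI[of 0 1])
        fix r :: real assume r: "r \<in> {0<..<1}"
        have "0 \<le> ln (measure \<nu> (ball x r)) / ln r" if "measure \<nu> (ball x r) \<noteq> 0"
        proof -
          have "0 < measure \<nu> (ball x r)" using that measure_nonneg[of \<nu> "ball x r"] by linarith
          then have "ln (measure \<nu> (ball x r)) \<le> ln 1" using prob_le_1[of "ball x r"] by (intro ln_mono)
          then have A: "ln (measure \<nu> (ball x r)) \<le> 0" unfolding ln_one .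
          have B: "ln r \<le> 0" using r by simp
          show ?thesis by (rule divide_nonpos_nonpos[OF A B])
        qed
        then show "ereal t \<le> dim_ratio \<nu> x r" using True by (auto simp: dim_ratio_def)
      qed simp
    next
      case False
      obtain q where q: "t < real_of_rat q" "real_of_rat q < D" using of_rat_dense[OF t] by blast
      let ?q = "real_of_rat q"
      obtain N where N: "\<And>m. N \<le> m \<Longrightarrow> measure \<nu> (ball x ((1/2) ^ m)) \<le> ((1/2) ^ m) powr ?q"
        using dy q(2) unfolding dyadic_dim_def eventually_sequentially by blast
      obtain N' :: nat where N': "t / (?q - t) \<le> real N'" using real_arch_simple by blast
      let ?N = "max 1 (max N N')"
      show ?thesis
      proof (rule eventually_at_rightI[of 0 "(1/2) ^ ?N"])
        fix r :: real assume "r \<in> {0<..<(1/2) ^ ?N}"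
        then have r: "0 < r" "r < (1/2) ^ ?N" by auto
        obtain m where m: "?N \<le> m" "(1/2) ^ Suc m \<le> r" "r < (1/2) ^ m" by (rule dyadic_bracket[OF r])
        define p where "p = measure \<nu> (ball x r)"
        show "ereal t \<le> dim_ratio \<nu> x r"
        proof (cases "p = 0")
          case True then show ?thesis by (simp add: dim_ratio_def p_def)
        next
          case False
          then have p: "0 < p" using measure_nonneg[of \<nu> "ball x r"] unfolding p_def by linarith
          have "p \<le> ((1/2) ^ m) powr ?q"
            using N[of m] mono[of r "(1/2) ^ m"] m by (simp add: p_def)
          then have "ln p \<le> ln (((1/2) ^ m) powr ?q)" using p by (intro ln_mono)
          then have lnp: "ln p \<le> - (?q * (real m * ln 2))" by (simp only: ln_powr ln_half_power mult_minus_right)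
          have "ln ((1/2) ^ Suc m) \<le> ln r" using m(2) by (intro ln_mono) auto
          then have lnr: "- (real (Suc m) * ln 2) \<le> ln r" by (simp only: ln_half_power)
          have "r < 1" using m(3) power_le_one[of "1/2::real" m] by simp
          then have lnr0: "ln r < 0" using r(1) by simp
          have "t \<le> real m * (?q - t)"
          proof -
            have "t / (?q - t) \<le> real m" using N' m(1) by linarith
            then show ?thesis using q(1) by (simp only: pos_divide_le_eq diff_gt_0_iff_gt)
          qed
          then have "t * real (Suc m) \<le> ?q * real m" by (simp add: algebra_simps)
          then have "t * real (Suc m) * ln 2 \<le> ?q * real m * ln 2" by (intro mult_right_mono) auto
          moreover have "t * (- (real (Suc m) * ln 2)) \<le> t * ln r" using lnr False \<open>\<not> t < 0\<close> by (intro mult_left_mono) auto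
          ultimately have "ln p \<le> t * ln r" using lnp by (simp add: algebra_simps)
          then have "t \<le> ln p / ln r" using lnr0 by (simp add: neg_le_divide_eq)
          then show ?thesis using p by (simp add: dim_ratio_def p_def)
        qed
      qed simp
    qed
  qed
  have U: "Limsup (at_right 0) (dim_ratio \<nu> x) \<le> ereal D"
  proof (rule ccontr)
    assume "\<not> ?thesis"
    then have "ereal D < Limsup (at_right 0) (dim_ratio \<nu> x)" by simp
    from ereal_dense2[OF this] obtain t where "ereal D < ereal t" "ereal t < Limsup (at_right 0) (dim_ratio \<nu> x)" by blast
    with upper[of t] show False by simp
  qed
  have Lo: "ereal D \<le> Liminf (at_right 0) (dim_ratio \<nu> x)"
  proof (rule ccontr)
    assume "\<not> ?thesis"
    then have "Liminf (at_right 0) (dim_ratio \<nu> x) < ereal D" by simp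
    from ereal_dense2[OF this] obtain t where "Liminf (at_right 0) (dim_ratio \<nu> x) < ereal t" "ereal t < ereal D" by blast
    with lower[of t] show False by simp
  qed
  have "Liminf (at_right 0) (dim_ratio \<nu> x) \<le> Limsup (at_right 0) (dim_ratio \<nu> x)"
    by (rule Liminf_le_Limsup) simp
  note LU = this
  have "Liminf (at_right 0) (dim_ratio \<nu> x) = ereal D"
    by (rule antisym[OF order_trans[OF LU U] Lo])
  moreover have "Limsup (at_right 0) (dim_ratio \<nu> x) = ereal D"
    by (rule antisym[OF U order_trans[OF Lo LU]])
  ultimately show ?thesis unfolding local_dim_eq_def lower_local_dim_def upper_local_dim_def by blast
qed

text \<open>The mass of a ball is the mass of a section of the open set of pairs at distance less
  than \<open>r\<close>, hence measurable in the centre.\<close>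

lemma dyadic_dim_measurable:
  fixes \<nu> :: "(real^'n) measure"
  assumes \<nu>: "prob_space \<nu>" "sets \<nu> = sets borel"
  shows "{x \<in> space borel. dyadic_dim \<nu> x D} \<in> sets borel"
proof -
  interpret prob_space \<nu> by fact
  have ball_meas: "(\<lambda>x. measure \<nu> (ball x r)) \<in> borel_measurable borel" for r
  proof -
    have "{p. dist (fst p) (snd p) < r} \<in> sets (borel \<Otimes>\<^sub>M (borel :: (real^'n) measure))"
      unfolding borel_prod by (intro borel_open open_Collect_less continuous_intros)
    then have "{p. dist (fst p) (snd p) < r} \<in> sets (borel \<Otimes>\<^sub>M \<nu>)"
      using sets_pair_measure_cong[of "borel :: (real^'n) measure" borel \<nu> borel, OF refl \<nu>(2)] by simp
    from measurable_emeasure_Pair[OF this]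
    have "(\<lambda>x. enn2real (emeasure \<nu> (Pair x -` {p. dist (fst p) (snd p) < r}))) \<in> borel_measurable borel"
      by (rule measurable_compose) simp
    moreover have "enn2real (emeasure \<nu> (Pair x -` {p. dist (fst p) (snd p) < r})) = measure \<nu> (ball x r)" for x
      unfolding measure_def by (intro arg_cong[where f="\<lambda>A. enn2real (emeasure \<nu> A)"]) auto
    ultimately show ?thesis by simp
  qed
  note [measurable] = ball_meas
  show ?thesis
    unfolding dyadic_dim_def eventually_sequentially by measurable
qed

section \<open>Ball masses of the projected measure\<close>

context ifs_measure
begin

text \<open>The version for open balls with real values, matching the balls in
  \<open>dim_ratio\<close>; \<open>ball_mass\<close> uses closed balls and \<open>ennreal\<close>
  for integration over translations.\<close>

definition ball_prob :: "('i \<Rightarrow> real^'n) \<Rightarrow> (nat \<Rightarrow> 'i) \<Rightarrow> real \<Rightarrow> real" where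
  "ball_prob a \<omega> r = measure \<mu> {\<tau>. norm (coding_map A a \<tau> - coding_map A a \<omega>) < r}"

lemma ball_set_measurable:
  assumes "a \<in> space trans_measure"
  shows "{\<tau>. norm (coding_map A a \<tau> - y) < r} \<in> sets \<mu>" "{\<tau>. norm (coding_map A a \<tau> - y) \<le> r} \<in> sets \<mu>"
proof -
  have m: "(\<lambda>\<tau>. norm (coding_map A a \<tau> - y)) \<in> borel_measurable \<mu>"
    by (rule measurable_compose[OF borel_measurable_diff[OF coding_measurable_\<mu>[OF assms] borel_measurable_const] borel_measurable_norm])
  show "{\<tau>. norm (coding_map A a \<tau> - y) < r} \<in> sets \<mu>"
    using borel_measurable_less[OF m borel_measurable_const[of r]] by simp
  show "{\<tau>. norm (coding_map A a \<tau> - y) \<le> r} \<in> sets \<mu>"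
    using borel_measurable_le[OF m borel_measurable_const[of r]] by simp
qed

lemma measure_distr_ball:
  assumes a: "a \<in> space trans_measure"
  shows "measure (distr \<mu> borel (coding_map A a)) (ball (coding_map A a \<omega>) r) = ball_prob a \<omega> r"
proof -
  have "measure (distr \<mu> borel (coding_map A a)) (ball (coding_map A a \<omega>) r) =
      measure \<mu> (coding_map A a -` ball (coding_map A a \<omega>) r \<inter> space \<mu>)"
    by (rule measure_distr[OF coding_measurable_\<mu>[OF a]]) simp
  also have "coding_map A a -` ball (coding_map A a \<omega>) r \<inter> space \<mu> = {\<tau>. norm (coding_map A a \<tau> - coding_map A a \<omega>) < r}"
    by (auto simp: dist_norm norm_minus_commute)
  finally show ?thesis by (simp add: ball_prob_def)
qed

lemma ball_prob_mono:
  assumes "a \<in> space trans_measure" "r \<le> r'"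
  shows "ball_prob a \<omega> r \<le> ball_prob a \<omega> r'"
  unfolding ball_prob_def using assms(2) by (intro finite_measure_mono ball_set_measurable[OF assms(1)]) auto

lemma ball_prob_le_of_ball_mass:
  assumes "a \<in> space trans_measure" "ball_mass a \<omega> r \<le> ennreal x" "0 \<le> x"
  shows "ball_prob a \<omega> r \<le> x"
proof -
  have "ball_prob a \<omega> r \<le> measure \<mu> {\<tau>. norm (coding_map A a \<tau> - coding_map A a \<omega>) \<le> r}"
    unfolding ball_prob_def by (intro finite_measure_mono ball_set_measurable[OF assms(1)]) auto
  also have "\<dots> \<le> x" using assms(2,3) by (simp add: ball_mass_def emeasure_eq_measure)
  finally show ?thesis .
qed

section \<open>Cells of cylinder images\<close>

definition radius :: real where "radius = real CARD('n) / (1 - c)"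

lemma radius_nonneg: "0 \<le> radius" using c_less by (simp add: radius_def)

lemma norm_coding_le_radius:
  assumes "a \<in> space trans_measure"
  shows "norm (coding_map A a \<omega>) \<le> radius"
  unfolding radius_def by (rule norm_coding_map_le[where a=a, OF norm_translation_le[OF assms]])

text \<open>A bound for the number of cells with side the singular value of index \<open>k\<close>
  that cover the image of a ball. Up to the constant it is \<open>sv_fun s\<close> over the
  \<open>s\<close>-th power of that singular value, for any \<open>s\<close> between
  \<open>k\<close> and \<open>k + 1\<close>.\<close>

definition cell_count :: "nat \<Rightarrow> 'i list \<Rightarrow> real" where
  "cell_count k w = (2 * radius + 2) ^ k * (sv_prod k (word_mat A w) / (sing_vals (word_mat A w) ! k) ^ k)"

lemma cell_count_pos:
  assumes k: "k < CARD('n)"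
  shows "0 < cell_count k w"
proof -
  have "0 < sv_prod k (word_mat A w)" by (rule sv_prod_pos[OF invertible_word_mat less_imp_le[OF k]])
  moreover have "0 < sing_vals (word_mat A w) ! k" by (rule sing_vals_pos[OF invertible_word_mat k])
  moreover have "0 < 2 * radius + 2" using radius_nonneg by linarith
  ultimately show ?thesis unfolding cell_count_def by simp
qed

text \<open>\<open>box_partition\<close> in the basis of left singular vectors, with cell size the
  singular value of index \<open>k\<close>. The semi-axes from index \<open>k\<close> on are at most
  \<open>radius\<close> times that size, so these directions stay uncut.\<close>

lemma ellipsoid_partition:
  assumes k: "k < CARD('n)"
  shows "\<exists>(lab :: real^'n \<Rightarrow> int list) L. finite L \<and> real (card L) \<le> cell_count k w \<and>
    lab \<in> measurable borel (count_space UNIV) \<and>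
    (\<forall>y. norm y \<le> radius \<longrightarrow> lab (word_mat A w *v y) \<in> L) \<and>
    (\<forall>y y'. norm y \<le> radius \<longrightarrow> norm y' \<le> radius \<longrightarrow> lab (word_mat A w *v y) = lab (word_mat A w *v y') \<longrightarrow>
       norm (word_mat A w *v y - word_mat A w *v y') \<le> real CARD('n) * (1 + 2 * radius) * (sing_vals (word_mat A w) ! k))"
proof -
  let ?M = "word_mat A w"
  let ?a = "\<lambda>l. sing_vals ?M ! l"
  obtain u v where uv: "orthonormal_family u" "orthonormal_family v"
    "\<And>l. l < CARD('n) \<Longrightarrow> 0 < ?a l"
    "\<And>l x. l < CARD('n) \<Longrightarrow> (?M *v x) \<bullet> u l = ?a l * (x \<bullet> v l)"
    by (rule svd[OF invertible_word_mat[of w]]) blast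
  have box: "\<forall>l<CARD('n). \<bar>(?M *v y) \<bullet> u l\<bar> \<le> radius * ?a l" if y: "norm y \<le> radius" for y
  proof (intro allI impI)
    fix l assume l: "l < CARD('n)"
    have "\<bar>y \<bullet> v l\<bar> \<le> radius"
      using Cauchy_Schwarz_ineq2[of y "v l"] orthonormal_family_norm[OF uv(2) l] y by simp
    then show "\<bar>(?M *v y) \<bullet> u l\<bar> \<le> radius * ?a l"
      using uv(3)[OF l] by (simp add: uv(4)[OF l] abs_mult mult.commute mult_left_mono)
  qed
  obtain lab :: "real^'n \<Rightarrow> int list" and L where L: "finite L" "real (card L) \<le> (\<Prod>l<k. 2 * (radius * ?a l) / ?a k + 2)"
    "lab \<in> measurable borel (count_space UNIV)"
    "\<And>p. (\<forall>l<CARD('n). \<bar>p \<bullet> u l\<bar> \<le> radius * ?a l) \<Longrightarrow> lab p \<in> L"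
    "\<And>p p'. (\<forall>l<CARD('n). \<bar>p \<bullet> u l\<bar> \<le> radius * ?a l) \<Longrightarrow> (\<forall>l<CARD('n). \<bar>p' \<bullet> u l\<bar> \<le> radius * ?a l) \<Longrightarrow> lab p = lab p' \<Longrightarrow>
        norm (p - p') \<le> real CARD('n) * (1 + 2 * radius) * ?a k"
  proof -
    have "\<exists>(lab :: real^'n \<Rightarrow> int list) L. finite L \<and> real (card L) \<le> (\<Prod>l<k. 2 * (radius * ?a l) / ?a k + 2) \<and>
      lab \<in> measurable borel (count_space UNIV) \<and>
      (\<forall>p. (\<forall>l<CARD('n). \<bar>p \<bullet> u l\<bar> \<le> radius * ?a l) \<longrightarrow> lab p \<in> L) \<and>
      (\<forall>p p'. (\<forall>l<CARD('n). \<bar>p \<bullet> u l\<bar> \<le> radius * ?a l) \<longrightarrow> (\<forall>l<CARD('n). \<bar>p' \<bullet> u l\<bar> \<le> radius * ?a l) \<longrightarrow> lab p = lab p' \<longrightarrow>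
          norm (p - p') \<le> real CARD('n) * (1 + 2 * radius) * ?a k)"
    proof (rule box_partition[OF uv(1) uv(3)[OF k] less_imp_le[OF k]])
      show "0 \<le> radius * ?a l" if "l < CARD('n)" for l using radius_nonneg uv(3)[OF that] by simp
      show "0 \<le> radius" by (rule radius_nonneg)
      show "radius * ?a l \<le> radius * ?a k" if "k \<le> l" "l < CARD('n)" for l
        using sing_vals_antimono[OF that] radius_nonneg by (intro mult_left_mono)
    qed
    then show thesis using that by blast
  qed
  have "(\<Prod>l<k. 2 * (radius * ?a l) / ?a k + 2) \<le> (\<Prod>l<k. (2 * radius + 2) * (?a l / ?a k))"
  proof (rule prod_mono)
    fix l assume "l \<in> {..<k}"
    then have l: "l < k" "l < CARD('n)" using k by auto
    have "?a k \<le> ?a l" using l k by (intro sing_vals_antimono) auto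
    define x where "x = ?a l / ?a k"
    have x: "1 \<le> x" using \<open>?a k \<le> ?a l\<close> uv(3)[OF k] by (simp add: x_def field_simps)
    have "2 * (radius * ?a l) / ?a k = 2 * radius * x" by (simp add: x_def)
    moreover have "2 * radius * x + 2 \<le> (2 * radius + 2) * x" using x by (simp add: distrib_right)
    moreover have "0 \<le> 2 * radius * x" using x radius_nonneg by simp
    ultimately show "0 \<le> 2 * (radius * ?a l) / ?a k + 2 \<and> 2 * (radius * ?a l) / ?a k + 2 \<le> (2 * radius + 2) * (?a l / ?a k)"
      unfolding x_def by linarith
  qed
  also have "\<dots> = cell_count k w"
    by (subst prod.distrib) (simp add: cell_count_def sv_prod_def prod_dividef)
  finally have "real (card L) \<le> cell_count k w" using L(2) by linarith
  then show ?thesis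
    using L(1,3) L(4)[OF box] L(5)[OF box box] by (intro exI[of _ lab] exI[of _ L]) blast
qed

text \<open>The class of a sequence is its prefix and its label is the cell of its projection inside
  the ellipsoid of that prefix. Sequences in one cell project close together, so the ball contains
  the cell. The factor 2 in the radius turns the closed estimate into the strict one of an open
  ball.\<close>

lemma AE_ellipsoid_lower:
  assumes a: "a \<in> space trans_measure" and k: "k < CARD('n)"
  shows "AE \<omega> in \<mu>. \<forall>\<^sub>F n in sequentially. mass (prefix \<omega> n) \<le> (real n + 1)\<^sup>2 * cell_count k (prefix \<omega> n) *
    ball_prob a \<omega> (2 * real CARD('n) * (1 + 2 * radius) * (sing_vals (word_mat A (prefix \<omega> n)) ! k))"
proof -
  let ?\<pi> = "coding_map A a"
  let ?P = "\<lambda>w lab L. finite L \<and> real (card L) \<le> cell_count k w \<and>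
    lab \<in> measurable (borel :: (real^'n) measure) (count_space (UNIV :: int list set)) \<and>
    (\<forall>y. norm y \<le> radius \<longrightarrow> lab (word_mat A w *v y) \<in> L) \<and>
    (\<forall>y y'. norm y \<le> radius \<longrightarrow> norm y' \<le> radius \<longrightarrow> lab (word_mat A w *v y) = lab (word_mat A w *v y') \<longrightarrow>
       norm (word_mat A w *v y - word_mat A w *v y') \<le> real CARD('n) * (1 + 2 * radius) * (sing_vals (word_mat A w) ! k))"
  have "\<forall>w. \<exists>lab. \<exists>L. ?P w lab L" using ellipsoid_partition[OF k] by blast
  from choice[OF this] obtain lab where "\<forall>w. \<exists>L. ?P w (lab w) L" ..
  from choice[OF this] obtain L where "\<forall>w. ?P w (lab w) (L w)" ..
  then have P: "?P w (lab w) (L w)" for w ..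
  \<comment> \<open>Subtracting the image of the origin centres the ellipsoid, so the label depends
    on a point of the form \<open>word_mat A w *v y\<close>.\<close>
  have decomp: "?\<pi> \<omega> - word_fun A a (prefix \<omega> n) 0 = word_mat A (prefix \<omega> n) *v ?\<pi> ((shift ^^ n) \<omega>)" for \<omega> n
    by (subst coding_map_word[where a=a and n=n, OF norm_translation_le[OF a]], subst word_fun_affine) simp
  have rad: "norm (?\<pi> \<omega>) \<le> radius" for \<omega> by (rule norm_coding_le_radius[OF a])
  let ?Y = "\<lambda>n \<omega>. lab (prefix \<omega> n) (?\<pi> \<omega> - word_fun A a (prefix \<omega> n) 0)"
  have "AE \<omega> in \<mu>. \<forall>\<^sub>F n in sequentially. measure \<mu> {\<omega>' \<in> space \<mu>. prefix \<omega>' n = prefix \<omega> n} \<le>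
     (real n + 1)\<^sup>2 * cell_count k (prefix \<omega> n) * measure \<mu> {\<omega>' \<in> space \<mu>. prefix \<omega>' n = prefix \<omega> n \<and> ?Y n \<omega>' = ?Y n \<omega>}"
  proof (rule AE_cell_mass[where L="\<lambda>_. L" and N="\<lambda>_. cell_count k"])
    show "(\<lambda>\<omega>. prefix \<omega> n) \<in> measurable \<mu> (count_space UNIV)" for n unfolding measurable_\<mu> by (rule prefix_measurable)
    show "?Y n \<in> measurable \<mu> (count_space UNIV)" for n
    proof (rule measurable_compose_countable[where f="\<lambda>w \<omega>. lab w (?\<pi> \<omega> - word_fun A a w 0)" and g="\<lambda>\<omega>. prefix \<omega> n"])
      show "(\<lambda>\<omega>. prefix \<omega> n) \<in> measurable \<mu> (count_space UNIV)" unfolding measurable_\<mu> by (rule prefix_measurable)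
      show "(\<lambda>\<omega>. lab w (?\<pi> \<omega> - word_fun A a w 0)) \<in> measurable \<mu> (count_space UNIV)" for w
        using P[of w] by (intro measurable_compose[OF borel_measurable_diff[OF coding_measurable_\<mu>[OF a] borel_measurable_const]]) blast
    qed
    show "finite (L w)" "real (card (L w)) \<le> cell_count k w" for w using P[of w] by blast+
    show "0 < cell_count k w" for w by (rule cell_count_pos[OF k])
    show "?Y n \<omega> \<in> L (prefix \<omega> n)" for n \<omega> unfolding decomp using P[of "prefix \<omega> n"] rad by blast
  qed
  then show ?thesis
  proof (rule AE_mp, intro AE_I2 impI)
    fix \<omega>
    assume "\<forall>\<^sub>F n in sequentially. measure \<mu> {\<omega>' \<in> space \<mu>. prefix \<omega>' n = prefix \<omega> n} \<le>
     (real n + 1)\<^sup>2 * cell_count k (prefix \<omega> n) * measure \<mu> {\<omega>' \<in> space \<mu>. prefix \<omega>' n = prefix \<omega> n \<and> ?Y n \<omega>' = ?Y n \<omega>}"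
    then show "\<forall>\<^sub>F n in sequentially. mass (prefix \<omega> n) \<le> (real n + 1)\<^sup>2 * cell_count k (prefix \<omega> n) *
      ball_prob a \<omega> (2 * real CARD('n) * (1 + 2 * radius) * (sing_vals (word_mat A (prefix \<omega> n)) ! k))"
    proof eventually_elim
      case (elim n)
      let ?w = "prefix \<omega> n"
      let ?C = "{\<omega>' \<in> space \<mu>. prefix \<omega>' n = ?w \<and> ?Y n \<omega>' = ?Y n \<omega>}"
      have "?C \<subseteq> {\<tau>. norm (?\<pi> \<tau> - ?\<pi> \<omega>) < 2 * real CARD('n) * (1 + 2 * radius) * (sing_vals (word_mat A ?w) ! k)}"
      proof safe
        fix \<tau> assume eq: "prefix \<tau> n = ?w" "?Y n \<tau> = ?Y n \<omega>"
        let ?y = "?\<pi> ((shift ^^ n) \<tau>)" and ?y' = "?\<pi> ((shift ^^ n) \<omega>)"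
        have leq: "lab ?w (word_mat A ?w *v ?y) = lab ?w (word_mat A ?w *v ?y')"
          using eq(2) decomp[of \<tau> n] unfolding eq(1) decomp[of \<omega> n] by simp
        define t where "t = real CARD('n) * (1 + 2 * radius) * (sing_vals (word_mat A ?w) ! k)"
        have "norm (word_mat A ?w *v ?y - word_mat A ?w *v ?y') \<le> t"
          using P[of ?w] rad leq unfolding t_def by blast
        moreover have diff: "?\<pi> \<tau> - ?\<pi> \<omega> = word_mat A ?w *v ?y - word_mat A ?w *v ?y'"
          using decomp[of \<tau> n] decomp[of \<omega> n] unfolding eq(1) by (simp add: algebra_simps)
        moreover have "0 < t"
          using radius_nonneg sing_vals_pos[OF invertible_word_mat k, of ?w] by (simp add: t_def)
        ultimately have "norm (?\<pi> \<tau> - ?\<pi> \<omega>) < 2 * t" by simp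
        then show "norm (?\<pi> \<tau> - ?\<pi> \<omega>) < 2 * real CARD('n) * (1 + 2 * radius) * (sing_vals (word_mat A ?w) ! k)"
          by (simp add: t_def mult.assoc)
      qed
      then have "measure \<mu> ?C \<le> ball_prob a \<omega> (2 * real CARD('n) * (1 + 2 * radius) * (sing_vals (word_mat A ?w) ! k))"
        unfolding ball_prob_def by (intro finite_measure_mono ball_set_measurable[OF a])
      then have step: "(real n + 1)\<^sup>2 * cell_count k ?w * measure \<mu> ?C \<le> (real n + 1)\<^sup>2 * cell_count k ?w *
          ball_prob a \<omega> (2 * real CARD('n) * (1 + 2 * radius) * (sing_vals (word_mat A ?w) ! k))"
        using cell_count_pos[OF k, of ?w] by (intro mult_left_mono) auto
      show ?case unfolding mass_prefix by (rule order_trans[OF elim step])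
    qed
  qed
qed

text \<open>The same argument with a single class and cubes of side \<open>(1/2) ^ n\<close>; it
  gives the bound \<open>d\<close> for the dimension, regardless of the pressure.\<close>

lemma AE_cube_lower:
  assumes a: "a \<in> space trans_measure"
  shows "AE \<omega> in \<mu>. \<forall>\<^sub>F n in sequentially. 1 \<le> (real n + 1)\<^sup>2 * ((2 * radius + 2) * 2 ^ n) ^ CARD('n) *
    ball_prob a \<omega> (2 * real CARD('n) * (1/2) ^ n)"
proof -
  let ?\<pi> = "coding_map A a"
  let ?N = "\<lambda>n :: nat. ((2 * radius + 2) * 2 ^ n) ^ CARD('n)"
  obtain u :: "nat \<Rightarrow> real^'n" where u: "orthonormal_family u"
    using ex_adapted_orthonormal_family[of 0 "\<lambda>_. 0 :: real^'n"] by auto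
  have box: "\<forall>l<CARD('n). \<bar>?\<pi> \<omega> \<bullet> u l\<bar> \<le> radius" for \<omega>
  proof (intro allI impI)
    fix l assume l: "l < CARD('n)"
    then show "\<bar>?\<pi> \<omega> \<bullet> u l\<bar> \<le> radius"
      using Cauchy_Schwarz_ineq2[of "?\<pi> \<omega>" "u l"] orthonormal_family_norm[OF u l] norm_coding_le_radius[OF a, of \<omega>] by simp
  qed
  let ?P = "\<lambda>n lab L. finite L \<and> real (card L) \<le> (\<Prod>l<CARD('n). 2 * radius / (1/2) ^ n + 2) \<and>
    lab \<in> measurable (borel :: (real^'n) measure) (count_space (UNIV :: int list set)) \<and>
    (\<forall>p. (\<forall>l<CARD('n). \<bar>p \<bullet> u l\<bar> \<le> radius) \<longrightarrow> lab p \<in> L) \<and>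
    (\<forall>p p'. (\<forall>l<CARD('n). \<bar>p \<bullet> u l\<bar> \<le> radius) \<longrightarrow> (\<forall>l<CARD('n). \<bar>p' \<bullet> u l\<bar> \<le> radius) \<longrightarrow> lab p = lab p' \<longrightarrow>
        norm (p - p') \<le> real CARD('n) * (1 + 2 * 0) * (1/2) ^ n)"
  have "\<exists>lab L. ?P n lab L" for n
    by (rule box_partition[OF u, where B=0 and k="CARD('n)" and a="\<lambda>_. radius" and \<rho>="(1/2) ^ n"])
      (use radius_nonneg in simp_all)
  then have "\<forall>n. \<exists>lab. \<exists>L. ?P n lab L" ..
  from choice[OF this] obtain lab where "\<forall>n. \<exists>L. ?P n (lab n) L" ..
  from choice[OF this] obtain L where "\<forall>n. ?P n (lab n) (L n)" ..
  then have P: "?P n (lab n) (L n)" for n ..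
  have count: "(\<Prod>l<CARD('n). 2 * radius / (1/2) ^ n + 2) \<le> ?N n" for n
  proof -
    have "2 * radius / (1/2) ^ n = 2 * radius * 2 ^ n" by (simp add: power_one_over)
    moreover have "(1::real) \<le> 2 ^ n" by simp
    ultimately have le: "2 * radius / (1/2) ^ n + 2 \<le> (2 * radius + 2) * 2 ^ n"
      unfolding distrib_right by linarith
    have "0 \<le> 2 * radius / (1/2) ^ n + 2" using radius_nonneg by simp
    from power_mono[OF le this] show ?thesis unfolding prod_constant card_lessThan .
  qed
  have "AE \<omega> in \<mu>. \<forall>\<^sub>F n in sequentially. measure \<mu> {\<omega>' \<in> space \<mu>. () = ()} \<le>
     (real n + 1)\<^sup>2 * ?N n * measure \<mu> {\<omega>' \<in> space \<mu>. () = () \<and> lab n (?\<pi> \<omega>') = lab n (?\<pi> \<omega>)}"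
  proof (rule AE_cell_mass[where X="\<lambda>_ _. ()" and L="\<lambda>n _. L n" and N="\<lambda>n _. ?N n"])
    show "(\<lambda>\<omega>. lab n (?\<pi> \<omega>)) \<in> measurable \<mu> (count_space UNIV)" for n
      using P[of n] by (intro measurable_compose[OF coding_measurable_\<mu>[OF a]]) blast
    show "finite (L n)" for n using P[of n] by blast
    show "real (card (L n)) \<le> ?N n" for n using P[of n] count[of n] by linarith
    show "0 < ?N n" for n
    proof -
      have "0 < 2 * radius + 2" using radius_nonneg by linarith
      then show ?thesis by simp
    qed
    show "lab n (?\<pi> \<omega>) \<in> L n" for n \<omega> using P[of n] box by blast
  qed simp
  then show ?thesis
  proof (rule AE_mp, intro AE_I2 impI)
    fix \<omega>
    assume "\<forall>\<^sub>F n in sequentially. measure \<mu> {\<omega>' \<in> space \<mu>. () = ()} \<le>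
     (real n + 1)\<^sup>2 * ?N n * measure \<mu> {\<omega>' \<in> space \<mu>. () = () \<and> lab n (?\<pi> \<omega>') = lab n (?\<pi> \<omega>)}"
    then show "\<forall>\<^sub>F n in sequentially. 1 \<le> (real n + 1)\<^sup>2 * ?N n * ball_prob a \<omega> (2 * real CARD('n) * (1/2) ^ n)"
    proof eventually_elim
      case (elim n)
      let ?C = "{\<omega>' \<in> space \<mu>. () = () \<and> lab n (?\<pi> \<omega>') = lab n (?\<pi> \<omega>)}"
      have "?C \<subseteq> {\<tau>. norm (?\<pi> \<tau> - ?\<pi> \<omega>) < 2 * real CARD('n) * (1/2) ^ n}"
      proof safe
        fix \<tau> assume "lab n (?\<pi> \<tau>) = lab n (?\<pi> \<omega>)"
        then have "norm (?\<pi> \<tau> - ?\<pi> \<omega>) \<le> real CARD('n) * (1 + 2 * 0) * (1/2) ^ n"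
          using P[of n] box by blast
        moreover define t where "t = real CARD('n) * (1/2::real) ^ n"
        ultimately have "norm (?\<pi> \<tau> - ?\<pi> \<omega>) \<le> t" by simp
        moreover have "0 < t" by (simp add: t_def)
        ultimately have "norm (?\<pi> \<tau> - ?\<pi> \<omega>) < 2 * t" by linarith
        then show "norm (?\<pi> \<tau> - ?\<pi> \<omega>) < 2 * real CARD('n) * (1/2) ^ n" by (simp add: t_def mult.assoc)
      qed
      then have "measure \<mu> ?C \<le> ball_prob a \<omega> (2 * real CARD('n) * (1/2) ^ n)"
        unfolding ball_prob_def by (intro finite_measure_mono ball_set_measurable[OF a])
      then have "(real n + 1)\<^sup>2 * ?N n * measure \<mu> ?C \<le> (real n + 1)\<^sup>2 * ?N n * ball_prob a \<omega> (2 * real CARD('n) * (1/2) ^ n)"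
        by (rule mult_left_mono) (use radius_nonneg in simp)
      moreover have "measure \<mu> {\<omega>' \<in> space \<mu>. () = ()} = 1" using prob_space by simp
      ultimately show ?case using elim by linarith
    qed
  qed
qed

end

section \<open>Pressure\<close>

text \<open>Rates may be minus infinity but never plus infinity, so the indeterminate sum cannot
  occur.\<close>

lemma ereal_tendsto_add:
  fixes a b :: "nat \<Rightarrow> real"
  assumes a: "(\<lambda>n. ereal (a n)) \<longlonglongrightarrow> x" and b: "(\<lambda>n. ereal (b n)) \<longlonglongrightarrow> y" and fin: "x \<noteq> \<infinity>" "y \<noteq> \<infinity>"
  shows "(\<lambda>n. ereal (a n + b n)) \<longlonglongrightarrow> x + y"
proof -
  have "(\<lambda>n. - ereal (a n) + - ereal (b n)) \<longlonglongrightarrow> - x + - y"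
    using fin by (intro tendsto_add_ereal_nonneg tendsto_uminus_ereal a b) (auto simp: ereal_uminus_eq_reorder)
  then have "(\<lambda>n. - (- ereal (a n) + - ereal (b n))) \<longlonglongrightarrow> - (- x + - y)" by (rule tendsto_uminus_ereal)
  moreover have "- (- x + - y) = x + y" using fin by (cases x; cases y) auto
  ultimately show ?thesis by (simp add: algebra_simps)
qed

lemma ereal_tendsto_mult:
  fixes a :: "nat \<Rightarrow> real"
  assumes a: "(\<lambda>n. ereal (a n)) \<longlonglongrightarrow> x"
  shows "(\<lambda>n. ereal (r * a n)) \<longlonglongrightarrow> ereal r * x"
  using tendsto_cmult_ereal[OF _ a, of "ereal r"] by simp

context ifs_measure
begin

definition log_growth :: "nat \<Rightarrow> 'i list \<Rightarrow> real" where
  "log_growth k w = ln (sv_prod k (word_mat A w))"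

lemma log_growth_append:
  assumes k: "k \<le> CARD('n)"
  shows "log_growth k (u @ v) \<le> ln ((fact CARD('n))\<^sup>2) + log_growth k u + log_growth k v"
proof -
  note pos = sv_prod_pos[OF invertible_word_mat k]
  have "sv_prod k (word_mat A (u @ v)) \<le> (fact CARD('n))\<^sup>2 * sv_prod k (word_mat A u) * sv_prod k (word_mat A v)"
    unfolding word_mat_append by (rule sv_prod_mult_le[OF invertible_word_mat invertible_word_mat k])
  then have "log_growth k (u @ v) \<le> ln ((fact CARD('n))\<^sup>2 * sv_prod k (word_mat A u) * sv_prod k (word_mat A v))"
    unfolding log_growth_def using pos by (intro ln_mono)
  also have "\<dots> = ln ((fact CARD('n))\<^sup>2) + log_growth k u + log_growth k v"
    unfolding log_growth_def using pos[of u] pos[of v] by (subst ln_mult_pos, simp, simp, subst ln_mult_pos) auto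
  finally show ?thesis .
qed

lemma log_growth_sum: "k \<le> CARD('n) \<Longrightarrow> log_growth k w = (\<Sum>l<k. ln (sing_vals (word_mat A w) ! l))"
  unfolding log_growth_def by (rule ln_sv_prod[OF invertible_word_mat])

lemma log_growth_Suc:
  assumes "k < CARD('n)"
  shows "log_growth (Suc k) w = log_growth k w + ln (sing_vals (word_mat A w) ! k)"
  using assms by (simp add: log_growth_sum)

lemma log_growth_nonpos: "k \<le> CARD('n) \<Longrightarrow> log_growth k w \<le> 0"
  using ln_sing_vals_word_nonpos by (auto simp: log_growth_sum intro!: sum_nonpos)

definition growth_rate :: "nat \<Rightarrow> (nat \<Rightarrow> 'i) \<Rightarrow> ereal" where
  "growth_rate k = lower_rate (log_growth k)"

text \<open>The full-measure set of sequences for which all limits exist. The statements about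
  pressure below are deterministic on it.\<close>

definition regular :: "(nat \<Rightarrow> 'i) \<Rightarrow> bool" where
  "regular \<omega> \<longleftrightarrow> (\<forall>n. 0 < mass (prefix \<omega> n)) \<and>
    (\<lambda>n. ereal (- ln (mass (prefix \<omega> n)) / n)) \<longlonglongrightarrow> lower_entropy \<omega> \<and> lower_entropy \<omega> < \<infinity> \<and>
    (\<forall>k\<le>CARD('n). (\<lambda>n. ereal (log_growth k (prefix \<omega> n) / n)) \<longlonglongrightarrow> growth_rate k \<omega>)"

lemma regular_mass_rate_nonneg:
  assumes "regular \<omega>"
  shows "0 \<le> - ln (mass (prefix \<omega> n)) / real n"
proof -
  have "0 < mass (prefix \<omega> n)" using assms by (auto simp: regular_def)
  then have "0 \<le> - ln (mass (prefix \<omega> n))" by simp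
  then show ?thesis by (rule divide_nonneg_nonneg) simp
qed

lemma AE_regular:
  assumes "Defs.entropy \<mu> < \<infinity>"
  shows "AE \<omega> in \<mu>. regular \<omega>"
proof -
  have "AE \<omega> in \<mu>. k \<le> CARD('n) \<longrightarrow> (\<lambda>n. ereal (log_growth k (prefix \<omega> n) / n)) \<longlonglongrightarrow> growth_rate k \<omega>" for k
  proof (cases "k \<le> CARD('n)")
    case True
    from subadditive_rate[OF log_growth_append[OF True] log_growth_nonpos[OF True]]
    show ?thesis unfolding growth_rate_def by (rule AE_mp) (auto intro!: AE_I2)
  qed simp
  then have "AE \<omega> in \<mu>. \<forall>k. k \<le> CARD('n) \<longrightarrow> (\<lambda>n. ereal (log_growth k (prefix \<omega> n) / n)) \<longlonglongrightarrow> growth_rate k \<omega>"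
    unfolding AE_all_countable by blast
  with AE_mass_pos shannon_mcmillan_breiman[OF assms] show ?thesis
    by eventually_elim (auto simp: regular_def)
qed

lemma regular_entropy:
  assumes "regular \<omega>"
  obtains h where "0 \<le> h" "lower_entropy \<omega> = ereal h" "(\<lambda>n. - ln (mass (prefix \<omega> n)) / n) \<longlonglongrightarrow> h"
proof -
  have lim: "(\<lambda>n. ereal (- ln (mass (prefix \<omega> n)) / n)) \<longlonglongrightarrow> lower_entropy \<omega>" and fin: "lower_entropy \<omega> < \<infinity>"
    and pos: "\<And>n. 0 < mass (prefix \<omega> n)"
    using assms by (auto simp: regular_def)
  have "0 \<le> ereal (- ln (mass (prefix \<omega> n)) / n)" for n
    using regular_mass_rate_nonneg[OF assms, of n] by (simp only: ereal_less_eq(5))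
  then have "0 \<le> lower_entropy \<omega>" using lim by (intro LIMSEQ_le_const[OF lim]) auto
  then obtain h where h: "lower_entropy \<omega> = ereal h" "0 \<le> h" using fin by (cases "lower_entropy \<omega>") auto
  then show thesis using that lim by simp
qed

lemma regular_growth:
  assumes "regular \<omega>" "k \<le> CARD('n)"
  shows "(\<lambda>n. ereal (log_growth k (prefix \<omega> n) / n)) \<longlonglongrightarrow> growth_rate k \<omega>" "growth_rate k \<omega> \<le> 0"
proof -
  show lim: "(\<lambda>n. ereal (log_growth k (prefix \<omega> n) / n)) \<longlonglongrightarrow> growth_rate k \<omega>"
    using assms by (auto simp: regular_def)
  have "ereal (log_growth k (prefix \<omega> n) / n) \<le> 0" for n
    using log_growth_nonpos[OF assms(2), of "prefix \<omega> n"] by (simp add: divide_nonpos_nonneg)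
  then show "growth_rate k \<omega> \<le> 0" by (intro LIMSEQ_le_const2[OF lim]) auto
qed

text \<open>Interpolates linearly between the growth rates. At an integer below the dimension the
  second coefficient is 0, and since \<open>0 * (- \<infinity>) = 0\<close> in \<open>ereal\<close>
  the value is right even if the next rate is minus infinity.\<close>

definition energy :: "(nat \<Rightarrow> ereal) \<Rightarrow> real \<Rightarrow> ereal" where
  "energy L s = (if s < real CARD('n) then
     ereal (real (nat \<lfloor>s\<rfloor>) + 1 - s) * L (nat \<lfloor>s\<rfloor>) + ereal (s - real (nat \<lfloor>s\<rfloor>)) * L (Suc (nat \<lfloor>s\<rfloor>))
     else ereal (s / real CARD('n)) * L CARD('n))"

lemma ereal_mult_nonpos_finite: "0 \<le> r \<Longrightarrow> x \<le> 0 \<Longrightarrow> ereal r * x \<noteq> \<infinity>"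
  by (cases x) (auto simp: ereal_mult_eq_PInfty)

lemma energy_limit:
  assumes reg: "regular \<omega>" and s: "0 \<le> s"
  shows "(\<lambda>n. ereal (ln (sv_fun s (word_mat A (prefix \<omega> n))) / n)) \<longlonglongrightarrow> energy (\<lambda>k. growth_rate k \<omega>) s"
    "energy (\<lambda>k. growth_rate k \<omega>) s \<noteq> \<infinity>"
proof -
  let ?L = "\<lambda>k. growth_rate k \<omega>"
  have "(\<lambda>n. ereal (ln (sv_fun s (word_mat A (prefix \<omega> n))) / n)) \<longlonglongrightarrow> energy ?L s \<and> energy ?L s \<noteq> \<infinity>"
  proof (cases "s < real CARD('n)")
    case True
    define k where "k = nat \<lfloor>s\<rfloor>"
    have ks: "real k \<le> s" "s \<le> real k + 1" using nat_floor_bounds[OF s] by (auto simp: k_def)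
    then have k: "k < CARD('n)" using True by linarith
    have e: "energy ?L s = ereal (real k + 1 - s) * ?L k + ereal (s - real k) * ?L (Suc k)"
      using True by (simp add: energy_def k_def)
    have f1: "ereal (real k + 1 - s) * ?L k \<noteq> \<infinity>"
      using ks k by (intro ereal_mult_nonpos_finite regular_growth(2)[OF reg]) auto
    have f2: "ereal (s - real k) * ?L (Suc k) \<noteq> \<infinity>"
      using ks k by (intro ereal_mult_nonpos_finite regular_growth(2)[OF reg]) auto
    have "(\<lambda>n. ereal ((real k + 1 - s) * (log_growth k (prefix \<omega> n) / n) + (s - real k) * (log_growth (Suc k) (prefix \<omega> n) / n)))
        \<longlonglongrightarrow> ereal (real k + 1 - s) * ?L k + ereal (s - real k) * ?L (Suc k)"
      using k by (intro ereal_tendsto_add ereal_tendsto_mult regular_growth(1)[OF reg] f1 f2) auto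
    also have "(\<lambda>n. ereal ((real k + 1 - s) * (log_growth k (prefix \<omega> n) / n) + (s - real k) * (log_growth (Suc k) (prefix \<omega> n) / n)))
       = (\<lambda>n. ereal (ln (sv_fun s (word_mat A (prefix \<omega> n))) / n))"
      unfolding ln_sv_fun_interpolation[OF invertible_word_mat ks k True] log_growth_def
      by (simp add: add_divide_distrib)
    finally show ?thesis using f1 f2 unfolding e by simp
  next
    case False
    then have sd: "real CARD('n) \<le> s" by simp
    have e: "energy ?L s = ereal (s / real CARD('n)) * ?L CARD('n)" using False by (simp add: energy_def)
    have "(\<lambda>n. ereal ((s / real CARD('n)) * (log_growth CARD('n) (prefix \<omega> n) / n))) \<longlonglongrightarrow> energy ?L s"
      unfolding e by (intro ereal_tendsto_mult regular_growth(1)[OF reg]) simp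
    moreover have "energy ?L s \<noteq> \<infinity>" unfolding e
      using s by (intro ereal_mult_nonpos_finite regular_growth(2)[OF reg]) auto
    ultimately show ?thesis
      unfolding sv_fun_large(2)[OF invertible_word_mat sd] log_growth_def by simp
  qed
  then show "(\<lambda>n. ereal (ln (sv_fun s (word_mat A (prefix \<omega> n))) / n)) \<longlonglongrightarrow> energy ?L s" "energy ?L s \<noteq> \<infinity>" by blast+
qed

definition pressure_rate :: "real \<Rightarrow> nat \<Rightarrow> (nat \<Rightarrow> 'i) \<Rightarrow> real" where
  "pressure_rate s n \<omega> = - ln (mass (prefix \<omega> n)) / n + ln (sv_fun s (word_mat A (prefix \<omega> n))) / n"

text \<open>\<open>pressure\<close> is written with \<open>lim\<close>, which says nothing unless
  the limit exists; on regular sequences it does. The second part shows that the pressure depends on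
  \<omega> only through finitely many invariant quantities.\<close>

lemma pressure_limit:
  assumes reg: "regular \<omega>" and s: "0 \<le> s"
  shows "(\<lambda>n. ereal (pressure_rate s n \<omega>)) \<longlonglongrightarrow> pressure \<mu> A s \<omega>"
    "pressure \<mu> A s \<omega> = lower_entropy \<omega> + energy (\<lambda>k. growth_rate k \<omega>) s"
proof -
  obtain h where h: "0 \<le> h" "lower_entropy \<omega> = ereal h" "(\<lambda>n. - ln (mass (prefix \<omega> n)) / n) \<longlonglongrightarrow> h"
    by (rule regular_entropy[OF reg])
  have "(\<lambda>n. ereal (- ln (mass (prefix \<omega> n)) / n)) \<longlonglongrightarrow> lower_entropy \<omega>" "lower_entropy \<omega> \<noteq> \<infinity>"
    using reg by (auto simp: regular_def)
  from ereal_tendsto_add[OF this(1) energy_limit(1)[OF reg s] this(2) energy_limit(2)[OF reg s]]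
  have lim: "(\<lambda>n. ereal (pressure_rate s n \<omega>)) \<longlonglongrightarrow> lower_entropy \<omega> + energy (\<lambda>k. growth_rate k \<omega>) s"
    unfolding pressure_rate_def .
  have "ereal (ln (measure \<mu> (cyl (prefix \<omega> n)) / sv_fun s (word_mat A (prefix \<omega> n))) / real n) = - ereal (pressure_rate s n \<omega>)" for n
  proof -
    have "0 < mass (prefix \<omega> n)" using reg by (auto simp: regular_def)
    moreover have "0 < sv_fun s (word_mat A (prefix \<omega> n))" by (rule sv_fun_pos[OF invertible_word_mat s])
    ultimately show ?thesis
      by (simp add: mass_def[symmetric] pressure_rate_def ln_div diff_divide_distrib)
  qed
  then have "pressure \<mu> A s \<omega> = - lim (\<lambda>n. - ereal (pressure_rate s n \<omega>))" by (simp only: pressure_def)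
  also have "lim (\<lambda>n. - ereal (pressure_rate s n \<omega>)) = - (lower_entropy \<omega> + energy (\<lambda>k. growth_rate k \<omega>) s)"
    by (rule limI[OF tendsto_uminus_ereal[OF lim]])
  finally show eq: "pressure \<mu> A s \<omega> = lower_entropy \<omega> + energy (\<lambda>k. growth_rate k \<omega>) s" by simp
  show "(\<lambda>n. ereal (pressure_rate s n \<omega>)) \<longlonglongrightarrow> pressure \<mu> A s \<omega>" unfolding eq by (rule lim)
qed

section \<open>Decay and monotonicity of the pressure in the exponent\<close>

lemma ln_sv_fun_decay:
  assumes s: "0 \<le> s" "s \<le> t" "t < real CARD('n)"
  shows "ln (sv_fun t (word_mat A w)) \<le> ln (sv_fun s (word_mat A w)) + (t - s) * (real (length w) * ln c)"
proof -
  let ?a = "\<lambda>l. ln (sing_vals (word_mat A w) ! l)"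
  have t0: "0 \<le> t" and sd: "s < real CARD('n)" using s by auto
  have "ln (sv_fun t (word_mat A w)) - ln (sv_fun s (word_mat A w)) = (\<Sum>l<CARD('n). (sv_weight t l - sv_weight s l) * ?a l)"
    unfolding sv_fun_small(2)[OF invertible_word_mat t0 s(3)] sv_fun_small(2)[OF invertible_word_mat s(1) sd]
    by (simp add: left_diff_distrib sum_subtractf)
  also have "\<dots> \<le> (\<Sum>l<CARD('n). (sv_weight t l - sv_weight s l) * (real (length w) * ln c))"
    using sv_weight_mono[OF s(2)] ln_sing_vals_word_le by (intro sum_mono mult_left_mono) auto
  also have "\<dots> = (t - s) * (real (length w) * ln c)"
    unfolding sum_distrib_right[symmetric] sum_subtractf sv_weight_sum[OF t0 s(3)] sv_weight_sum[OF s(1) sd] ..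
  finally show ?thesis by simp
qed

text \<open>Every singular value is at most \<open>c ^ n\<close>, so raising the exponent by
  \<open>t - s\<close> costs at least \<open>(t - s) * ln c\<close> per step. Hence nonnegative
  pressure at one exponent below \<open>d\<close> is strictly positive pressure at smaller
  ones.\<close>

lemma pressure_decay:
  assumes reg: "regular \<omega>" and s: "0 \<le> s" "s \<le> t" "t < real CARD('n)"
  shows "pressure \<mu> A t \<omega> \<le> pressure \<mu> A s \<omega> + ereal ((t - s) * ln c)"
proof (rule LIMSEQ_le[OF pressure_limit(1)[OF reg]])
  show "0 \<le> t" using s by simp
  have "pressure \<mu> A s \<omega> \<noteq> \<infinity>"
  proof -
    obtain h where "lower_entropy \<omega> = ereal h" by (rule regular_entropy[OF reg])
    then show ?thesis using pressure_limit(2)[OF reg s(1)] energy_limit(2)[OF reg s(1)] by simp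
  qed
  then show "(\<lambda>n. ereal (pressure_rate s n \<omega> + (t - s) * ln c)) \<longlonglongrightarrow> pressure \<mu> A s \<omega> + ereal ((t - s) * ln c)"
    by (intro ereal_tendsto_add pressure_limit(1)[OF reg s(1)]) auto
  show "\<exists>N. \<forall>n\<ge>N. ereal (pressure_rate t n \<omega>) \<le> ereal (pressure_rate s n \<omega> + (t - s) * ln c)"
  proof (intro exI[of _ 1] allI impI)
    fix n :: nat assume n: "1 \<le> n"
    have "ln (sv_fun t (word_mat A (prefix \<omega> n))) / n \<le> (ln (sv_fun s (word_mat A (prefix \<omega> n))) + (t - s) * (real n * ln c)) / n"
      using ln_sv_fun_decay[OF s, of "prefix \<omega> n"] by (intro divide_right_mono) auto
    then show "ereal (pressure_rate t n \<omega>) \<le> ereal (pressure_rate s n \<omega> + (t - s) * ln c)"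
      using n by (simp add: pressure_rate_def add_divide_distrib)
  qed
qed

text \<open>\<open>t\<close> may exceed the dimension, where \<open>sv_fun\<close> has a different
  formula; there both sides are compared with the product of all singular values.\<close>

lemma pressure_antimono:
  assumes reg: "regular \<omega>" and s: "0 \<le> s" "s \<le> t" "s < real CARD('n)"
  shows "pressure \<mu> A t \<omega> \<le> pressure \<mu> A s \<omega>"
proof (cases "t < real CARD('n)")
  case True
  have "pressure \<mu> A t \<omega> \<le> pressure \<mu> A s \<omega> + ereal ((t - s) * ln c)"
    by (rule pressure_decay[OF reg s(1,2) True])
  also have "\<dots> \<le> pressure \<mu> A s \<omega> + 0"
    using s ln_c_neg by (intro add_left_mono) (simp add: mult_nonneg_nonpos)
  finally show ?thesis by simp
next
  case False
  then have t: "real CARD('n) \<le> t" by simp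
  have le: "ln (sv_fun t (word_mat A w)) \<le> ln (sv_fun s (word_mat A w))" for w
  proof -
    let ?a = "\<lambda>l. ln (sing_vals (word_mat A w) ! l)"
    have "ln (sv_fun t (word_mat A w)) = (t / real CARD('n)) * log_growth CARD('n) w"
      unfolding sv_fun_large(2)[OF invertible_word_mat t] log_growth_def ..
    also have "\<dots> \<le> 1 * log_growth CARD('n) w"
      using t log_growth_nonpos[of "CARD('n)" w] by (intro mult_right_mono_neg) auto
    also have "\<dots> = (\<Sum>l<CARD('n). 1 * ?a l)" by (simp add: log_growth_sum)
    also have "\<dots> \<le> (\<Sum>l<CARD('n). sv_weight s l * ?a l)"
      using ln_sing_vals_word_nonpos sv_weight_range(2) by (intro sum_mono mult_right_mono_neg) auto
    also have "\<dots> = ln (sv_fun s (word_mat A w))"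
      by (rule sv_fun_small(2)[OF invertible_word_mat s(1,3), symmetric])
    finally show ?thesis .
  qed
  show ?thesis
  proof (rule LIMSEQ_le[OF pressure_limit(1)[OF reg] pressure_limit(1)[OF reg s(1)]])
    show "0 \<le> t" using s by simp
    show "\<exists>N. \<forall>n\<ge>N. ereal (pressure_rate t n \<omega>) \<le> ereal (pressure_rate s n \<omega>)"
      using le by (auto simp: pressure_rate_def divide_right_mono)
  qed
qed

text \<open>At exponent 0 the singular value function is 1 and only the entropy term remains. So an
  exponent with negative pressure is positive.\<close>

lemma pressure_0_nonneg:
  assumes reg: "regular \<omega>"
  shows "0 \<le> pressure \<mu> A 0 \<omega>"
proof (rule LIMSEQ_le_const[OF pressure_limit(1)[OF reg order_refl]])
  have "ln (sv_fun 0 (word_mat A w)) = 0" for w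
    by (subst sv_fun_small(2)[OF invertible_word_mat]) (auto simp: sv_weight_def)
  moreover have "0 \<le> - ln (mass (prefix \<omega> n)) / n" for n by (rule regular_mass_rate_nonneg[OF reg])
  ultimately show "\<exists>N. \<forall>n\<ge>N. 0 \<le> ereal (pressure_rate 0 n \<omega>)" by (simp only: pressure_rate_def div_0 add_0_right ereal_less_eq(5)) blast
qed

text \<open>Below \<open>D\<close> the pressure is strictly positive, so the series in
  \<open>mass_bound\<close> is dominated by a geometric one. The quadratic factor is absorbed by a
  rational exponent \<open>t\<close> strictly between \<open>q\<close> and \<open>D\<close>.\<close>

lemma ball_prob_upper:
  assumes reg: "regular \<omega>" and a: "a \<in> space trans_measure"
    and mass_bound: "\<forall>q::rat. 0 \<le> q \<longrightarrow> real_of_rat q < real CARD('n) \<longrightarrow>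
     (\<Sum>n. ennreal (mass (prefix \<omega> n) / sv_fun (real_of_rat q) (word_mat A (prefix \<omega> n)))) < \<infinity> \<longrightarrow>
     (\<exists>N. \<forall>m\<ge>N. ball_mass a \<omega> ((1/2) ^ m) \<le> ennreal ((real m + 1)\<^sup>2 * ((1/2) ^ m) powr real_of_rat q))"
    and D: "D \<le> real CARD('n)" "\<And>s. 0 \<le> s \<Longrightarrow> s < D \<Longrightarrow> 0 \<le> pressure \<mu> A s \<omega>" and q: "q < D"
  shows "\<forall>\<^sub>F m in sequentially. ball_prob a \<omega> ((1/2) ^ m) \<le> ((1/2) ^ m) powr q"
proof (cases "q < 0")
  case True
  have "ball_prob a \<omega> ((1/2) ^ m) \<le> ((1/2) ^ m) powr q" for m
  proof -
    have "ball_prob a \<omega> ((1/2) ^ m) \<le> 1" by (simp add: ball_prob_def)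
    also have "(1::real) \<le> ((1/2) ^ m) powr q"
      using True by (simp add: powr_def ln_half_power mult_nonpos_nonneg)
    finally show ?thesis .
  qed
  then show ?thesis by simp
next
  case False
  obtain t where t: "q < real_of_rat t" "real_of_rat t < D" using of_rat_dense[OF q] by blast
  let ?t = "real_of_rat t"
  have t0': "0 \<le> ?t" using False t(1) by linarith
  then have t0: "0 \<le> ?t" "0 \<le> t" by simp_all
  have td: "?t < real CARD('n)" using t D by simp
  \<comment> \<open>Nonnegative pressure at \<open>t'\<close>, half-way between \<open>t\<close> and
    \<open>D\<close>, gives pressure at least 2 \<delta> at \<open>t\<close>; half of it is kept as
    the rate of decay of the summands.\<close>
  define t' where "t' = (?t + D) / 2"
  have t': "?t < t'" "t' < D" using t(2) by (auto simp: t'_def)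
  define \<delta> where "\<delta> = - ((t' - ?t) * ln c) / 2"
  have \<delta>: "0 < \<delta>" using t'(1) ln_c_neg by (simp add: \<delta>_def mult_pos_neg)
  have "0 \<le> t'" using t' t0' by linarith
  then have "0 \<le> pressure \<mu> A t' \<omega>" using t' by (intro D(2))
  also have "\<dots> \<le> pressure \<mu> A ?t \<omega> + ereal ((t' - ?t) * ln c)"
    using t' t0 D(1) by (intro pressure_decay[OF reg]) auto
  finally have "0 \<le> pressure \<mu> A ?t \<omega> + ereal (- 2 * \<delta>)" by (simp add: \<delta>_def)
  then have "ereal \<delta> < pressure \<mu> A ?t \<omega>" using \<delta> by (cases "pressure \<mu> A ?t \<omega>") auto
  with pressure_limit(1)[OF reg t0(1)] have "\<forall>\<^sub>F n in sequentially. ereal \<delta> < ereal (pressure_rate ?t n \<omega>)"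
    by (rule order_tendstoD)
  then have ev: "\<forall>\<^sub>F n in sequentially. norm (mass (prefix \<omega> n) / sv_fun ?t (word_mat A (prefix \<omega> n))) \<le> exp (- \<delta>) ^ n"
    using eventually_gt_at_top[of 0]
  proof eventually_elim
    case (elim n)
    let ?x = "mass (prefix \<omega> n)" and ?y = "sv_fun ?t (word_mat A (prefix \<omega> n))"
    have x: "0 < ?x" using reg by (auto simp: regular_def)
    have y: "0 < ?y" by (rule sv_fun_pos[OF invertible_word_mat t0(1)])
    have "\<delta> < (ln ?y - ln ?x) / n" using elim(1) by (simp add: pressure_rate_def diff_divide_distrib)
    then have "ln ?x - ln ?y \<le> - (\<delta> * n)" using elim(2) by (simp add: field_simps)
    then have "ln (?x / ?y) \<le> - (\<delta> * n)" using x y by (simp add: ln_div)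
    then have "exp (ln (?x / ?y)) \<le> exp (- (\<delta> * n))" by simp
    then have "?x / ?y \<le> exp (- \<delta>) ^ n" using x y by (simp add: exp_of_nat_mult[symmetric] mult.commute)
    then show ?case using x y by simp
  qed
  have "summable (\<lambda>n. mass (prefix \<omega> n) / sv_fun ?t (word_mat A (prefix \<omega> n)))"
    by (rule summable_comparison_test_ev[OF ev]) (use \<delta> in \<open>auto intro: summable_geometric\<close>)
  then have "(\<Sum>n. ennreal (mass (prefix \<omega> n) / sv_fun ?t (word_mat A (prefix \<omega> n)))) =
      ennreal (\<Sum>n. mass (prefix \<omega> n) / sv_fun ?t (word_mat A (prefix \<omega> n)))"
    using sv_fun_pos[OF invertible_word_mat t0(1)] by (intro suminf_ennreal2) (auto intro!: divide_nonneg_pos)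
  then have "(\<Sum>n. ennreal (mass (prefix \<omega> n) / sv_fun ?t (word_mat A (prefix \<omega> n)))) < \<infinity>" by simp
  then have "\<exists>N. \<forall>m\<ge>N. ball_mass a \<omega> ((1/2) ^ m) \<le> ennreal ((real m + 1)\<^sup>2 * ((1/2) ^ m) powr ?t)"
    using mass_bound t0(2) td by blast
  then have "\<forall>\<^sub>F m in sequentially. ball_mass a \<omega> ((1/2) ^ m) \<le> ennreal ((real m + 1)\<^sup>2 * ((1/2) ^ m) powr ?t)"
    unfolding eventually_sequentially .
  moreover have "\<forall>\<^sub>F m in sequentially. 2 * ln (real m + 1) \<le> ((?t - q) * ln 2) * real m"
    using t(1) by (intro eventually_ln_le_linear) simp
  ultimately show ?thesis
  proof eventually_elim
    case (elim m)
    have "ball_prob a \<omega> ((1/2) ^ m) \<le> (real m + 1)\<^sup>2 * ((1/2) ^ m) powr ?t"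
      by (rule ball_prob_le_of_ball_mass[OF a elim(1)]) simp
    also have "(real m + 1)\<^sup>2 = exp (2 * ln (real m + 1))"
      using exp_of_nat_mult[of 2 "ln (real m + 1)"] by (simp add: mult.commute)
    also have "exp (2 * ln (real m + 1)) * ((1/2) ^ m) powr ?t \<le> exp (((?t - q) * ln 2) * real m) * ((1/2) ^ m) powr ?t"
      using elim(2) by (intro mult_right_mono) auto
    also have "\<dots> = ((1/2) ^ m) powr q"
      by (simp add: powr_def ln_half_power exp_add[symmetric] algebra_simps)
    finally show ?case .
  qed
qed


lemma cube_lower_bound:
  assumes a: "a \<in> space trans_measure"
    and cube: "\<forall>\<^sub>F n in sequentially. 1 \<le> (real n + 1)\<^sup>2 * ((2 * radius + 2) * 2 ^ n) ^ CARD('n) *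
      ball_prob a \<omega> (2 * real CARD('n) * (1/2) ^ n)"
    and q: "real CARD('n) < q"
  shows "\<forall>\<^sub>F m in sequentially. ((1/2) ^ m) powr q \<le> ball_prob a \<omega> ((1/2) ^ m)"
proof -
  let ?d = "real CARD('n)"
  define s where "s = (?d + q) / 2"
  have s: "0 \<le> s" "s < q" "?d < s" using q by (auto simp: s_def)
  \<comment> \<open>Half of the exponential gain \<open>(s - d) * ln 2\<close>: one \<open>e\<close>
    absorbs the factor \<open>(n + 1)^2\<close>, the other the constant
    \<open>C ^ d\<close>.\<close>
  define e where "e = (s - ?d) * ln 2 / 2"
  have e: "0 < e" using s by (simp add: e_def)
  define C where "C = 2 * radius + 2"
  have C: "0 < C" using radius_nonneg by (simp add: C_def)
  have "(\<lambda>n. - ln (2 * ?d) / n + ln 2) \<longlonglongrightarrow> 0 + ln 2" by (intro tendsto_add lim_const_over_n tendsto_const)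
  then have lim: "(\<lambda>n. - ln (2 * ?d) / n + ln 2) \<longlonglongrightarrow> ln 2" by simp
  have "\<forall>\<^sub>F n in sequentially. - ln (2 * ?d) / real n + ln 2 = - ln (2 * ?d * (1/2) ^ n) / real n"
    using eventually_gt_at_top[of 0]
  proof eventually_elim
    case (elim n)
    have "ln (2 * ?d * (1/2) ^ n) = ln (2 * ?d) - real n * ln 2"
      by (subst ln_mult_pos) (auto simp: ln_half_power)
    then show ?case using elim by (simp add: diff_divide_distrib)
  qed
  with lim have lim': "(\<lambda>n. - ln (2 * ?d * (1/2) ^ n) / real n) \<longlonglongrightarrow> ln 2"
    by (rule Lim_transform_eventually)
  obtain N :: nat where N: "?d * ln C / e \<le> real N" using real_arch_simple by blast
  have "\<forall>\<^sub>F n in sequentially. exp (- (s * ln 2 * n)) \<le> ball_prob a \<omega> (2 * ?d * (1/2) ^ n)"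
    using cube eventually_ln_le_linear[OF e] eventually_ge_at_top[of N]
  proof eventually_elim
    case (elim n)
    let ?\<beta> = "ball_prob a \<omega> (2 * ?d * (1/2) ^ n)"
    have "?d * ln C \<le> e * real n"
    proof -
      have "?d * ln C / e \<le> real n" using N elim(3) by linarith
      then show ?thesis using e by (simp add: divide_le_eq mult.commute)
    qed
    moreover have "2 * (e * real n) = s * ln 2 * n - ?d * ln 2 * n"
    proof -
      have "2 * e = (s - ?d) * ln 2" by (simp add: e_def)
      then have "2 * (e * real n) = (s - ?d) * ln 2 * n" by simp
      then show ?thesis by (simp add: algebra_simps)
    qed
    ultimately have le: "2 * ln (real n + 1) + (?d * ln C + ?d * (n * ln 2)) \<le> s * ln 2 * n"
      using elim(2) by (simp add: algebra_simps)
    let ?K = "(real n + 1)\<^sup>2 * (C * 2 ^ n) ^ CARD('n)"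
    have K: "0 < ?K" using C by simp
    have "ln ?K = 2 * ln (real n + 1) + (?d * ln C + ?d * (n * ln 2))"
      using C by (simp add: ln_mult_pos ln_realpow algebra_simps)
    then have "?K \<le> exp (s * ln 2 * n)" using le K by (metis exp_le_cancel_iff exp_ln)
    moreover have "0 \<le> ?\<beta>" by (simp add: ball_prob_def)
    ultimately have "1 \<le> exp (s * ln 2 * n) * ?\<beta>"
      using elim(1) mult_right_mono[of ?K "exp (s * ln 2 * n)" ?\<beta>] unfolding C_def by linarith
    then show ?case by (simp add: exp_minus field_simps)
  qed
  then show ?thesis
    using s by (intro dyadic_lower_bound_of_scales[where \<kappa>="ln 2" and s=s and r="\<lambda>n. 2 * ?d * (1/2) ^ n", OF ball_prob_mono[OF a] _ lim']) auto
qed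

text \<open>At scale the singular value of index \<open>k\<close>, the ball has mass about
  \<open>mass\<close> over \<open>cell_count\<close>; the exponential rate of this quotient is
  compared with \<open>s\<close> times the rate of the scale, and their difference is the
  pressure.\<close>

lemma ellipsoid_lower_bound:
  assumes reg: "regular \<omega>" and a: "a \<in> space trans_measure"
    and ell: "\<And>k. k < CARD('n) \<Longrightarrow> \<forall>\<^sub>F n in sequentially. mass (prefix \<omega> n) \<le> (real n + 1)\<^sup>2 * cell_count k (prefix \<omega> n) *
      ball_prob a \<omega> (2 * real CARD('n) * (1 + 2 * radius) * (sing_vals (word_mat A (prefix \<omega> n)) ! k))"
    and s: "0 \<le> s" "s < real CARD('n)" "- \<infinity> < pressure \<mu> A s \<omega>" "pressure \<mu> A s \<omega> < 0" and q: "s < q"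
  shows "\<forall>\<^sub>F m in sequentially. ((1/2) ^ m) powr q \<le> ball_prob a \<omega> ((1/2) ^ m)"
proof -
  obtain h where h: "0 \<le> h" "lower_entropy \<omega> = ereal h" "(\<lambda>n. - ln (mass (prefix \<omega> n)) / n) \<longlonglongrightarrow> h"
    by (rule regular_entropy[OF reg])
  have "s \<noteq> 0" using pressure_0_nonneg[OF reg] s(4) by auto
  then have s0: "0 < s" using s(1) by simp
  \<comment> \<open>Ceiling minus 1 and not the floor: then \<open>k < s\<close>, so the rate of
    index \<open>k + 1\<close> has a positive coefficient in the pressure at \<open>s\<close>, and
    finiteness of the pressure forces that rate to be finite, even at an integer
    \<open>s\<close>.\<close>
  define k where "k = nat (\<lceil>s\<rceil> - 1)"
  have ks: "real k < s" "s \<le> real k + 1" using s0 unfolding k_def by linarith+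
  then have k: "k < CARD('n)" using s(2) by linarith
  let ?g = "\<lambda>j n. log_growth j (prefix \<omega> n) / real n"
  let ?a = "\<lambda>n. - ln (mass (prefix \<omega> n)) / real n"
  have rate: "pressure_rate s n \<omega> = ?a n + ((real k + 1 - s) * ?g k n + (s - real k) * ?g (Suc k) n)" for n
    unfolding pressure_rate_def ln_sv_fun_interpolation[OF invertible_word_mat less_imp_le[OF ks(1)] ks(2) k s(2)] log_growth_def
    by (simp add: add_divide_distrib)
  have g_le: "?g j n \<le> 0" if "j \<le> CARD('n)" for j n
    using log_growth_nonpos[OF that, of "prefix \<omega> n"] by (simp add: divide_nonpos_nonneg)
  have glim: "(\<lambda>n. ereal (?g j n)) \<longlonglongrightarrow> growth_rate j \<omega>" if "j \<le> CARD('n)" for j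
    by (rule regular_growth(1)[OF reg that])
  have "growth_rate (Suc k) \<omega> \<noteq> - \<infinity>"
  proof
    assume inf: "growth_rate (Suc k) \<omega> = - \<infinity>"
    have "(\<lambda>n. ereal (?a n + (s - real k) * ?g (Suc k) n)) \<longlonglongrightarrow> ereal h + ereal (s - real k) * growth_rate (Suc k) \<omega>"
      using h(3) k ks inf by (intro ereal_tendsto_add ereal_tendsto_mult glim) auto
    moreover have "ereal h + ereal (s - real k) * growth_rate (Suc k) \<omega> = - \<infinity>" using inf ks by simp
    ultimately have "(\<lambda>n. ereal (?a n + (s - real k) * ?g (Suc k) n)) \<longlonglongrightarrow> - \<infinity>" by simp
    note bound_lim = this
    have "pressure \<mu> A s \<omega> \<le> - \<infinity>"
    proof (rule LIMSEQ_le[OF pressure_limit(1)[OF reg s(1)] bound_lim], rule exI)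
      show "\<forall>n\<ge>0. ereal (pressure_rate s n \<omega>) \<le> ereal (?a n + (s - real k) * ?g (Suc k) n)"
      proof (intro allI impI)
        fix n
        have "(real k + 1 - s) * ?g k n \<le> 0" using ks k by (intro mult_nonneg_nonpos g_le) auto
        then show "ereal (pressure_rate s n \<omega>) \<le> ereal (?a n + (s - real k) * ?g (Suc k) n)"
          unfolding rate ereal_less_eq(3) by linarith
      qed
    qed
    then show False using s(3) by simp
  qed
  moreover have "growth_rate (Suc k) \<omega> \<le> 0" using k by (intro regular_growth(2)[OF reg]) simp
  ultimately obtain l1 where l1: "growth_rate (Suc k) \<omega> = ereal l1" by (cases "growth_rate (Suc k) \<omega>") auto
  have "growth_rate (Suc k) \<omega> \<le> growth_rate k \<omega>"
  proof (rule LIMSEQ_le[OF glim glim])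
    show "\<exists>N. \<forall>n\<ge>N. ereal (?g (Suc k) n) \<le> ereal (?g k n)"
      using ln_sing_vals_word_nonpos[OF k] by (auto simp: log_growth_Suc[OF k] intro!: divide_right_mono)
  qed (use k in auto)
  moreover have "growth_rate k \<omega> \<le> 0" using k by (intro regular_growth(2)[OF reg]) simp
  ultimately obtain l0 where l0: "growth_rate k \<omega> = ereal l0" using l1 by (cases "growth_rate k \<omega>") auto
  have g0: "?g k \<longlonglongrightarrow> l0" using glim[of k] k unfolding l0 by simp
  have g1: "?g (Suc k) \<longlonglongrightarrow> l1" using glim[of "Suc k"] k unfolding l1 by simp
  \<comment> \<open>Minus the Lyapunov exponent of the singular value with index \<open>k\<close>.
    It is finite because both growth rates are, and positive by contraction.\<close>
  define \<kappa> where "\<kappa> = l0 - l1"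
  have sv_rate: "(\<lambda>n. - ln (sing_vals (word_mat A (prefix \<omega> n)) ! k) / real n) \<longlonglongrightarrow> \<kappa>"
  proof -
    have "(\<lambda>n. ?g k n - ?g (Suc k) n) \<longlonglongrightarrow> \<kappa>" unfolding \<kappa>_def by (intro tendsto_diff g0 g1)
    moreover have "(\<lambda>n. ?g k n - ?g (Suc k) n) = (\<lambda>n. - ln (sing_vals (word_mat A (prefix \<omega> n)) ! k) / real n)"
      by (simp add: log_growth_Suc[OF k] add_divide_distrib)
    ultimately show ?thesis by simp
  qed
  have \<kappa>: "0 < \<kappa>"
  proof -
    have "- ln c \<le> \<kappa>"
    proof (rule LIMSEQ_le_const[OF sv_rate], intro exI[of _ 1] allI impI)
      fix n :: nat assume n: "1 \<le> n"
      show "- ln c \<le> - ln (sing_vals (word_mat A (prefix \<omega> n)) ! k) / real n"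
        using ln_sing_vals_word_le[OF k, of "prefix \<omega> n"] n by (simp add: field_simps)
    qed
    then show ?thesis using ln_c_neg by linarith
  qed
  \<comment> \<open>Negative pressure rewritten in terms of \<kappa>, using
    \<open>l1 = l0 - \<kappa>\<close>.\<close>
  have Pneg: "h + l0 < (s - real k) * \<kappa>"
  proof -
    have "(\<lambda>n. pressure_rate s n \<omega>) \<longlonglongrightarrow> h + ((real k + 1 - s) * l0 + (s - real k) * l1)"
      unfolding rate by (intro tendsto_intros h(3) g0 g1)
    then have "(\<lambda>n. ereal (pressure_rate s n \<omega>)) \<longlonglongrightarrow> ereal (h + ((real k + 1 - s) * l0 + (s - real k) * l1))" by simp
    from LIMSEQ_unique[OF pressure_limit(1)[OF reg s(1)] this] s(4)
    have "h + ((real k + 1 - s) * l0 + (s - real k) * l1) < 0" by simp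
    then show ?thesis by (simp add: \<kappa>_def algebra_simps)
  qed
  define C where "C = 2 * real CARD('n) * (1 + 2 * radius)"
  have C: "0 < C" unfolding C_def using radius_nonneg by (intro mult_pos_pos) auto
  let ?\<alpha> = "\<lambda>n. sing_vals (word_mat A (prefix \<omega> n)) ! k"
  let ?r = "\<lambda>n. C * ?\<alpha> n"
  have \<alpha>: "0 < ?\<alpha> n" for n by (rule sing_vals_pos[OF invertible_word_mat k])
  have r_lim: "(\<lambda>n. - ln (?r n) / real n) \<longlonglongrightarrow> \<kappa>"
  proof -
    have "(\<lambda>n. - ln C / real n + - ln (?\<alpha> n) / real n) \<longlonglongrightarrow> 0 + \<kappa>"
      by (intro tendsto_add lim_const_over_n sv_rate)
    moreover have "- ln C / real n + - ln (?\<alpha> n) / real n = - ln (?r n) / real n" for n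
      using C \<alpha>[of n] by (simp add: ln_mult_pos add_divide_distrib diff_divide_distrib)
    ultimately show ?thesis by simp
  qed
  \<comment> \<open>An upper bound for \<open>- ln\<close> of the ball mass per step: entropy, the
    quadratic factor, and the logarithm of \<open>cell_count\<close>. Its limit
    \<open>h + l0 + k * \<kappa>\<close> is below \<open>s * \<kappa>\<close> by
    \<open>Pneg\<close>.\<close>
  let ?E = "\<lambda>n. ?a n + 2 * (ln (real n * real (Suc n)) / real n) + real k * ln (2 * radius + 2) / real n + ?g k n +
      real k * (- ln (?\<alpha> n) / real n)"
  have "?E \<longlonglongrightarrow> h + 2 * 0 + 0 + l0 + real k * \<kappa>"
    by (intro tendsto_add tendsto_mult tendsto_const h(3) ln_oblong_over_n_tendsto_0 lim_const_over_n g0 sv_rate)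
  moreover have "h + 2 * 0 + 0 + l0 + real k * \<kappa> < s * \<kappa>" using Pneg by (simp add: algebra_simps)
  ultimately have "\<forall>\<^sub>F n in sequentially. ?E n < s * \<kappa>" by (rule order_tendstoD)
  then have "\<forall>\<^sub>F n in sequentially. exp (- (s * \<kappa> * n)) \<le> ball_prob a \<omega> (?r n)"
    using ell[OF k] eventually_ge_at_top[of 1]
  proof eventually_elim
    case (elim n)
    let ?\<beta> = "ball_prob a \<omega> (?r n)" and ?w = "prefix \<omega> n"
    have m: "0 < mass ?w" using reg by (auto simp: regular_def)
    have cc: "0 < cell_count k ?w" by (rule cell_count_pos[OF k])
    have le: "mass ?w \<le> (real n + 1)\<^sup>2 * cell_count k ?w * ?\<beta>" using elim(2) unfolding C_def .
    have "?\<beta> \<noteq> 0" using le m by auto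
    then have \<beta>: "0 < ?\<beta>" unfolding ball_prob_def using measure_nonneg[of \<mu>] by (simp add: less_le)
    have "ln (mass ?w) \<le> ln ((real n + 1)\<^sup>2 * cell_count k ?w * ?\<beta>)" using le m by (intro ln_mono)
    also have "\<dots> = 2 * ln (real n + 1) + ln (cell_count k ?w) + ln ?\<beta>"
      using cc \<beta> by (simp add: ln_mult_pos ln_realpow)
    also have "ln (cell_count k ?w) = real k * ln (2 * radius + 2) + log_growth k ?w - real k * ln (?\<alpha> n)"
    proof -
      have "0 < 2 * radius + 2" "0 < sv_prod k (word_mat A ?w)"
        using radius_nonneg sv_prod_pos[OF invertible_word_mat less_imp_le[OF k]] by auto
      then show ?thesis
        unfolding cell_count_def log_growth_def using \<alpha>[of n]
        by (subst ln_mult_pos) (auto simp: ln_div ln_realpow)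
    qed
    finally have lnm: "ln (mass ?w) \<le> 2 * ln (real n + 1) + (real k * ln (2 * radius + 2) + log_growth k ?w - real k * ln (?\<alpha> n)) + ln ?\<beta>" .
    have "1 * (real n + 1) \<le> real n * real (Suc n)" using elim(3) by (intro mult_mono) auto
    then have l: "ln (real n + 1) \<le> ln (real n * real (Suc n))" by (intro ln_mono) auto
    have cancel: "x * (a1 / x + 2 * (a2 / x) + a3 / x + a4 / x + y * (a5 / x)) = a1 + 2 * a2 + a3 + a4 + y * a5"
      if "x \<noteq> 0" for x y a1 a2 a3 a4 a5 :: real
      using that by (simp add: distrib_left)
    have "real n * ?E n = - ln (mass ?w) + 2 * ln (real n * real (Suc n)) + real k * ln (2 * radius + 2) + log_growth k ?w + real k * (- ln (?\<alpha> n))"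
      by (rule cancel) (use elim(3) in simp)
    moreover have "real n * ?E n \<le> real n * (s * \<kappa>)" using elim(1) by (intro mult_left_mono) auto
    ultimately have "- (s * \<kappa> * n) \<le> ln ?\<beta>" using lnm l by (simp add: mult_ac)
    then have "exp (- (s * \<kappa> * n)) \<le> exp (ln ?\<beta>)" by simp
    then show ?case using \<beta> by simp
  qed
  then show ?thesis
    using s q \<kappa> C \<alpha> by (intro dyadic_lower_bound_of_scales[where \<kappa>=\<kappa> and s=s and r="?r", OF ball_prob_mono[OF a] _ r_lim]) auto
qed

section \<open>Dimension of the projected measure\<close>

lemma dimLY_nonneg: "0 \<le> dimLY \<mu> A \<omega>"
  unfolding dimLY_def by (rule Inf_greatest) auto

text \<open>Below \<open>D\<close> the pressure is nonnegative by the definition of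
  \<open>dimLY\<close>. Above \<open>D\<close>, exponents beyond the dimension are handled by cubes,
  and the remaining ones by ellipsoids.\<close>

lemma dyadic_dim_projection:
  assumes reg: "regular \<omega>" and a: "a \<in> space trans_measure"
    and mass_bound: "\<forall>q::rat. 0 \<le> q \<longrightarrow> real_of_rat q < real CARD('n) \<longrightarrow>
     (\<Sum>n. ennreal (mass (prefix \<omega> n) / sv_fun (real_of_rat q) (word_mat A (prefix \<omega> n)))) < \<infinity> \<longrightarrow>
     (\<exists>N. \<forall>m\<ge>N. ball_mass a \<omega> ((1/2) ^ m) \<le> ennreal ((real m + 1)\<^sup>2 * ((1/2) ^ m) powr real_of_rat q))"
    and cube: "\<forall>\<^sub>F n in sequentially. 1 \<le> (real n + 1)\<^sup>2 * ((2 * radius + 2) * 2 ^ n) ^ CARD('n) *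
      ball_prob a \<omega> (2 * real CARD('n) * (1/2) ^ n)"
    and ell: "\<And>k. k < CARD('n) \<Longrightarrow> \<forall>\<^sub>F n in sequentially. mass (prefix \<omega> n) \<le> (real n + 1)\<^sup>2 * cell_count k (prefix \<omega> n) *
      ball_prob a \<omega> (2 * real CARD('n) * (1 + 2 * radius) * (sing_vals (word_mat A (prefix \<omega> n)) ! k))"
    and s0: "0 \<le> s0" "- \<infinity> < pressure \<mu> A s0 \<omega>" "pressure \<mu> A s0 \<omega> < 0"
    and D: "ereal D = min (ereal (real CARD('n))) (dimLY \<mu> A \<omega>)"
  shows "dyadic_dim (distr \<mu> borel (coding_map A a)) (coding_map A a \<omega>) D"
  unfolding dyadic_dim_def measure_distr_ball[OF a]
proof (intro allI conjI impI)
  fix q :: rat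
  let ?q = "real_of_rat q"
  have Dd: "D \<le> real CARD('n)" using D by (metis ereal_less_eq(3) min.cobounded1)
  have DL: "ereal D \<le> dimLY \<mu> A \<omega>" unfolding D by simp
  show "\<forall>\<^sub>F m in sequentially. ball_prob a \<omega> ((1/2) ^ m) \<le> ((1/2) ^ m) powr ?q" if q: "?q < D"
  proof (rule ball_prob_upper[OF reg a mass_bound Dd _ q])
    fix s assume s: "0 \<le> s" "s < D"
    show "0 \<le> pressure \<mu> A s \<omega>"
    proof (rule ccontr)
      assume "\<not> 0 \<le> pressure \<mu> A s \<omega>"
      then have "dimLY \<mu> A \<omega> \<le> ereal s" unfolding dimLY_def using s(1) by (intro Inf_lower) auto
      then have "ereal D \<le> ereal s" using DL by (rule order_trans[rotated])
      then show False using s(2) by simp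
    qed
  qed
  show "\<forall>\<^sub>F m in sequentially. ((1/2) ^ m) powr ?q \<le> ball_prob a \<omega> ((1/2) ^ m)" if q: "D < ?q"
  proof (cases "real CARD('n) < ?q")
    case True
    show ?thesis by (rule cube_lower_bound[OF a cube True])
  next
    case False
    then have "D < real CARD('n)" using q by linarith
    then have "dimLY \<mu> A \<omega> = ereal D" using D by (auto simp: min_def split: if_splits)
    then have "dimLY \<mu> A \<omega> < ereal ?q" using q by simp
    then obtain s1 where s1: "0 \<le> s1" "pressure \<mu> A s1 \<omega> < 0" "s1 < ?q"
      unfolding dimLY_def Inf_less_iff by auto
    \<comment> \<open>The pressure at \<open>s1\<close> is negative but may be minus infinity, while
      \<open>s0\<close> need not be below \<open>q\<close>. The smaller of the two has both
      properties: the pressure there is negative, and by monotonicity at least the finite pressure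
      at \<open>s0\<close>.\<close>
    define s where "s = min s0 s1"
    have s: "0 \<le> s" "s < ?q" "s < real CARD('n)" using s0(1) s1 False by (auto simp: s_def)
    have "pressure \<mu> A s0 \<omega> \<le> pressure \<mu> A s \<omega>"
      by (rule pressure_antimono[OF reg s(1) _ s(3)]) (simp add: s_def)
    then have "- \<infinity> < pressure \<mu> A s \<omega>" using s0(2) by (rule less_le_trans[rotated])
    moreover have "pressure \<mu> A s \<omega> < 0" using s0(3) s1(2) by (simp add: s_def min_def)
    ultimately show ?thesis by (intro ellipsoid_lower_bound[OF reg a ell s(1,3) _ _ s(2)]) auto
  qed
qed

lemma dim_real:
  assumes "0 \<le> x"
  obtains D where "0 \<le> D" "ereal D = min (ereal (real CARD('n))) x"
proof (cases x)
  case (real r)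
  then show thesis using assms that[of "min (real CARD('n)) r"] by (auto simp: min_def)
next
  case PInf
  then show thesis using that[of "real CARD('n)"] by simp
qed (use assms in simp)

lemma AE_dyadic_dim:
  assumes ent: "Defs.entropy \<mu> < \<infinity>"
  shows "AE a in trans_measure. AE \<omega> in \<mu>.
    (\<exists>s\<ge>0. - \<infinity> < pressure \<mu> A s \<omega> \<and> pressure \<mu> A s \<omega> < 0) \<longrightarrow>
    (\<forall>D. ereal D = min (ereal (real CARD('n))) (dimLY \<mu> A \<omega>) \<longrightarrow>
      dyadic_dim (distr \<mu> borel (coding_map A a)) (coding_map A a \<omega>) D)"
  using AE_ball_mass_le AE_space
proof eventually_elim
  case (elim a)
  note a = elim(2)
  have ell: "AE \<omega> in \<mu>. \<forall>k. k < CARD('n) \<longrightarrow> (\<forall>\<^sub>F n in sequentially. mass (prefix \<omega> n) \<le> (real n + 1)\<^sup>2 * cell_count k (prefix \<omega> n) *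
      ball_prob a \<omega> (2 * real CARD('n) * (1 + 2 * radius) * (sing_vals (word_mat A (prefix \<omega> n)) ! k)))"
    unfolding AE_all_countable
  proof
    fix k
    show "AE \<omega> in \<mu>. k < CARD('n) \<longrightarrow> (\<forall>\<^sub>F n in sequentially. mass (prefix \<omega> n) \<le> (real n + 1)\<^sup>2 * cell_count k (prefix \<omega> n) *
      ball_prob a \<omega> (2 * real CARD('n) * (1 + 2 * radius) * (sing_vals (word_mat A (prefix \<omega> n)) ! k)))"
    proof (cases "k < CARD('n)")
      case True
      then show ?thesis using AE_ellipsoid_lower[OF a True] by simp
    qed simp
  qed
  from elim(1) AE_regular[OF ent] AE_cube_lower[OF a] ell show ?case
  proof eventually_elim
    case (elim \<omega>)
    show ?case
    proof (intro impI allI)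
      fix D
      assume "\<exists>s\<ge>0. - \<infinity> < pressure \<mu> A s \<omega> \<and> pressure \<mu> A s \<omega> < 0"
      then obtain s0 where s0: "0 \<le> s0" "- \<infinity> < pressure \<mu> A s0 \<omega>" "pressure \<mu> A s0 \<omega> < 0" by blast
      assume D: "ereal D = min (ereal (real CARD('n))) (dimLY \<mu> A \<omega>)"
      show "dyadic_dim (distr \<mu> borel (coding_map A a)) (coding_map A a \<omega>) D"
        by (rule dyadic_dim_projection[OF elim(2) a elim(1) elim(3) _ s0 D]) (use elim(4) in blast)
    qed
  qed
qed

lemma proj_eq_coding:
  assumes a: "a \<in> space trans_measure"
  shows "proj A a = coding_map A a"
proof
  fix \<omega>
  show "proj A a \<omega> = coding_map A a \<omega>"
    by (rule proj_eq_coding_map[where a=a and D="real CARD('n)", OF norm_translation_le[OF a]]) simp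
qed

lemma prob_space_projection:
  assumes a: "a \<in> space trans_measure"
  shows "prob_space (distr \<mu> borel (coding_map A a))"
  by (rule prob_space_distr[OF coding_measurable_\<mu>[OF a]])

lemma AE_local_dim:
  assumes ent: "Defs.entropy \<mu> < \<infinity>"
  shows "AE a in trans_measure. AE \<omega> in \<mu>.
    (\<exists>s\<ge>0. - \<infinity> < pressure \<mu> A s \<omega> \<and> pressure \<mu> A s \<omega> < 0) \<longrightarrow>
    local_dim_eq (distr \<mu> borel (proj A a)) (proj A a \<omega>) (min (ereal (real CARD('n))) (dimLY \<mu> A \<omega>))"
  using AE_dyadic_dim[OF ent] AE_space
proof eventually_elim
  case (elim a)
  note a = elim(2)
  from elim(1) show ?case
    unfolding proj_eq_coding[OF a]
  proof (rule AE_mp, intro AE_I2 impI)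
    fix \<omega>
    assume "(\<exists>s\<ge>0. - \<infinity> < pressure \<mu> A s \<omega> \<and> pressure \<mu> A s \<omega> < 0) \<longrightarrow>
      (\<forall>D. ereal D = min (ereal (real CARD('n))) (dimLY \<mu> A \<omega>) \<longrightarrow>
        dyadic_dim (distr \<mu> borel (coding_map A a)) (coding_map A a \<omega>) D)"
      and "\<exists>s\<ge>0. - \<infinity> < pressure \<mu> A s \<omega> \<and> pressure \<mu> A s \<omega> < 0"
    moreover obtain D where D: "0 \<le> D" "ereal D = min (ereal (real CARD('n))) (dimLY \<mu> A \<omega>)"
      by (rule dim_real[OF dimLY_nonneg])
    ultimately have "dyadic_dim (distr \<mu> borel (coding_map A a)) (coding_map A a \<omega>) D" by blast
    from local_dim_eq_of_dyadic_dim[OF prob_space_projection[OF a] _ D(1) this]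
    show "local_dim_eq (distr \<mu> borel (coding_map A a)) (coding_map A a \<omega>) (min (ereal (real CARD('n))) (dimLY \<mu> A \<omega>))"
      unfolding D(2) by simp
  qed
qed

text \<open>\<open>dimLY\<close> is a function of the lower entropy and finitely many growth rates.
  Each of these is measurable and invariant, hence constant, which spares a measurability proof for
  \<open>dimLY\<close> itself.\<close>

lemma ergodic_dimLY_const:
  assumes ent: "Defs.entropy \<mu> < \<infinity>"
    and erg: "\<And>X. X \<in> sets \<mu> \<Longrightarrow> shift -` X = X \<Longrightarrow> measure \<mu> X = 0 \<or> measure \<mu> X = 1"
  shows "\<exists>D. AE \<omega> in \<mu>. dimLY \<mu> A \<omega> = D"
proof -
  obtain h where h: "AE \<omega> in \<mu>. lower_entropy \<omega> = h"
    using AE_invariant_const[OF erg lower_entropy_measurable lower_entropy_invariant] by blast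
  have "\<exists>c. AE \<omega> in \<mu>. k \<le> CARD('n) \<longrightarrow> growth_rate k \<omega> = c" for k
  proof (cases "k \<le> CARD('n)")
    case True
    have inv: "AE \<omega> in \<mu>. growth_rate k (shift \<omega>) = growth_rate k \<omega>"
      unfolding growth_rate_def
      by (rule lower_rate_invariant[OF log_growth_append[OF True] log_growth_nonpos[OF True]])
    have m: "growth_rate k \<in> borel_measurable \<mu>"
      unfolding growth_rate_def by (rule lower_rate_measurable)
    from AE_invariant_const[OF erg m inv] obtain c where "AE \<omega> in \<mu>. growth_rate k \<omega> = c" by blast
    then show ?thesis using True by auto
  qed simp
  then have "\<forall>k. \<exists>c. AE \<omega> in \<mu>. k \<le> CARD('n) \<longrightarrow> growth_rate k \<omega> = c" ..
  from choice[OF this] obtain L where "\<forall>k. AE \<omega> in \<mu>. k \<le> CARD('n) \<longrightarrow> growth_rate k \<omega> = L k" ..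
  then have L: "AE \<omega> in \<mu>. \<forall>k. k \<le> CARD('n) \<longrightarrow> growth_rate k \<omega> = L k" unfolding AE_all_countable .
  have "AE \<omega> in \<mu>. dimLY \<mu> A \<omega> = Inf (ereal ` {s. 0 \<le> s \<and> h + energy L s < 0})"
    using AE_regular[OF ent] h L
  proof eventually_elim
    case (elim \<omega>)
    have "pressure \<mu> A s \<omega> = h + energy L s" if s: "0 \<le> s" for s
    proof -
      have "energy (\<lambda>k. growth_rate k \<omega>) s = energy L s"
      proof (cases "s < real CARD('n)")
        case True
        then have "nat \<lfloor>s\<rfloor> < CARD('n)" using nat_floor_bounds(1)[OF s] by linarith
        then show ?thesis using elim(3) True by (simp add: energy_def)
      next
        case False then show ?thesis using elim(3) by (simp add: energy_def)
      qed
      then show ?thesis using pressure_limit(2)[OF elim(1) s] elim(2) by simp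
    qed
    then have "{s. 0 \<le> s \<and> pressure \<mu> A s \<omega> < 0} = {s. 0 \<le> s \<and> h + energy L s < 0}" by auto
    then show ?case unfolding dimLY_def by simp
  qed
  then show ?thesis ..
qed

text \<open>With a constant dimension the statement about \<omega> becomes one about the projected
  point alone. Moving it to the image measure uses measurability of the set of points with
  \<open>dyadic_dim\<close>.\<close>

lemma AE_exact_dimensional:
  assumes ent: "Defs.entropy \<mu> < \<infinity>" and D: "AE \<omega> in \<mu>. dimLY \<mu> A \<omega> = D"
    and s: "0 \<le> s" "AE \<omega> in \<mu>. - \<infinity> < pressure \<mu> A s \<omega> \<and> pressure \<mu> A s \<omega> < 0"
  shows "AE a in trans_measure. AE x in distr \<mu> borel (proj A a).
    local_dim_eq (distr \<mu> borel (proj A a)) x (min (ereal (real CARD('n))) D)"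
  using AE_dyadic_dim[OF ent] AE_space
proof eventually_elim
  case (elim a)
  note a = elim(2)
  let ?\<nu> = "distr \<mu> borel (coding_map A a)"
  have "0 \<le> D"
  proof -
    have "AE \<omega> in \<mu>. 0 \<le> D" using D by eventually_elim (use dimLY_nonneg in blast)
    then show ?thesis by simp
  qed
  then obtain D' where D': "0 \<le> D'" "ereal D' = min (ereal (real CARD('n))) D" by (rule dim_real)
  have "AE \<omega> in \<mu>. dyadic_dim ?\<nu> (coding_map A a \<omega>) D'"
    using elim(1) D s(2)
  proof eventually_elim
    case (elim \<omega>)
    have "ereal D' = min (ereal (real CARD('n))) (dimLY \<mu> A \<omega>)" unfolding elim(2) by (rule D'(2))
    then show ?case using elim(1,3) s(1) by blast
  qed
  then have "AE x in ?\<nu>. dyadic_dim ?\<nu> x D'"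
    using dyadic_dim_measurable[OF prob_space_projection[OF a], of D']
    by (subst AE_distr_iff[OF coding_measurable_\<mu>[OF a]]) auto
  then show ?case
    unfolding proj_eq_coding[OF a]
  proof (rule AE_mp, intro AE_I2 impI)
    fix x assume "dyadic_dim ?\<nu> x D'"
    from local_dim_eq_of_dyadic_dim[OF prob_space_projection[OF a] _ D'(1) this]
    show "local_dim_eq ?\<nu> x (min (ereal (real CARD('n))) D)" unfolding D'(2) by simp
  qed
qed

end

lemma ifs_measureI:
  fixes A :: "'i::countable \<Rightarrow> real^'n^'n" and \<mu> :: "(nat \<Rightarrow> 'i) measure"
  assumes invA: "\<forall>i. invertible (A i)"
    and normA: "\<exists>c<1/2. \<forall>i. onorm (\<lambda>x. A i *v x) \<le> c"
    and mu_inv: "invariant_prob \<mu>"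
  shows "\<exists>c. ifs_measure A c \<mu>"
proof -
  obtain c0 where c0: "c0 < 1/2" "\<And>i. onorm (\<lambda>x. A i *v x) \<le> c0" using normA by blast
  \<comment> \<open>The maximum with 1/4 secures a positive constant that is still below
    1/2.\<close>
  define c where "c = max c0 (1/4)"
  have "norm (A i *v x) \<le> c * norm x" for i x
  proof -
    have "norm (A i *v x) \<le> onorm (\<lambda>x. A i *v x) * norm x" by (rule onorm[OF matrix_vector_mul_bounded_linear])
    also have "\<dots> \<le> c * norm x" using c0(2)[of i] by (intro mult_right_mono) (auto simp: c_def)
    finally show ?thesis .
  qed
  moreover have "0 < c" "c < 1/2" using c0(1) by (auto simp: c_def)
  ultimately have "contracting_ifs A c" using invA by unfold_locales auto
  moreover have "invariant_shift \<mu>"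
    using mu_inv unfolding invariant_prob_def invariant_shift_def invariant_shift_axioms_def by blast
  ultimately have "ifs_measure A c \<mu>" by (simp add: ifs_measure_def)
  then show ?thesis ..
qed

theorem mainTheorem1:
  fixes A :: "'i::countable \<Rightarrow> real^'n^'n" and \<mu> :: "(nat \<Rightarrow> 'i) measure"
  assumes invA: "\<forall>i. invertible (A i)"
    and normA: "\<exists>c<1/2. \<forall>i. onorm (\<lambda>x. A i *v x) \<le> c"
    and mu_inv: "invariant_prob \<mu>"
    and ent: "entropy \<mu> < \<infinity>"
  shows "(AE a in trans_measure. AE \<omega> in \<mu>.
            (\<exists>s\<ge>0. - \<infinity> < pressure \<mu> A s \<omega> \<and> pressure \<mu> A s \<omega> < 0) \<longrightarrow>
            local_dim_eq (distr \<mu> borel (proj A a)) (proj A a \<omega>)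
              (min (ereal (real CARD('n))) (dimLY \<mu> A \<omega>)))
       \<and> (ergodic_prob \<mu> \<and> (\<exists>s\<ge>0. AE \<omega> in \<mu>. - \<infinity> < pressure \<mu> A s \<omega> \<and> pressure \<mu> A s \<omega> < 0)
           \<longrightarrow> (\<exists>D. (AE \<omega> in \<mu>. dimLY \<mu> A \<omega> = D) \<and>
                (AE a in trans_measure. AE x in distr \<mu> borel (proj A a).
                   local_dim_eq (distr \<mu> borel (proj A a)) x (min (ereal (real CARD('n))) D))))"
proof -
  obtain c where "ifs_measure A c \<mu>" using ifs_measureI[OF invA normA mu_inv] by blast
  then interpret ifs_measure A c \<mu> .
  show ?thesis
  proof (intro conjI impI, rule AE_local_dim[OF ent])
    assume erg: "ergodic_prob \<mu> \<and> (\<exists>s\<ge>0. AE \<omega> in \<mu>. - \<infinity> < pressure \<mu> A s \<omega> \<and> pressure \<mu> A s \<omega> < 0)"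
    then have "\<And>X. X \<in> sets \<mu> \<Longrightarrow> shift -` X = X \<Longrightarrow> measure \<mu> X = 0 \<or> measure \<mu> X = 1"
      unfolding ergodic_prob_def by blast
    from ergodic_dimLY_const[OF ent this] obtain D where D: "AE \<omega> in \<mu>. dimLY \<mu> A \<omega> = D" by blast
    obtain s where "0 \<le> s" "AE \<omega> in \<mu>. - \<infinity> < pressure \<mu> A s \<omega> \<and> pressure \<mu> A s \<omega> < 0" using erg by blast
    from AE_exact_dimensional[OF ent D this] D
    show "\<exists>D. (AE \<omega> in \<mu>. dimLY \<mu> A \<omega> = D) \<and>
      (AE a in trans_measure. AE x in distr \<mu> borel (proj A a).
         local_dim_eq (distr \<mu> borel (proj A a)) x (min (ereal (real CARD('n))) D))"
      by blast
  qed
qed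

end
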